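(* Consider the local search algorithm $\textsc{LS}(A,w,\varepsilon)$, taking a full solution $(A,w)$ and $\varepsilon>0$: let $\hat t=\sum_{n\in N}s_n/|A|$; repeat: pick $c_{\min}\in A$ with $t_{\min}=\mathrm{supp}_w(c_{\min})=\mathrm{supp}_w(A)$; pick $c_{\max}\in C\setminus A$ with highest score $t_{\max}=\mathrm{score}_{(A,w)}(c_{\max})=\max_{c'\in C\setminus A}\mathrm{score}_{(A,w)}(c')$; if $t_{\max}<\min\{(1+\varepsilon)t_{\min},\hat t\}$ return $(A,w)$; otherwise update $(A,w)\leftarrow\textsc{Insert}(A\setminus\{c_{\min}\},w,c_{\max},t_{\max})$. For any $\varepsilon>0$ and any full solution $(A,w)$, let $(A',w')$ be the output of $\textsc{LS}(A,w,\varepsilon)$. Then: 1. $(A',w')$ is a full (feasible) solution and $\mathrm{supp}_{w'}(A')\ge\mathrm{supp}_w(A)$; 2. for $t=\min\{(1+\varepsilon)\mathrm{supp}_{w'}(A'),\hat t\}$ with $\hat t=\sum_{n\in N}s_n/k$, one has $\max_{c'\in C\setminus A'}\mathrm{prescore}_{(A',w')}(c',t)<t$; hence $A'$ satisfies $t$-PJR and PJR; 3. if $(A,w)$ is an $\alpha$-approximation for maximin support for some $\alpha\ge1$, then the algorithm performs at most $k(1+\log_{1+\varepsilon}\alpha)+1$ iterations, each taking time $O(|E|\log k)$; 4. in the limit $\varepsilon\to\infty$ (i.e. with stopping test $t_{\max}<\hat t$), the algorithm finds a solution whose committee satisfies PJR in at most $k+1$ iterations.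
   Context: An election instance consists of a finite bipartite graph $G=(N\cup C,E)$ with no isolated vertices ($N$ = voters, $C$ = candidates), a vector $s\in\mathbb{R}^N$ of non-negative vote strengths, and an integer $k$ with $0<k<|C|$. Write $nc$ for $\{n,c\}$, $C_n=\{c: nc\in E\}$, $N_c=\{n: nc\in E\}$. A weight vector $w\in\mathbb{R}^E$ is feasible if $w\ge0$ and $\sum_{c\in C_n}w_{nc}\le s_n$ for all $n$. $\mathrm{supp}_w(c)=\sum_{n\in N_c}w_{nc}$, $\mathrm{supp}_w(A)=\min_{c\in A}\mathrm{supp}_w(c)$, $\mathrm{supp}_w(\emptyset)=\infty$. A solution is $(A,w)$ with $A\subseteq C$, $|A|\le k$, $w$ feasible; full if $|A|=k$. OPT is the maximum of $\mathrm{supp}_w(A)$ over full solutions (maximin support problem); a full solution is an $\alpha$-approximation if $\mathrm{supp}_w(A)\ge\mathrm{OPT}/\alpha$. Numerical operations take constant time. For a (possibly partial) committee $A$ with feasible $w$, $n\in N$, $t\ge0$: $\mathrm{slack}(n,t)=s_n-\sum_{c\in A\cap C_n}w_{nc}\min\{1,t/\mathrm{supp}_w(c)\}$; for $c'\in C\setminus A$, $\mathrm{prescore}_{(A,w)}(c',t)=\sum_{n\in N_{c'}}\mathrm{slack}(n,t)$, $\mathrm{score}_{(A,w)}(c')=\max\{t\ge0:\mathrm{prescore}_{(A,w)}(c',t)\ge t\}$. $\textsc{Insert}(A,w,c',t)$ returns $(A\cup\{c'\},w')$ where $w'$ starts equal to $w$ and, for each $n\in N_{c'}$, sets $w'_{nc}=w_{nc}\,t/\mathrm{supp}_w(c)$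 for each $c\in A\cap C_n$ with $\mathrm{supp}_w(c)>t$, and $w'_{nc'}=s_n-\sum_{c\in A\cap C_n}w'_{nc}$. For $t\in\mathbb{R}$, a committee $A$ (any size) satisfies $t$-PJR if there is no $N'\subseteq N$ and integer $0<r\le|A|$ with (a) $\sum_{n\in N'}s_n\ge rt$, (b) $|\bigcap_{n\in N'}C_n|\ge r$, (c) $|A\cap\bigcup_{n\in N'}C_n|<r$. A committee $A$ with $|A|=k$ satisfies PJR if it satisfies $t$-PJR for $t=\sum_{n\in N}s_n/k$.
   Formalization: Before Insert, weights outside A∖{c_min} are set to 0 (else the result can be infeasible); termination is claimed only if OPT>0 (item 4: if the total vote strength is positive), as LS otherwise never returns; log k is read as max(1, log₂ k), since it is 0 at k=1. *)

theory Defs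
  imports Complex_Main
begin

section \<open>Election instances and the maximin support problem\<close>

text \<open>The two sides of the bipartite graph live in different types, hence are disjoint. A weight
  vector is a total function of which only the values on edges are ever used.\<close>

record ('v, 'c) election =
  voters :: "'v set"
  cands :: "'c set"
  edges :: "('v \<times> 'c) set"
  strength :: "'v \<Rightarrow> real"
  seats :: nat

definition valid_election :: "('v, 'c) election \<Rightarrow> bool" where
  "valid_election I \<longleftrightarrow>
     finite (voters I) \<and> finite (cands I) \<and>
     edges I \<subseteq> voters I \<times> cands I \<and>
     (\<forall>n\<in>voters I. \<exists>c. (n, c) \<in> edges I) \<and>
     (\<forall>c\<in>cands I. \<exists>n. (n, c) \<in> edges I) \<and>
     (\<forall>n\<in>voters I. 0 \<le> strength I n) \<and>
     0 < seats I \<and> seats I < card (cands I)"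

definition cands_of :: "('v, 'c) election \<Rightarrow> 'v \<Rightarrow> 'c set" where
  "cands_of I n = {c. (n, c) \<in> edges I}"

definition voters_of :: "('v, 'c) election \<Rightarrow> 'c \<Rightarrow> 'v set" where
  "voters_of I c = {n. (n, c) \<in> edges I}"

type_synonym ('v, 'c) weight = "'v \<Rightarrow> 'c \<Rightarrow> real"

definition feasible :: "('v, 'c) election \<Rightarrow> ('v, 'c) weight \<Rightarrow> bool" where
  "feasible I w \<longleftrightarrow>
     (\<forall>(n, c)\<in>edges I. 0 \<le> w n c) \<and>
     (\<forall>n\<in>voters I. (\<Sum>c\<in>cands_of I n. w n c) \<le> strength I n)"

definition supp :: "('v, 'c) election \<Rightarrow> ('v, 'c) weight \<Rightarrow> 'c \<Rightarrow> real" where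
  "supp I w c = (\<Sum>n\<in>voters_of I c. w n c)"

text \<open>The support of a committee is only ever taken of full, hence nonempty, committees; so the
  value \<open>\<infinity>\<close> for the empty committee is not represented.\<close>

definition supp_set :: "('v, 'c) election \<Rightarrow> ('v, 'c) weight \<Rightarrow> 'c set \<Rightarrow> real" where
  "supp_set I w A = Min (supp I w ` A)"

definition solution :: "('v, 'c) election \<Rightarrow> 'c set \<Rightarrow> ('v, 'c) weight \<Rightarrow> bool" where
  "solution I A w \<longleftrightarrow> A \<subseteq> cands I \<and> card A \<le> seats I \<and> feasible I w"

definition full_solution :: "('v, 'c) election \<Rightarrow> 'c set \<Rightarrow> ('v, 'c) weight \<Rightarrow> bool" where
  "full_solution I A w \<longleftrightarrow> solution I A w \<and> card A = seats I"

definition OPT :: "('v, 'c) election \<Rightarrow> real" where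
  "OPT I = (GREATEST v. \<exists>A w. full_solution I A w \<and> v = supp_set I w A)"

definition approximation :: "('v, 'c) election \<Rightarrow> real \<Rightarrow> 'c set \<Rightarrow> ('v, 'c) weight \<Rightarrow> bool" where
  "approximation I \<alpha> A w \<longleftrightarrow> full_solution I A w \<and> supp_set I w A \<ge> OPT I / \<alpha>"

section \<open>Scores, insertion, and proportional justified representation\<close>

text \<open>If \<open>supp I w c = 0\<close> then all \<open>w n c\<close> vanish, so the value of the quotient below is
  irrelevant.\<close>

definition slack :: "('v, 'c) election \<Rightarrow> 'c set \<Rightarrow> ('v, 'c) weight \<Rightarrow> 'v \<Rightarrow> real \<Rightarrow> real" where
  "slack I A w n t =
     strength I n - (\<Sum>c\<in>A \<inter> cands_of I n. w n c * min 1 (t / supp I w c))"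

definition prescore :: "('v, 'c) election \<Rightarrow> 'c set \<Rightarrow> ('v, 'c) weight \<Rightarrow> 'c \<Rightarrow> real \<Rightarrow> real" where
  "prescore I A w c' t = (\<Sum>n\<in>voters_of I c'. slack I A w n t)"

definition score :: "('v, 'c) election \<Rightarrow> 'c set \<Rightarrow> ('v, 'c) weight \<Rightarrow> 'c \<Rightarrow> real" where
  "score I A w c' = (GREATEST t. 0 \<le> t \<and> prescore I A w c' t \<ge> t)"

definition max_score :: "('v, 'c) election \<Rightarrow> 'c set \<Rightarrow> ('v, 'c) weight \<Rightarrow> real" where
  "max_score I A w = Max (score I A w ` (cands I - A))"

definition insert_cand ::
  "('v, 'c) election \<Rightarrow> 'c set \<Rightarrow> ('v, 'c) weight \<Rightarrow> 'c \<Rightarrow> real \<Rightarrow> 'c set \<times> ('v, 'c) weight" where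
  "insert_cand I A w c' t =
     (let w1 = (\<lambda>n c. if n \<in> voters_of I c' \<and> c \<in> A \<inter> cands_of I n \<and> supp I w c > t
                      then w n c * t / supp I w c else w n c)
      in (A \<union> {c'},
          \<lambda>n c. if n \<in> voters_of I c' \<and> c = c'
                then strength I n - (\<Sum>d\<in>A \<inter> cands_of I n. w1 n d)
                else w1 n c))"

text \<open>For the empty group the intersection of the approval sets is \<open>cands I\<close>.\<close>

definition t_PJR :: "('v, 'c) election \<Rightarrow> real \<Rightarrow> 'c set \<Rightarrow> bool" where
  "t_PJR I t A \<longleftrightarrow>
     \<not> (\<exists>N' r. N' \<subseteq> voters I \<and> 0 < r \<and> r \<le> card A \<and>
          (\<Sum>n\<in>N'. strength I n) \<ge> real r * t \<and>
          card (cands I \<inter> (\<Inter>n\<in>N'. cands_of I n)) \<ge> r \<and>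
          card (A \<inter> (\<Union>n\<in>N'. cands_of I n)) < r)"

definition PJR :: "('v, 'c) election \<Rightarrow> 'c set \<Rightarrow> bool" where
  "PJR I A \<longleftrightarrow>
     card A = seats I \<and> t_PJR I ((\<Sum>n\<in>voters I. strength I n) / real (seats I)) A"

section \<open>The local search algorithm\<close>

definition t_hat :: "('v, 'c) election \<Rightarrow> 'c set \<Rightarrow> real" where
  "t_hat I A = (\<Sum>n\<in>voters I. strength I n) / real (card A)"

text \<open>The value the highest score is compared with, for a start from committee \<open>A\<close> and current
  solution \<open>(B, u)\<close>; the second definition is the limit \<open>\<epsilon> \<longlonglongrightarrow> \<infinity>\<close>.\<close>

definition ls_threshold ::
  "('v, 'c) election \<Rightarrow> real \<Rightarrow> 'c set \<Rightarrow> 'c set \<times> ('v, 'c) weight \<Rightarrow> real" where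
  "ls_threshold I \<epsilon> A = (\<lambda>(B, u). min ((1 + \<epsilon>) * supp_set I u B) (t_hat I A))"

definition ls_threshold_inf ::
  "('v, 'c) election \<Rightarrow> 'c set \<Rightarrow> 'c set \<times> ('v, 'c) weight \<Rightarrow> real" where
  "ls_threshold_inf I A = (\<lambda>(B, u). t_hat I A)"

definition ls_stop ::
  "('v, 'c) election \<Rightarrow> ('c set \<times> ('v, 'c) weight \<Rightarrow> real) \<Rightarrow> 'c set \<times> ('v, 'c) weight \<Rightarrow> bool" where
  "ls_stop I \<theta> = (\<lambda>(B, u). max_score I B u < \<theta> (B, u))"

text \<open>An iteration that does not return. Ties for \<open>cmin\<close> and \<open>cmax\<close> may be broken arbitrarily.
  Only the weights on the remaining committee are handed to the insertion: it reassigns all the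
  strength that a voter of \<open>cmax\<close> does not give to members, so weight left over on \<open>cmin\<close> or on
  other non-members would make the result infeasible.\<close>

inductive ls_step ::
  "('v, 'c) election \<Rightarrow> ('c set \<times> ('v, 'c) weight \<Rightarrow> real) \<Rightarrow>
   'c set \<times> ('v, 'c) weight \<Rightarrow> 'c set \<times> ('v, 'c) weight \<Rightarrow> bool"
  for I \<theta> where
  "\<lbrakk>cmin \<in> B; supp I u cmin = supp_set I u B;
    cmax \<in> cands I - B; tmax = score I B u cmax; tmax = max_score I B u;
    \<not> ls_stop I \<theta> (B, u);
    u0 = (\<lambda>n c. if c \<in> B - {cmin} then u n c else 0)\<rbrakk>
   \<Longrightarrow> ls_step I \<theta> (B, u) (insert_cand I (B - {cmin}) u0 cmax tmax)"

text \<open>\<open>ls_returns I \<theta> S i S'\<close>: some execution from \<open>S\<close> returns \<open>S'\<close> in its \<open>i\<close>-th iteration.\<close>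

definition ls_returns ::
  "('v, 'c) election \<Rightarrow> ('c set \<times> ('v, 'c) weight \<Rightarrow> real) \<Rightarrow>
   'c set \<times> ('v, 'c) weight \<Rightarrow> nat \<Rightarrow> 'c set \<times> ('v, 'c) weight \<Rightarrow> bool" where
  "ls_returns I \<theta> S i S' \<longleftrightarrow>
     (\<exists>j. i = Suc j \<and> (ls_step I \<theta> ^^ j) S S' \<and> ls_stop I \<theta> S')"

text \<open>Every execution from \<open>S\<close> returns, after performing at most \<open>b\<close> iterations (the one that
  returns included).\<close>

definition ls_terminates_within ::
  "('v, 'c) election \<Rightarrow> ('c set \<times> ('v, 'c) weight \<Rightarrow> real) \<Rightarrow>
   'c set \<times> ('v, 'c) weight \<Rightarrow> real \<Rightarrow> bool" where
  "ls_terminates_within I \<theta> S b \<longleftrightarrow>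
     (\<forall>j S'. (ls_step I \<theta> ^^ j) S S' \<longrightarrow>
        real (Suc j) \<le> b \<and> (ls_stop I \<theta> S' \<or> (\<exists>S''. ls_step I \<theta> S' S'')))"

section \<open>A real RAM with unit-cost operations\<close>

text \<open>Memory consists of named arrays of naturals (also used as indices) and of reals; scalars are
  kept in cell 0. Every operator, memory access and command costs one unit. There are no
  real-to-integer operations, and no multiplication of integers.\<close>

record store =
  ints :: "string \<Rightarrow> nat \<Rightarrow> nat"
  reals :: "string \<Rightarrow> nat \<Rightarrow> real"

datatype iexp = IConst nat | IRead string iexp | IAdd iexp iexp | ISub iexp iexp | IHalf iexp

datatype rexp = RNat iexp | RRead string iexp | RAdd rexp rexp | RSub rexp rexp
  | RMul rexp rexp | RDiv rexp rexp

datatype bexp = ILess iexp iexp | RLess rexp rexp | BNot bexp | BAnd bexp bexp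

datatype com = Skip | SetI string iexp iexp | SetR string iexp rexp
  | Seq com com | Cond bexp com com | While bexp com

fun ival :: "iexp \<Rightarrow> store \<Rightarrow> nat" where
  "ival (IConst m) \<sigma> = m"
| "ival (IRead a e) \<sigma> = ints \<sigma> a (ival e \<sigma>)"
| "ival (IAdd e f) \<sigma> = ival e \<sigma> + ival f \<sigma>"
| "ival (ISub e f) \<sigma> = ival e \<sigma> - ival f \<sigma>"
| "ival (IHalf e) \<sigma> = ival e \<sigma> div 2"

fun rval :: "rexp \<Rightarrow> store \<Rightarrow> real" where
  "rval (RNat e) \<sigma> = real (ival e \<sigma>)"
| "rval (RRead a e) \<sigma> = reals \<sigma> a (ival e \<sigma>)"
| "rval (RAdd e f) \<sigma> = rval e \<sigma> + rval f \<sigma>"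
| "rval (RSub e f) \<sigma> = rval e \<sigma> - rval f \<sigma>"
| "rval (RMul e f) \<sigma> = rval e \<sigma> * rval f \<sigma>"
| "rval (RDiv e f) \<sigma> = rval e \<sigma> / rval f \<sigma>"

fun bval :: "bexp \<Rightarrow> store \<Rightarrow> bool" where
  "bval (ILess e f) \<sigma> = (ival e \<sigma> < ival f \<sigma>)"
| "bval (RLess e f) \<sigma> = (rval e \<sigma> < rval f \<sigma>)"
| "bval (BNot b) \<sigma> = (\<not> bval b \<sigma>)"
| "bval (BAnd b d) \<sigma> = (bval b \<sigma> \<and> bval d \<sigma>)"

fun icost :: "iexp \<Rightarrow> nat" where
  "icost (IConst m) = 1"
| "icost (IRead a e) = 1 + icost e"
| "icost (IAdd e f) = 1 + icost e + icost f"
| "icost (ISub e f) = 1 + icost e + icost f"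
| "icost (IHalf e) = 1 + icost e"

fun rcost :: "rexp \<Rightarrow> nat" where
  "rcost (RNat e) = 1 + icost e"
| "rcost (RRead a e) = 1 + icost e"
| "rcost (RAdd e f) = 1 + rcost e + rcost f"
| "rcost (RSub e f) = 1 + rcost e + rcost f"
| "rcost (RMul e f) = 1 + rcost e + rcost f"
| "rcost (RDiv e f) = 1 + rcost e + rcost f"

fun bcost :: "bexp \<Rightarrow> nat" where
  "bcost (ILess e f) = 1 + icost e + icost f"
| "bcost (RLess e f) = 1 + rcost e + rcost f"
| "bcost (BNot b) = 1 + bcost b"
| "bcost (BAnd b d) = 1 + bcost b + bcost d"

text \<open>\<open>exec p \<sigma> m \<sigma>'\<close>: program \<open>p\<close> started in \<open>\<sigma>\<close> halts in \<open>\<sigma>'\<close> after \<open>m\<close> units of time.\<close>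

inductive exec :: "com \<Rightarrow> store \<Rightarrow> nat \<Rightarrow> store \<Rightarrow> bool" where
  Skip: "exec Skip \<sigma> 1 \<sigma>"
| SetI: "exec (SetI a i e) \<sigma> (1 + icost i + icost e)
           (\<sigma>\<lparr>ints := (ints \<sigma>)(a := (ints \<sigma> a)(ival i \<sigma> := ival e \<sigma>))\<rparr>)"
| SetR: "exec (SetR a i e) \<sigma> (1 + icost i + rcost e)
           (\<sigma>\<lparr>reals := (reals \<sigma>)(a := (reals \<sigma> a)(ival i \<sigma> := rval e \<sigma>))\<rparr>)"
| Seq: "exec p \<sigma> m \<sigma>' \<Longrightarrow> exec q \<sigma>' l \<sigma>'' \<Longrightarrow> exec (Seq p q) \<sigma> (1 + m + l) \<sigma>''"
| CondT: "bval b \<sigma> \<Longrightarrow> exec p \<sigma> m \<sigma>' \<Longrightarrow> exec (Cond b p q) \<sigma> (1 + bcost b + m) \<sigma>'"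
| CondF: "\<not> bval b \<sigma> \<Longrightarrow> exec q \<sigma> m \<sigma>' \<Longrightarrow> exec (Cond b p q) \<sigma> (1 + bcost b + m) \<sigma>'"
| WhileF: "\<not> bval b \<sigma> \<Longrightarrow> exec (While b p) \<sigma> (1 + bcost b) \<sigma>"
| WhileT: "bval b \<sigma> \<Longrightarrow> exec p \<sigma> m \<sigma>' \<Longrightarrow> exec (While b p) \<sigma>' l \<sigma>'' \<Longrightarrow>
           exec (While b p) \<sigma> (1 + bcost b + m + l) \<sigma>''"

text \<open>The graph is stored as an unordered edge list, with respect to arbitrary numberings \<open>vs\<close>,
  \<open>cs\<close>, \<open>es\<close> of voters, candidates and edges. All other memory is unconstrained.\<close>

definition encodes ::
  "'v list \<Rightarrow> 'c list \<Rightarrow> ('v \<times> 'c) list \<Rightarrow> ('v, 'c) election \<Rightarrow> real \<Rightarrow>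
   'c set \<times> ('v, 'c) weight \<Rightarrow> store \<Rightarrow> bool" where
  "encodes vs cs es I \<epsilon> S \<sigma> \<longleftrightarrow>
     distinct vs \<and> set vs = voters I \<and>
     distinct cs \<and> set cs = cands I \<and>
     distinct es \<and> set es = edges I \<and>
     ints \<sigma> ''nvoters'' 0 = length vs \<and>
     ints \<sigma> ''ncands'' 0 = length cs \<and>
     ints \<sigma> ''nedges'' 0 = length es \<and>
     ints \<sigma> ''seats'' 0 = seats I \<and>
     reals \<sigma> ''eps'' 0 = \<epsilon> \<and>
     (\<forall>i<length vs. reals \<sigma> ''strength'' i = strength I (vs ! i)) \<and>
     (\<forall>j<length cs. ints \<sigma> ''member'' j = (if cs ! j \<in> fst S then 1 else 0)) \<and>
     (\<forall>e<length es.
        ints \<sigma> ''voter'' e < length vs \<and> vs ! ints \<sigma> ''voter'' e = fst (es ! e) \<and>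
        ints \<sigma> ''cand'' e < length cs \<and> cs ! ints \<sigma> ''cand'' e = snd (es ! e) \<and>
        reals \<sigma> ''weight'' e = snd S (fst (es ! e)) (snd (es ! e)))"

text \<open>Started on any encoding of the current solution \<open>S\<close>, the program carries out one iteration of
  the local search with starting committee \<open>A\<close>, in time at most \<open>T\<close>: it either reports that the
  algorithm returns \<open>S\<close>, or replaces \<open>S\<close> by a solution the algorithm may move to, encoded in the
  same format and with the same numberings.\<close>

definition performs_iteration ::
  "com \<Rightarrow> ('v, 'c) election \<Rightarrow> real \<Rightarrow> 'c set \<Rightarrow> 'c set \<times> ('v, 'c) weight \<Rightarrow> real \<Rightarrow> bool" where
  "performs_iteration p I \<epsilon> A S T \<longleftrightarrow>
     (\<forall>vs cs es \<sigma>. encodes vs cs es I \<epsilon> S \<sigma> \<longrightarrow>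
        (\<exists>m \<sigma>'. exec p \<sigma> m \<sigma>' \<and> real m \<le> T \<and>
           (ls_stop I (ls_threshold I \<epsilon> A) S \<and>
              ints \<sigma>' ''return'' 0 = 1 \<and> encodes vs cs es I \<epsilon> S \<sigma>' \<or>
            (\<exists>S'. ls_step I (ls_threshold I \<epsilon> A) S S' \<and>
              ints \<sigma>' ''return'' 0 = 0 \<and> encodes vs cs es I \<epsilon> S' \<sigma>'))))"

end

theory Submission
  imports Defs
begin

text \<open>
  The prescore of a candidate is a nonnegative decreasing function of \<open>t\<close>, and its score is the unique
  fixpoint. An exchange at score \<open>t\<close> keeps every other support above the minimum of \<open>t\<close> and its old
  value and gives the new member support at least \<open>t\<close>, so for each \<open>x \<le> t\<close> the number of
  members with support below \<open>x\<close> drops unless it is zero. Hence \<open>seats I\<close> exchanges multiply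
  the least support by \<open>1 + \<epsilon>\<close>, until
  it exceeds the optimum or reaches the average \<open>t_hat\<close>; in the latter case all strength is used
  up equally and every prescore vanishes. When the search stops, a group of voters violating \<open>t\<close>-PJR
  would have a common non-member whose prescore at \<open>t\<close> is at least \<open>t\<close>.

  For the running time only the largest score is needed. All prescores at one value \<open>t\<close> take
  time linear in the number of edges, and the largest score is at least \<open>t\<close> iff one of them is. After sorting
  the supports of the members, binary search leaves an interval between consecutive supports on
  which all prescores are linear, and there the best fixpoint is found directly.
\<close>

text \<open>The growth argument is silent about a start with least support 0: if
  \<open>0 < OPT I\<close>, such a start is an \<alpha>-approximation for no \<alpha>. There a
  \<open>potential\<close> based on the number of unsupported members shows that the least support
  is positive after \<open>2 * seats I + 2\<close> exchanges. If \<open>OPT I\<close> is 0, every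
  threshold is 0 and no score lies below it, so the search never returns. Hence termination is tied
  to \<open>0 < OPT I\<close>, whereas an execution that does return proves this condition by
  itself. Since \<open>OPT I\<close> is a \<open>GREATEST\<close> over reals, the optimum has to be
  shown to be attained: by compactness for a fixed committee, then by finiteness of the set of
  committees. The constant in the time bound must not depend on the instance. Costs are therefore
  bounded by a product of \<open>unit_cost\<close>, a number read off the program text, and a number
  of rounds. As no vertex is isolated, loops over voters, candidates and seats are also bounded by
  the number of edges; only sorting and bisection add an outer loop, of logarithmic length.\<close>

locale election_instance =
  fixes I :: "('v, 'c) election"
  assumes valid: "valid_election I"
begin

abbreviation "tot_str \<equiv> \<Sum>n\<in>voters I. strength I n"

lemma finite_voters: "finite (voters I)"
  and finite_cands: "finite (cands I)"
  and edges_subset: "edges I \<subseteq> voters I \<times> cands I"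
  and strength_nonneg: "n \<in> voters I \<Longrightarrow> 0 \<le> strength I n"
  and seats_pos: "0 < seats I"
  and seats_less: "seats I < card (cands I)"
  using valid by (auto simp: valid_election_def)

lemma voters_of_subset: "voters_of I c \<subseteq> voters I"
  and cands_of_subset: "cands_of I n \<subseteq> cands I"
  using edges_subset by (auto simp: voters_of_def cands_of_def)

lemma finite_voters_of: "finite (voters_of I c)"
  and finite_cands_of: "finite (cands_of I n)"
  using finite_subset[OF voters_of_subset finite_voters]
    finite_subset[OF cands_of_subset finite_cands] by auto

lemma in_voters_of: "n \<in> voters_of I c \<longleftrightarrow> (n, c) \<in> edges I"
  and in_cands_of: "c \<in> cands_of I n \<longleftrightarrow> (n, c) \<in> edges I"
  by (auto simp: voters_of_def cands_of_def)

lemma total_nonneg: "0 \<le> tot_str"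
  by (intro sum_nonneg strength_nonneg)

section \<open>Weights, slacks, and scores as fixpoints\<close>

lemma weight_nonneg: "feasible I w \<Longrightarrow> (n, c) \<in> edges I \<Longrightarrow> 0 \<le> w n c"
  by (auto simp: feasible_def)

lemma weight_sum_le: "feasible I w \<Longrightarrow> n \<in> voters I \<Longrightarrow> (\<Sum>c\<in>cands_of I n.
    w n c) \<le> strength I n"
  by (auto simp: feasible_def)

lemma supp_nonneg: "feasible I w \<Longrightarrow> 0 \<le> supp I w c"
  unfolding supp_def by (rule sum_nonneg) (auto simp: in_voters_of weight_nonneg)

lemma weight_le_supp:
  assumes "feasible I w" "(n, c) \<in> edges I"
  shows "w n c \<le> supp I w c"
  unfolding supp_def
  by (rule member_le_sum) (use assms in \<open>auto simp: in_voters_of weight_nonneg finite_voters_of\<close>)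

text \<open>What \<open>c\<close> still receives from \<open>n\<close> once its weights are scaled
  down uniformly so that its support is at most \<open>t\<close>. Both \<open>slack\<close> and the
  weights written by an exchange are expressed by it, which ties scores to exchanges.\<close>

definition capped :: "('v, 'c) weight \<Rightarrow> real \<Rightarrow> 'v \<Rightarrow> 'c \<Rightarrow> real" where
  "capped w t n c = w n c * min 1 (t / supp I w c)"

lemma capped_nonneg: "feasible I w \<Longrightarrow> (n, c) \<in> edges I \<Longrightarrow> 0 \<le> t
    \<Longrightarrow> 0 \<le> capped w t n c"
  unfolding capped_def by (intro mult_nonneg_nonneg) (auto simp: weight_nonneg supp_nonneg)

lemma capped_le: "feasible I w \<Longrightarrow> (n, c) \<in> edges I \<Longrightarrow> capped w t n c \<le> w n c"
  unfolding capped_def using weight_nonneg[of w n c] by (simp add: mult_left_le)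

lemma capped_mono:
  "feasible I w \<Longrightarrow> (n, c) \<in> edges I \<Longrightarrow> t \<le> t' \<Longrightarrow> capped w t n
      c \<le> capped w t' n c"
  unfolding capped_def
  by (intro mult_left_mono min.mono divide_right_mono) (auto simp: weight_nonneg supp_nonneg)

text \<open>The conditional form is the one in \<open>insert_cand\<close>. A zero support is
  harmless: the quotient by 0 is 0, and \<open>w n c\<close> is then 0 as well.\<close>

lemma capped_eq:
  assumes "feasible I w" "(n, c) \<in> edges I" "0 \<le> t"
  shows "capped w t n c = (if supp I w c > t then w n c * t / supp I w c else w n c)"
  using assms weight_le_supp[OF assms(1,2)] weight_nonneg[OF assms(1,2)] supp_nonneg[OF assms(1), of c]
  by (cases "supp I w c = 0") (auto simp: capped_def min_def field_simps)

text \<open>The scaling factor does not depend on the voter, so it comes out of the sum.\<close>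

lemma sum_capped:
  assumes "feasible I w" "0 \<le> t"
  shows "(\<Sum>n\<in>voters_of I c. capped w t n c) = min (supp I w c) t"
proof -
  have "(\<Sum>n\<in>voters_of I c. capped w t n c) = supp I w c * min 1 (t / supp I w c)"
    unfolding capped_def supp_def by (simp add: sum_distrib_right)
  then show ?thesis
    using supp_nonneg[OF assms(1), of c] assms(2)
    by (cases "supp I w c = 0") (auto simp: min_def field_simps)
qed

lemma slack_capped: "slack I A w n t = strength I n - (\<Sum>c\<in>A \<inter> cands_of I n. capped w t n c)"
  by (simp add: slack_def capped_def)

lemma slack_nonneg:
  assumes "feasible I w" "n \<in> voters I"
  shows "0 \<le> slack I A w n t"
proof -
  have "(\<Sum>c\<in>A \<inter> cands_of I n. capped w t n c) \<le> (\<Sum>c\<in>A \<inter> cands_of I n. w n c)"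
    by (intro sum_mono capped_le) (auto simp: assms in_cands_of)
  also have "\<dots> \<le> (\<Sum>c\<in>cands_of I n. w n c)"
    by (intro sum_mono2) (auto simp: finite_cands_of in_cands_of assms weight_nonneg)
  finally show ?thesis using weight_sum_le[OF assms] by (simp add: slack_capped)
qed

lemma slack_antimono: "feasible I w \<Longrightarrow> t \<le> t' \<Longrightarrow> slack I A w n t' \<le> slack I A w n t"
  unfolding slack_capped
  by (intro diff_left_mono sum_mono capped_mono) (auto simp: in_cands_of)

lemma prescore_antimono:
  "feasible I w \<Longrightarrow> t \<le> t' \<Longrightarrow> prescore I A w c t' \<le> prescore I A w c t"
  unfolding prescore_def by (intro sum_mono slack_antimono)

lemma prescore_nonneg: "feasible I w \<Longrightarrow> 0 \<le> prescore I A w c t"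
  unfolding prescore_def using voters_of_subset by (intro sum_nonneg slack_nonneg) auto

lemma prescore_fixpoint:
  assumes "feasible I w"
  obtains t where "0 \<le> t" "prescore I A w c t = t"
proof -
  let ?f = "\<lambda>t. t - prescore I A w c t"
  let ?T = "prescore I A w c 0"
  have "\<exists>x\<ge>0. x \<le> ?T \<and> ?f x = 0"
  proof (rule IVT')
    \<comment> \<open>The right end \<open>?T\<close> works because antitonicity bounds the prescore
      there by its value at 0, which is \<open>?T\<close> itself.\<close>
    show "?f 0 \<le> 0" "0 \<le> ?f ?T" "0 \<le> ?T"
      using prescore_nonneg[OF assms] prescore_antimono[OF assms, of 0 ?T] by auto
    \<comment> \<open>After \<open>divide_inverse\<close> the inverse support is a constant factor,
      so continuity does not require nonzero supports.\<close>
    show "continuous_on {0..?T} ?f"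
      unfolding prescore_def slack_def divide_inverse
      by (intro continuous_intros)
  qed
  then show ?thesis using that by force
qed

text \<open>To the right of a fixpoint a decreasing prescore stays strictly below the diagonal, so
  the \<open>GREATEST\<close> in \<open>score\<close> exists and is the fixpoint.\<close>

lemma score_eqI:
  assumes "feasible I w" "0 \<le> t" "prescore I A w c t = t"
  shows "score I A w c = t"
  unfolding score_def
proof (rule Greatest_equality)
  fix y assume y: "0 \<le> y \<and> y \<le> prescore I A w c y"
  show "y \<le> t"
  proof (rule ccontr)
    assume "\<not> y \<le> t"
    then show False
      using prescore_antimono[OF assms(1), of t y A c] y assms(3) by auto
  qed
qed (use assms in auto)

lemma score_props:
  assumes "feasible I w"
  shows "0 \<le> score I A w c" "prescore I A w c (score I A w c) = score I A w c"
  using prescore_fixpoint[OF assms] score_eqI[OF assms] by metis+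

text \<open>The diagonal is crossed only once, so one evaluation of the prescore at \<open>t\<close>
  decides on which side of \<open>t\<close> the score lies. PJR at termination and the bisection in
  the program both rest on this.\<close>

lemma le_score_iff:
  assumes "feasible I w" "0 \<le> t"
  shows "t \<le> score I A w c \<longleftrightarrow> t \<le> prescore I A w c t"
  using prescore_antimono[OF assms(1), of t "score I A w c" A c]
    prescore_antimono[OF assms(1), of "score I A w c" t A c] score_props[OF assms(1), of A c]
  by (cases "t \<le> score I A w c") auto

lemma score_less_iff:
  assumes "feasible I w" "0 \<le> t"
  shows "score I A w c < t \<longleftrightarrow> prescore I A w c t < t"
  using le_score_iff[OF assms, of A c] by linarith

lemma sum_edges_swap:
  assumes "finite A" "finite M"
  shows "(\<Sum>n\<in>M. \<Sum>c\<in>A \<inter> cands_of I n. f n c) = (\<Sum>c\<in>A. \<Sum>n\<in>M \<inter>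
      voters_of I c. f n c)"
proof -
  have "A \<inter> cands_of I n = {c. c \<in> A \<and> (n, c) \<in> edges I}" for n
    by (auto simp: cands_of_def)
  moreover have "M \<inter> voters_of I c = {n. n \<in> M \<and> (n, c) \<in> edges I}" for c
    by (auto simp: voters_of_def)
  ultimately show ?thesis using sum.swap_restrict[OF assms(2,1)] by simp
qed

section \<open>Full solutions, their least supports, and PJR\<close>

lemma full_solutionD:
  assumes "full_solution I A w"
  shows "feasible I w" "A \<subseteq> cands I" "card A = seats I" "finite A" "A \<noteq> {}" "cands I - A \<noteq> {}"
proof -
  show *: "feasible I w" "A \<subseteq> cands I" "card A = seats I"
    using assms by (auto simp: full_solution_def solution_def)
  show "finite A" using * finite_cands finite_subset by blast
  show "A \<noteq> {}" using * seats_pos by auto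
  show "cands I - A \<noteq> {}" using * seats_less by auto
qed

lemma supp_set_le: "full_solution I A w \<Longrightarrow> c \<in> A \<Longrightarrow> supp_set I w A \<le> supp I w c"
  unfolding supp_set_def using full_solutionD by (intro Min_le) auto

lemma supp_set_geI: "full_solution I A w \<Longrightarrow> (\<And>c. c \<in> A \<Longrightarrow> x \<le> supp I w
    c) \<Longrightarrow> x \<le> supp_set I w A"
  unfolding supp_set_def using full_solutionD by (subst Min_ge_iff) auto

lemma supp_set_attained:
  assumes "full_solution I A w"
  obtains c where "c \<in> A" "supp I w c = supp_set I w A"
proof -
  have "supp_set I w A \<in> supp I w ` A"
    unfolding supp_set_def using full_solutionD(4,5)[OF assms] by (intro Min_in) auto
  then show ?thesis using that by auto
qed

lemma supp_set_nonneg: "full_solution I A w \<Longrightarrow> 0 \<le> supp_set I w A"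
  by (intro supp_set_geI supp_nonneg full_solutionD)

lemma max_score_less_iff:
  assumes "full_solution I A w"
  shows "max_score I A w < t \<longleftrightarrow> (\<forall>c\<in>cands I - A. score I A w c < t)"
  unfolding max_score_def using full_solutionD[OF assms] finite_cands by (subst Max_less_iff) auto

lemma score_le_max_score:
  "c \<in> cands I - A \<Longrightarrow> score I A w c \<le> max_score I A w"
  unfolding max_score_def using finite_cands by (intro Max_ge) auto

lemma max_score_attained:
  assumes "full_solution I A w"
  obtains c where "c \<in> cands I - A" "score I A w c = max_score I A w"
proof -
  have "max_score I A w \<in> score I A w ` (cands I - A)"
    unfolding max_score_def using full_solutionD(6)[OF assms] finite_cands by (intro Max_in) auto
  then show ?thesis using that by auto
qed

lemma max_score_nonneg: "full_solution I A w \<Longrightarrow> 0 \<le> max_score I A w"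
  using max_score_attained score_props(1) full_solutionD(1) by metis

text \<open>Slacks are nonnegative, so \<open>voters_of I c\<close> may be enlarged to all voters,
  which makes the bound independent of \<open>c\<close>. As \<open>t\<close> exceeds no support, the
  capped weights of each member sum to exactly \<open>t\<close>.\<close>

lemma prescore_le_total:
  assumes full: "full_solution I A w" and t: "0 \<le> t" "t \<le> supp_set I w A"
  shows "prescore I A w c t \<le> tot_str - real (seats I) * t"
proof -
  note F = full_solutionD[OF full]
  have "prescore I A w c t \<le> (\<Sum>n\<in>voters I. slack I A w n t)"
    unfolding prescore_def
    by (intro sum_mono2 finite_voters voters_of_subset slack_nonneg) (use F in auto)
  also have "\<dots> = tot_str - (\<Sum>d\<in>A. \<Sum>n\<in>voters I \<inter> voters_of I d. capped w t n d)"
    by (simp add: slack_capped sum_subtractf sum_edges_swap F finite_voters)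
  also have "(\<Sum>d\<in>A. \<Sum>n\<in>voters I \<inter> voters_of I d. capped w t n d) = (\<Sum>d\<in>A. t)"
  proof (rule sum.cong)
    fix d assume "d \<in> A"
    then have "t \<le> supp I w d" using supp_set_le[OF full] t by force
    moreover have "voters I \<inter> voters_of I d = voters_of I d" using voters_of_subset by blast
    ultimately show "(\<Sum>n\<in>voters I \<inter> voters_of I d. capped w t n d) = t"
      using sum_capped[OF F(1) t(1)] by simp
  qed simp
  finally show ?thesis using F by simp
qed

lemma supp_set_le_average:
  assumes "full_solution I A w"
  shows "supp_set I w A \<le> tot_str / real (seats I)"
proof -
  \<comment> \<open>Any candidate would do, because the upper bound on the prescore does not mention
    it.\<close>
  have "0 \<le> prescore I A w undefined (supp_set I w A)"
    by (rule prescore_nonneg[OF full_solutionD(1)[OF assms]])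
  also have "\<dots> \<le> tot_str - real (seats I) * supp_set I w A"
    by (rule prescore_le_total[OF assms supp_set_nonneg[OF assms] order_refl])
  finally show ?thesis using seats_pos by (simp add: field_simps)
qed

text \<open>At the average the bound of \<open>prescore_le_total\<close> is 0. Positive total
  strength makes the inequality strict; otherwise score and average would both be 0.\<close>

lemma max_score_less_average:
  assumes full: "full_solution I A w" and pos: "0 < tot_str"
    and ge: "tot_str / real (seats I) \<le> supp_set I w A"
  shows "max_score I A w < tot_str / real (seats I)"
proof -
  let ?t = "tot_str / real (seats I)"
  have t: "0 < ?t" using pos seats_pos by simp
  have "prescore I A w c ?t \<le> 0" for c
    using prescore_le_total[OF full _ ge, of c] t seats_pos by simp
  then have "score I A w c < ?t" for c
    using score_less_iff[OF full_solutionD(1)[OF full], of ?t A c] t by (metis less_eq_real_def order_le_less_trans)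
  then show ?thesis using max_score_less_iff[OF full] by simp
qed

text \<open>A violating group has strength at least \<open>r * t\<close> but approves fewer than
  \<open>r\<close> members, and each of these absorbs at most \<open>t\<close> of its capped weight.
  So slack of at least \<open>t\<close> is left in the group, and all of it counts for a commonly
  approved candidate outside \<open>A\<close>.\<close>

lemma t_PJR_if_prescore_less:
  assumes full: "full_solution I A w" and t: "0 < t"
    and less: "\<And>c. c \<in> cands I - A \<Longrightarrow> prescore I A w c t < t"
  shows "t_PJR I t A"
  unfolding t_PJR_def
proof
  note F = full_solutionD[OF full]
  assume "\<exists>N' r. N' \<subseteq> voters I \<and> 0 < r \<and> r \<le> card A \<and> real r * t \<le>
      (\<Sum>n\<in>N'. strength I n) \<and>
          r \<le> card (cands I \<inter> (\<Inter>n\<in>N'. cands_of I n)) \<and> card (A \<inter>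
              (\<Union>n\<in>N'. cands_of I n)) < r"
  then obtain N' and r :: nat where N': "N' \<subseteq> voters I" and r: "0 < r"
    and a: "real r * t \<le> (\<Sum>n\<in>N'. strength I n)"
    and b: "r \<le> card (cands I \<inter> (\<Inter>n\<in>N'. cands_of I n))"
    and c: "card (A \<inter> (\<Union>n\<in>N'. cands_of I n)) < r" by auto
  let ?J = "cands I \<inter> (\<Inter>n\<in>N'. cands_of I n)" and ?U = "A \<inter> (\<Union>n\<in>N'. cands_of I n)"
  have finN: "finite N'" using N' finite_voters finite_subset by blast
  \<comment> \<open>In a nonempty group a common candidate lies in the union of the approval sets,
    so one that misses \<open>?U\<close> also misses \<open>A\<close>.\<close>
  have "N' \<noteq> {}" using a r t by (auto simp: mult_le_0_iff)
  have "\<not> ?J \<subseteq> ?U"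
    using card_mono[of ?U ?J] F(4) b c by auto
  then obtain c' where c': "c' \<in> ?J" "c' \<notin> A" using \<open>N' \<noteq> {}\<close> by auto
  have sub: "N' \<subseteq> voters_of I c'" using c' by (auto simp: in_voters_of in_cands_of)
  have capN: "(\<Sum>n\<in>N' \<inter> voters_of I d. capped w t n d) \<le> t" for d
  proof -
    have "(\<Sum>n\<in>N' \<inter> voters_of I d. capped w t n d) \<le> (\<Sum>n\<in>voters_of I d. capped w t n d)"
      by (intro sum_mono2) (auto simp: finite_voters_of in_voters_of capped_nonneg F t less_imp_le)
    then show ?thesis using sum_capped[OF F(1), of t d] t by simp
  qed
  have eq: "A \<inter> cands_of I n = ?U \<inter> cands_of I n" if "n \<in> N'" for n using that by auto
  have "t \<le> (real r - real (card ?U)) * t"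
    using c t by simp
  also have "\<dots> \<le> (\<Sum>n\<in>N'. strength I n) - (\<Sum>d\<in>?U. t)" using a by (simp add: algebra_simps)
  also have "\<dots> \<le> (\<Sum>n\<in>N'. strength I n) - (\<Sum>d\<in>?U. \<Sum>n\<in>N' \<inter> voters_of I
      d. capped w t n d)"
    by (intro diff_left_mono sum_mono capN)
  also have "\<dots> = (\<Sum>n\<in>N'. slack I A w n t)"
    using sum_edges_swap[of ?U N' "capped w t"] F finN eq
    by (simp add: slack_capped sum_subtractf)
  also have "\<dots> \<le> prescore I A w c' t"
    unfolding prescore_def
    by (intro sum_mono2 sub finite_voters_of slack_nonneg) (use F voters_of_subset in auto)
  finally show False using less[of c'] c' by auto
qed

lemma t_PJR_mono: "t_PJR I t A \<Longrightarrow> t \<le> t' \<Longrightarrow> t_PJR I t' A"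
  unfolding t_PJR_def by (meson mult_left_mono of_nat_0_le_iff order_trans)

section \<open>One exchange\<close>

text \<open>The insertion works on truncated weights \<open>u0\<close>, but for the remaining
  members these have the same supports as \<open>u\<close>. So the new weights can be written with
  \<open>capped\<close> and \<open>slack\<close> of \<open>u\<close>. Nothing is said off the edges,
  where values are never read.\<close>

lemma ls_step_cases:
  assumes step: "ls_step I \<theta> (B, u) S'" and full: "full_solution I B u"
  obtains cmin cmax u' where "S' = (insert cmax (B - {cmin}), u')" "cmin \<in> B"
    "supp I u cmin = supp_set I u B" "cmax \<in> cands I - B" "score I B u cmax = max_score I B u"
    "\<theta> (B, u) \<le> max_score I B u"
    "\<And>n c. (n, c) \<in> edges I \<Longrightarrow> u' n c =
       (if c = cmax then slack I (B - {cmin}) u n (max_score I B u)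
        else if c \<in> B - {cmin}
        then (if (n, cmax) \<in> edges I then capped u (max_score I B u) n c else u n c) else 0)"
  using step
proof cases
  case (1 cmin cmax tmax u0)
  let ?t = "max_score I B u"
  note F = full_solutionD[OF full]
  have t0: "0 \<le> ?t" by (rule max_score_nonneg[OF full])
  have supp0: "supp I u0 c = supp I u c" if "c \<in> B - {cmin}" for c
    using that 1 by (simp add: supp_def)
  have *: "(if n \<in> voters_of I cmax \<and> c \<in> (B - {cmin}) \<inter> cands_of I n \<and> ?t < supp I u0 c
          then u0 n c * ?t / supp I u0 c else u0 n c) =
      (if c \<in> B - {cmin} then (if (n, cmax) \<in> edges I then capped u ?t n c else u n c) else 0)"
    (is "?w1 n c = _")
    if "(n, c) \<in> edges I" for n c
    using that capped_eq[OF F(1) that t0] supp0[of c] 1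
    by (auto simp: in_voters_of in_cands_of)
  define u' where "u' = snd (insert_cand I (B - {cmin}) u0 cmax tmax)"
  have S': "S' = (insert cmax (B - {cmin}), u')"
    using 1 by (simp add: u'_def insert_cand_def Let_def)
  have tm: "tmax = ?t" using 1 by simp
  have u': "u' n c = (if n \<in> voters_of I cmax \<and> c = cmax
                then strength I n - (\<Sum>d\<in>(B - {cmin}) \<inter> cands_of I n. ?w1 n d) else ?w1 n c)" for n c
    unfolding u'_def insert_cand_def Let_def snd_conv tm ..
  have "u' n c = (if c = cmax then slack I (B - {cmin}) u n (max_score I B u)
        else if c \<in> B - {cmin}
        then (if (n, cmax) \<in> edges I then capped u (max_score I B u) n c else u n c) else 0)"
    if e: "(n, c) \<in> edges I" for n c
  proof (cases "c = cmax")
    case True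
    have "(\<Sum>d\<in>(B - {cmin}) \<inter> cands_of I n. ?w1 n d) = (\<Sum>d\<in>(B - {cmin}) \<inter> cands_of
        I n. capped u ?t n d)"
    proof (rule sum.cong)
      fix d assume "d \<in> (B - {cmin}) \<inter> cands_of I n"
      then show "?w1 n d = capped u ?t n d"
        using *[of n d] e True by (simp add: in_cands_of)
    qed simp
    then show ?thesis using True e by (simp add: u' slack_capped in_voters_of)
  next
    case False
    then show ?thesis using *[OF e] by (simp only: u' if_False simp_thms)
  qed
  moreover have "\<theta> (B, u) \<le> max_score I B u" using 1 by (simp add: ls_stop_def)
  ultimately show ?thesis using that[OF S' 1(2,3,4)] 1(5,6) by metis
qed

text \<open>The new member receives all slack of its voters; with respect to \<open>B\<close> this
  slack already sums to the score, and removing \<open>cmin\<close> can only raise it. Other members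
  keep at least their capped weights. The last conclusion serves exchanges in which the new
  candidate has only voters without strength.\<close>

lemma ls_step_props:
  assumes step: "ls_step I \<theta> (B, u) (B', u')" and full: "full_solution I B u"
  obtains cmin cmax where "B' = insert cmax (B - {cmin})" "cmin \<in> B"
    "supp I u cmin = supp_set I u B" "cmax \<in> cands I - B" "score I B u cmax = max_score I B u"
    "\<theta> (B, u) \<le> max_score I B u" "full_solution I B' u'"
    "max_score I B u \<le> supp I u' cmax"
    "\<And>c. c \<in> B - {cmin} \<Longrightarrow> min (supp I u c) (max_score I B u) \<le> supp I u' c"
    "\<And>c. \<forall>n\<in>voters_of I cmax. strength I n = 0 \<Longrightarrow> c \<in> B - {cmin} \<Longrightarrow>
       supp I u' c = supp I u c"
proof -
  let ?t = "max_score I B u"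
  note F = full_solutionD[OF full]
  have t0: "0 \<le> ?t" by (rule max_score_nonneg[OF full])
  obtain cmin cmax u'' where S'': "(B', u') = (insert cmax (B - {cmin}), u'')" and S0: "cmin \<in> B"
    "supp I u cmin = supp_set I u B" and cmax: "cmax \<in> cands I - B" "score I B u cmax = ?t"
    and th: "\<theta> (B, u) \<le> ?t"
    and u'': "\<And>n c. (n, c) \<in> edges I \<Longrightarrow> u'' n c =
       (if c = cmax then slack I (B - {cmin}) u n ?t
        else if c \<in> B - {cmin}
        then (if (n, cmax) \<in> edges I then capped u ?t n c else u n c) else 0)"
    by (rule ls_step_cases[OF step full]) blast
  have S: "B' = insert cmax (B - {cmin})" "cmin \<in> B" "supp I u cmin = supp_set I u B"
    using S'' S0 by auto
  have u': "(n, c) \<in> edges I \<Longrightarrow> u' n c =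
       (if c = cmax then slack I (B - {cmin}) u n ?t
        else if c \<in> B - {cmin}
        then (if (n, cmax) \<in> edges I then capped u ?t n c else u n c) else 0)" for n c
    using u''[of n c] S'' by blast
  let ?A = "B - {cmin}"
  have nonneg: "0 \<le> u' n c" if "(n, c) \<in> edges I" for n c
  proof -
    have "n \<in> voters I" using that edges_subset by auto
    then show ?thesis
      using slack_nonneg[OF F(1)] weight_nonneg[OF F(1) that] capped_nonneg[OF F(1) that t0]
      by (simp add: u'[OF that])
  qed
  have le: "(\<Sum>c\<in>cands_of I n. u' n c) \<le> strength I n" if n: "n \<in> voters I" for n
  proof -
    have "(\<Sum>c\<in>cands_of I n. u' n c) =
        (\<Sum>c\<in>?A \<inter> cands_of I n. u' n c) + (\<Sum>c\<in>{cmax} \<inter> cands_of I n. u' n c)"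
    proof -
      have "(\<Sum>c\<in>cands_of I n. u' n c) = (\<Sum>c\<in>(?A \<inter> cands_of I n) \<union> ({cmax} \<inter>
          cands_of I n). u' n c)"
        by (rule sum.mono_neutral_right) (auto simp: u' in_cands_of finite_cands_of)
      also have "\<dots> = (\<Sum>c\<in>?A \<inter> cands_of I n. u' n c) + (\<Sum>c\<in>{cmax} \<inter> cands_of I n. u' n c)"
        using cmax by (intro sum.union_disjoint) (auto simp: finite_cands_of)
      finally show ?thesis .
    qed
    \<comment> \<open>A voter of \<open>cmax\<close> spends its strength exactly, since its
      \<open>slack\<close> is what the others leave over; any other voter spends no more than
      before.\<close>
    also have "\<dots> \<le> strength I n"
    proof (cases "(n, cmax) \<in> edges I")
      case True
      have "(\<Sum>c\<in>?A \<inter> cands_of I n. u' n c) = (\<Sum>c\<in>?A \<inter> cands_of I n. capped u ?t n c)"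
        using True cmax by (intro sum.cong) (auto simp: u' in_cands_of)
      moreover have "{cmax} \<inter> cands_of I n = {cmax}" using True by (auto simp: in_cands_of)
      ultimately show ?thesis using True by (simp add: u' slack_capped)
    next
      case False
      then have "{cmax} \<inter> cands_of I n = {}" by (auto simp: in_cands_of)
      moreover have "(\<Sum>c\<in>?A \<inter> cands_of I n. u' n c) \<le> (\<Sum>c\<in>cands_of I n. u n c)"
      proof -
        have "(\<Sum>c\<in>?A \<inter> cands_of I n. u' n c) = (\<Sum>c\<in>?A \<inter> cands_of I n. u n c)"
          using False cmax by (intro sum.cong) (auto simp: u' in_cands_of)
        also have "\<dots> \<le> (\<Sum>c\<in>cands_of I n. u n c)"
          by (intro sum_mono2) (auto simp: finite_cands_of in_cands_of F weight_nonneg)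
        finally show ?thesis .
      qed
      ultimately show ?thesis using weight_sum_le[OF F(1) n] by simp
    qed
    finally show ?thesis .
  qed
  have feas: "feasible I u'" using nonneg le by (auto simp: feasible_def)
  have "card B' = card B"
    using S cmax F by (simp add: card_insert_if) (metis Suc_pred card_gt_0_iff)
  then have full': "full_solution I B' u'"
    using feas S cmax F by (auto simp: full_solution_def solution_def)
  have "?t \<le> prescore I B u cmax ?t" using score_props(2)[OF F(1), of B cmax] cmax by simp
  \<comment> \<open>Dropping the nonnegative capped weight of \<open>cmin\<close> from the sum
    increases the slack.\<close>
  also have "\<dots> \<le> (\<Sum>n\<in>voters_of I cmax. slack I ?A u n ?t)"
    unfolding prescore_def slack_capped
    by (intro sum_mono diff_left_mono sum_mono2) (auto simp: finite_cands_of in_cands_of F t0 capped_nonneg)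
  also have "\<dots> = supp I u' cmax"
    unfolding supp_def by (intro sum.cong) (auto simp: u' in_voters_of)
  finally have s1: "?t \<le> supp I u' cmax" .
  have s2: "min (supp I u c) ?t \<le> supp I u' c" if c: "c \<in> ?A" for c
  proof -
    have "(\<Sum>n\<in>voters_of I c. capped u ?t n c) \<le> supp I u' c"
      unfolding supp_def using c cmax
      by (intro sum_mono) (auto simp: u' in_voters_of F capped_le)
    then show ?thesis using sum_capped[OF F(1) t0, of c] by simp
  qed
  have s3: "supp I u' c = supp I u c"
    if z: "\<forall>n\<in>voters_of I cmax. strength I n = 0" and c: "c \<in> ?A" for c
    unfolding supp_def
  proof (rule sum.cong)
    fix n assume n: "n \<in> voters_of I c"
    then have e: "(n, c) \<in> edges I" by (simp add: in_voters_of)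
    show "u' n c = u n c"
    proof (cases "(n, cmax) \<in> edges I")
      case True
      have nv: "n \<in> voters I" using e edges_subset by auto
      \<comment> \<open>A voter without strength carries no weight at all, so capping changes
        nothing.\<close>
      have "u n c \<le> (\<Sum>c\<in>cands_of I n. u n c)"
        using e by (intro member_le_sum) (auto simp: in_cands_of weight_nonneg F finite_cands_of)
      then have "u n c = 0"
        using weight_sum_le[OF F(1) nv] z True weight_nonneg[OF F(1) e] by (simp add: in_voters_of)
      then show ?thesis using c cmax e True by (auto simp: u' capped_def)
    next
      case False then show ?thesis using c cmax e by (auto simp: u')
    qed
  qed simp
  show ?thesis using that[OF S cmax th full' s1 s2 s3] by blast
qed

section \<open>Counting exchanges\<close>

definition full :: "'c set \<times> ('v, 'c) weight \<Rightarrow> bool" where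
  "full S \<longleftrightarrow> full_solution I (fst S) (snd S)"

definition minsupp :: "'c set \<times> ('v, 'c) weight \<Rightarrow> real" where
  "minsupp S = supp_set I (snd S) (fst S)"

definition low :: "real \<Rightarrow> 'c set \<times> ('v, 'c) weight \<Rightarrow> nat" where
  "low x S = card {c \<in> fst S. supp I (snd S) c < x}"

abbreviation "average \<equiv> tot_str / real (seats I)"

lemma full_Pair [simp]: "full (B, u) \<longleftrightarrow> full_solution I B u"
  and minsupp_Pair [simp]: "minsupp (B, u) = supp_set I u B"
  by (simp_all add: full_def minsupp_def)

lemma minsupp_nonneg: "full S \<Longrightarrow> 0 \<le> minsupp S"
  by (simp add: full_def minsupp_def supp_set_nonneg)

lemma minsupp_le_average: "full S \<Longrightarrow> minsupp S \<le> average"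
  by (simp add: full_def minsupp_def supp_set_le_average)

lemma average_nonneg: "0 \<le> average"
  by (simp add: total_nonneg)

lemma low_eq_0_iff: "full S \<Longrightarrow> low x S = 0 \<longleftrightarrow> x \<le> minsupp S"
  unfolding full_def minsupp_def low_def
  using supp_set_geI[of "fst S" "snd S" x] supp_set_le[of "fst S" "snd S"]
    full_solutionD(4)[of "fst S" "snd S"]
  by (auto simp: not_less) (meson order_trans)

lemma low_le_seats: "full S \<Longrightarrow> low x S \<le> seats I"
  unfolding full_def low_def using full_solutionD[of "fst S" "snd S"]
  by (metis (no_types, lifting) card_mono mem_Collect_eq subsetI)

lemma ls_step_full:
  assumes "ls_step I \<theta> S S'" "full S"
  shows "full S'"
proof -
  have "ls_step I \<theta> (fst S, snd S) (fst S', snd S')" using assms by simp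
  then show ?thesis by (rule ls_step_props) (use assms in \<open>simp_all add: full_def\<close>)
qed

lemma ls_steps_full:
  assumes "(ls_step I \<theta> ^^ j) S S'" "full S"
  shows "full S'"
  using assms(1)
proof (induction j arbitrary: S')
  case 0
  then show ?case using assms(2) by simp
next
  case (Suc j)
  then show ?case using ls_step_full by (meson relpowp_Suc_E)
qed

lemma ls_step_low:
  assumes "ls_step I \<theta> S S'" "full S" "x \<le> \<theta> S"
  shows "low x S' \<le> low x S - 1"
proof -
  obtain B u B' u' where S: "S = (B, u)" "S' = (B', u')" by (cases S, cases S')
  have full: "full_solution I B u" using assms S by simp
  have step: "ls_step I \<theta> (B, u) (B', u')" using assms S by simp
  obtain cmin cmax where p: "B' = insert cmax (B - {cmin})" "cmin \<in> B"
    "supp I u cmin = supp_set I u B" "\<theta> (B, u) \<le> max_score I B u"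
    "max_score I B u \<le> supp I u' cmax"
    "\<And>c. c \<in> B - {cmin} \<Longrightarrow> min (supp I u c) (max_score I B u) \<le> supp I u' c"
    by (rule ls_step_props[OF step full]) blast
  let ?L = "{c \<in> B. supp I u c < x}"
  have finL: "finite ?L" using full_solutionD(4)[OF full] by simp
  have x: "x \<le> max_score I B u" using p assms S by auto
  have sub: "{c \<in> B'. supp I u' c < x} \<subseteq> ?L - {cmin}"
  proof
    fix c assume c: "c \<in> {c \<in> B'. supp I u' c < x}"
    then have "c \<noteq> cmax" using p(5) x by auto
    then have "c \<in> B - {cmin}" using c p(1) by auto
    then show "c \<in> ?L - {cmin}" using p(6)[of c] c x by auto
  qed
  have "card {c \<in> B'. supp I u' c < x} \<le> card (?L - {cmin})"
    using sub finL by (intro card_mono) auto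
  \<comment> \<open>If some member lies below \<open>x\<close>, then so does \<open>cmin\<close>,
    which is gone afterwards. If none does, truncated subtraction leaves 0 on both sides.\<close>
  also have "\<dots> \<le> card ?L - 1"
  proof (cases "?L = {}")
    case False
    then obtain c where "c \<in> B" "supp I u c < x" by auto
    then have "cmin \<in> ?L" using p supp_set_le[OF full] by force
    then show ?thesis by simp
  next
    case True
    then show ?thesis by (metis Diff_empty bot.extremum_uniqueI card.empty diff_0_eq_0 empty_Diff order_refl)
  qed
  finally show ?thesis by (simp add: low_def S)
qed

text \<open>\<open>m\<close> is a lower bound that has to persist, and \<open>x\<close> a target
  that the threshold dominates as long as \<open>m\<close> does persist. The first condition on
  \<open>\<theta>\<close> keeps the least support from falling, so the second stays applicable
  throughout.\<close>

lemma ls_steps_low: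
  assumes "(ls_step I \<theta> ^^ j) S S'" "full S" "m \<le> minsupp S"
    and \<theta>: "\<And>S. full S \<Longrightarrow> minsupp S \<le> \<theta> S" "\<And>S. full S
        \<Longrightarrow> m \<le> minsupp S \<Longrightarrow> x \<le> \<theta> S"
  shows "full S' \<and> minsupp S \<le> minsupp S' \<and> low x S' \<le> seats I - j"
  using assms(1)
proof (induction j arbitrary: S')
  case 0
  then show ?case using assms(2) low_le_seats by simp
next
  case (Suc j)
  then obtain T where T: "(ls_step I \<theta> ^^ j) S T" "ls_step I \<theta> T S'" by auto
  have IH: "full T" "minsupp S \<le> minsupp T" "low x T \<le> seats I - j"
    using Suc.IH[OF T(1)] by simp_all
  have f: "full S'" by (rule ls_step_full[OF T(2) IH(1)])
  \<comment> \<open>With the current least support as target the count is 0 and remains 0, which is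
    monotonicity of the least support.\<close>
  have "low (minsupp T) S' \<le> low (minsupp T) T - 1"
    by (rule ls_step_low[OF T(2) IH(1) \<theta>(1)[OF IH(1)]])
  also have "low (minsupp T) T = 0" using low_eq_0_iff[OF IH(1)] by simp
  finally have "minsupp T \<le> minsupp S'" using low_eq_0_iff[OF f] by simp
  moreover have "low x S' \<le> low x T - 1"
    by (rule ls_step_low[OF T(2) IH(1) \<theta>(2)[OF IH(1)]]) (use assms(3) IH(2) in linarith)
  ultimately show ?case using IH f by linarith
qed

lemma ls_steps_minsupp:
  assumes "(ls_step I \<theta> ^^ j) S S'" "full S" "m \<le> minsupp S" "seats I \<le> j"
    and "\<And>S. full S \<Longrightarrow> minsupp S \<le> \<theta> S" "\<And>S. full S \<Longrightarrow> m \<le>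
        minsupp S \<Longrightarrow> x \<le> \<theta> S"
  shows "x \<le> minsupp S'"
proof -
  have "full S'" "low x S' \<le> seats I - j" using ls_steps_low[OF assms(1,2,3,5,6)] by auto
  then show ?thesis using low_eq_0_iff[of S' x] assms(4) by simp
qed

lemma ls_threshold_eq:
  "card A = seats I \<Longrightarrow> ls_threshold I \<epsilon> A S = min ((1 + \<epsilon>) * minsupp S) average"
  "card A = seats I \<Longrightarrow> ls_threshold_inf I A S = average"
  by (cases S; simp add: ls_threshold_def ls_threshold_inf_def t_hat_def)+

text \<open>The least support never exceeds the average, so both thresholds dominate it, and no
  exchange happens at a score below it.\<close>

lemma ls_threshold_ge:
  assumes "card A = seats I" "0 < \<epsilon>" "full S"
  shows "minsupp S \<le> ls_threshold I \<epsilon> A S" "minsupp S \<le> ls_threshold_inf I A S"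
  using assms minsupp_nonneg[OF assms(3)] minsupp_le_average[OF assms(3)]
  by (auto simp: ls_threshold_eq distrib_right)

lemma ls_stop_iff: "ls_stop I \<theta> S \<longleftrightarrow> max_score I (fst S) (snd S) < \<theta> S"
  by (cases S) (simp add: ls_stop_def)

lemma not_ls_stop_if_ls_step: "ls_step I \<theta> S S' \<Longrightarrow> \<not> ls_stop I \<theta> S"
  by (auto elim: ls_step.cases)

lemma ls_step_exists:
  assumes "full S" "\<not> ls_stop I \<theta> S"
  shows "\<exists>S'. ls_step I \<theta> S S'"
proof -
  obtain B u where S: "S = (B, u)" by (cases S)
  then have full: "full_solution I B u" using assms by simp
  obtain cmin where cmin: "cmin \<in> B" "supp I u cmin = supp_set I u B" using supp_set_attained[OF full] .
  obtain cmax where cmax: "cmax \<in> cands I - B" "score I B u cmax = max_score I B u"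
    using max_score_attained[OF full] .
  show ?thesis
    unfolding S
    by (rule exI, rule ls_step.intros[OF cmin cmax(1) refl cmax(2) _ refl]) (use assms S in simp)
qed

lemma ls_stop_if_average:
  assumes "full S" "0 < tot_str" "average \<le> minsupp S" "average \<le> \<theta> S"
  shows "ls_stop I \<theta> S"
  using max_score_less_average[of "fst S" "snd S"] assms by (auto simp: ls_stop_iff full_def minsupp_def)

lemma ls_steps_growth:
  assumes "card A = seats I" "0 < \<epsilon>" "full S" "(ls_step I (ls_threshold I \<epsilon> A) ^^ (seats I * q)) S S'"
  shows "min ((1 + \<epsilon>) ^ q * minsupp S) average \<le> minsupp S'"
  using assms(4)
proof (induction q arbitrary: S')
  case 0
  then show ?case by auto
next
  case (Suc q)
  let ?\<theta> = "ls_threshold I \<epsilon> A"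
  let ?m = "min ((1 + \<epsilon>) ^ q * minsupp S) average"
  obtain T where T: "(ls_step I ?\<theta> ^^ (seats I * q)) S T" "(ls_step I ?\<theta> ^^ seats I) T S'"
    using Suc.prems relpowp_add[of "seats I * q" "seats I" "ls_step I ?\<theta>"]
    by (auto simp: add.commute)
  have m: "?m \<le> minsupp T" by (rule Suc.IH[OF T(1)])
  have fT: "full T"
    by (rule ls_steps_full[OF T(1) assms(3)])
  have "min ((1 + \<epsilon>) * ?m) average \<le> minsupp S'"
  proof (rule ls_steps_minsupp[OF T(2) fT m order_refl])
    show "minsupp S \<le> ?\<theta> S" if "full S" for S by (rule ls_threshold_ge(1)[OF assms(1,2) that])
    show "min ((1 + \<epsilon>) * ?m) average \<le> ?\<theta> S" if "?m \<le> minsupp S" for S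
      unfolding ls_threshold_eq(1)[OF assms(1)]
      by (intro min.mono order_refl mult_left_mono that) (use assms in auto)
  qed
  \<comment> \<open>Once the power passes the average, \<open>?m\<close> is the average itself, and
    the factor \<open>1 + \<epsilon>\<close> does not bring it down.\<close>
  moreover have "min ((1 + \<epsilon>) ^ Suc q * minsupp S) average \<le> min ((1 + \<epsilon>) * ?m) average"
  proof -
    have "average \<le> (1 + \<epsilon>) * average"
      using average_nonneg assms(2) mult_right_mono[of 1 "1 + \<epsilon>" average] by linarith
    then have "(1 + \<epsilon>) * ?m \<ge> min ((1 + \<epsilon>) ^ Suc q * minsupp S) average"
      using assms(2) by (cases "(1 + \<epsilon>) ^ q * minsupp S \<le> average") (simp_all add: mult.assoc min_le_iff_disj)
    then show ?thesis by simp
  qed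
  ultimately show ?case by linarith
qed

end

section \<open>Attainment of the optimal value\<close>

text \<open>Bolzano-Weierstrass, one coordinate at a time: each new coordinate thins out the
  subsequence further, which preserves the convergence already achieved. Only finitely many
  coordinates matter, as weights are total functions read on edges alone.\<close>

lemma convergent_subseq_finite:
  fixes f :: "nat \<Rightarrow> 'e \<Rightarrow> real"
  assumes "finite E" "\<And>e. e \<in> E \<Longrightarrow> Bseq (\<lambda>j. f j e)"
  shows "\<exists>r. strict_mono (r :: nat \<Rightarrow> nat) \<and> (\<forall>e\<in>E. convergent (\<lambda>j. f (r j) e))"
  using assms
proof (induction E rule: finite_induct)
  case empty
  show ?case using strict_mono_id by (auto simp: id_def)
next
  case (insert e E)
  then obtain r :: "nat \<Rightarrow> nat" where r: "strict_mono r" "\<forall>e\<in>E. convergent (\<lambda>j. f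
      (r j) e)" by blast
  obtain g where g: "strict_mono g" "monoseq (\<lambda>n. f (r (g n)) e)"
    using seq_monosub[of "\<lambda>j. f (r j) e"] by auto
  have rg: "strict_mono (r \<circ> g)" using r g by (simp add: strict_mono_o)
  have "Bseq (\<lambda>n. f (r (g n)) e)"
    using insert.prems[of e] by (auto simp: Bseq_def)
  then have "convergent (\<lambda>n. f (r (g n)) e)" using g Bseq_monoseq_convergent by blast
  moreover have "convergent (\<lambda>n. f (r (g n)) e')" if "e' \<in> E" for e'
    using convergent_subseq_convergent[of "\<lambda>j. f (r j) e'" g] r g that by (simp add: o_def)
  ultimately have "\<forall>e'\<in>insert e E. convergent (\<lambda>j. f ((r \<circ> g) j) e')" by simp
  then show ?case using rg by blast
qed

context election_instance
begin

lemma weight_le_strength: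
  assumes "feasible I w" "(n, c) \<in> edges I"
  shows "w n c \<le> strength I n"
proof -
  have "w n c \<le> (\<Sum>c\<in>cands_of I n. w n c)"
    using assms by (intro member_le_sum) (auto simp: in_cands_of weight_nonneg finite_cands_of)
  then show ?thesis using weight_sum_le[OF assms(1), of n] assms edges_subset by force
qed

text \<open>Feasible weights are bounded by the strengths on each edge, so a sequence approaching
  the supremum has a subsequence converging on all edges. Feasibility and lower bounds on supports
  are closed conditions on finite sums and pass to the limit.\<close>

lemma optimal_weight_exists:
  assumes A: "A \<subseteq> cands I" "card A = seats I"
  shows "\<exists>w. full_solution I A w \<and> (\<forall>w'. full_solution I A w' \<longrightarrow> supp_set I w'
      A \<le> supp_set I w A)"
proof -
  let ?V = "{supp_set I w A |w. feasible I w}"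
  have full_iff: "full_solution I A w \<longleftrightarrow> feasible I w" for w
    using A by (auto simp: full_solution_def solution_def)
  have "feasible I (\<lambda>_ _. 0)" by (auto simp: feasible_def strength_nonneg)
  then have ne: "?V \<noteq> {}" by auto
  have bdd: "bdd_above ?V"
  proof (rule bdd_aboveI)
    fix x assume "x \<in> ?V"
    then show "x \<le> average" using supp_set_le_average full_iff by blast
  qed
  have "\<exists>w. feasible I w \<and> Sup ?V - inverse (real (Suc j)) < supp_set I w A" for j
  proof -
    have "Sup ?V - inverse (real (Suc j)) < Sup ?V" by simp
    then obtain x where "x \<in> ?V" "Sup ?V - inverse (real (Suc j)) < x"
      using less_cSup_iff[OF ne bdd] by blast
    then show ?thesis by blast
  qed
  then have "\<forall>j. \<exists>w. feasible I w \<and> Sup ?V - inverse (real (Suc j)) < supp_set I w A" by blast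
  from choice[OF this] obtain W where W: "\<And>j. feasible I (W j)"
    "\<And>j. Sup ?V - inverse (real (Suc j)) < supp_set I (W j) A" by blast
  have "finite (edges I)"
    using finite_subset[OF edges_subset] finite_voters finite_cands by auto
  moreover have "Bseq (\<lambda>j. W j (fst e) (snd e))" if "e \<in> edges I" for e
  proof (rule BseqI'[of _ "strength I (fst e)"])
    fix j
    have e: "(fst e, snd e) \<in> edges I" using that by simp
    show "norm (W j (fst e) (snd e)) \<le> strength I (fst e)"
      using weight_le_strength[OF W(1) e, of j] weight_nonneg[OF W(1) e, of j] by simp
  qed
  ultimately obtain r where r: "strict_mono r"
    and conv: "\<And>e. e \<in> edges I \<Longrightarrow> convergent (\<lambda>j. W (r j) (fst e) (snd e))"
    using convergent_subseq_finite[of "edges I" "\<lambda>j e. W j (fst e) (snd e)"] by blast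
  define w where "w n c = lim (\<lambda>j. W (r j) n c)" for n c
  have lim: "(\<lambda>j. W (r j) n c) \<longlonglongrightarrow> w n c" if "(n, c) \<in> edges I" for n c
    using conv[OF that] unfolding w_def convergent_LIMSEQ_iff by simp
  have "0 \<le> w n c" if e: "(n, c) \<in> edges I" for n c
    by (rule LIMSEQ_le_const[OF lim[OF e]]) (use weight_nonneg[OF W(1) e] in auto)
  moreover have "(\<Sum>c\<in>cands_of I n. w n c) \<le> strength I n" if n: "n \<in> voters I" for n
  proof (rule LIMSEQ_le_const2)
    show "(\<lambda>j. \<Sum>c\<in>cands_of I n. W (r j) n c) \<longlonglongrightarrow> (\<Sum>c\<in>cands_of I n. w n c)"
      by (intro tendsto_sum lim) (simp add: in_cands_of)
    show "\<exists>N. \<forall>j\<ge>N. (\<Sum>c\<in>cands_of I n. W (r j) n c) \<le> strength I n"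
      using weight_sum_le[OF W(1) n] by auto
  qed
  ultimately have feas: "feasible I w" by (auto simp: feasible_def)
  have "Sup ?V \<le> supp_set I w A"
  proof (rule supp_set_geI)
    fix c assume c: "c \<in> A"
    show "Sup ?V \<le> supp I w c"
    proof (rule LIMSEQ_le)
      show "(\<lambda>j. Sup ?V - inverse (real (Suc j))) \<longlonglongrightarrow> Sup ?V"
        using tendsto_diff[OF tendsto_const LIMSEQ_inverse_real_of_nat, of "Sup ?V"] by simp
      show "(\<lambda>j. supp I (W (r j)) c) \<longlonglongrightarrow> supp I w c"
        unfolding supp_def by (intro tendsto_sum lim) (simp add: in_voters_of)
      have "Sup ?V - inverse (real (Suc j)) \<le> supp I (W (r j)) c" for j
      proof -
        \<comment> \<open>A strictly increasing \<open>r\<close> has \<open>j \<le> r j\<close>, so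
          along the subsequence the error is no larger.\<close>
        have "inverse (real (Suc (r j))) \<le> inverse (real (Suc j))"
          using seq_suble[OF r, of j] by (intro le_imp_inverse_le) auto
        moreover have "supp_set I (W (r j)) A \<le> supp I (W (r j)) c"
          by (rule supp_set_le[OF _ c]) (simp add: full_iff W(1))
        ultimately show ?thesis using W(2)[of "r j"] by linarith
      qed
      then show "\<exists>N. \<forall>n\<ge>N. Sup ?V - inverse (real (Suc n)) \<le> supp I (W (r n)) c" by blast
    qed
  qed (simp add: full_iff feas)
  moreover have "supp_set I w' A \<le> Sup ?V" if "feasible I w'" for w'
    using that by (intro cSup_upper bdd) auto
  ultimately have "\<forall>w'. full_solution I A w' \<longrightarrow> supp_set I w' A \<le> supp_set I w A"
    using full_iff by force
  then show ?thesis using feas full_iff by blast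
qed

text \<open>There are finitely many committees of the right size; the best of their individual
  optima is the \<open>GREATEST\<close> in \<open>OPT\<close>.\<close>

lemma OPT_attained:
  obtains A w where "full_solution I A w" "supp_set I w A = OPT I"
    "\<And>A' w'. full_solution I A' w' \<Longrightarrow> supp_set I w' A' \<le> OPT I"
proof -
  let ?\<A> = "{A. A \<subseteq> cands I \<and> card A = seats I}"
  have fin: "finite ?\<A>" using finite_cands by auto
  have ne: "?\<A> \<noteq> {}"
    using obtain_subset_with_card_n[of "seats I" "cands I"] seats_less by auto
  obtain W where W: "\<And>A. A \<in> ?\<A> \<Longrightarrow> full_solution I A (W A)"
    "\<And>A w'. A \<in> ?\<A> \<Longrightarrow> full_solution I A w' \<Longrightarrow> supp_set I w' A \<le> supp_set I (W A) A"
  proof -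
    have "\<forall>A\<in>?\<A>. \<exists>w. full_solution I A w \<and> (\<forall>w'. full_solution I A w'
        \<longrightarrow> supp_set I w' A \<le> supp_set I w A)"
      using optimal_weight_exists by blast
    from bchoice[OF this] show ?thesis using that by blast
  qed
  let ?g = "\<lambda>A. supp_set I (W A) A"
  have "Max (?g ` ?\<A>) \<in> ?g ` ?\<A>" using fin ne by (intro Max_in) auto
  then obtain A where A: "A \<in> ?\<A>" "?g A = Max (?g ` ?\<A>)" by force
  have le: "supp_set I w' A' \<le> ?g A" if "full_solution I A' w'" for A' w'
  proof -
    have A': "A' \<in> ?\<A>" using full_solutionD[OF that] by auto
    then have "supp_set I w' A' \<le> ?g A'" using W that by blast
    also have "\<dots> \<le> ?g A" using A' A fin by simp
    finally show ?thesis .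
  qed
  have "OPT I = ?g A"
    unfolding OPT_def by (rule Greatest_equality) (use le W(1)[OF A(1)] in auto)
  then show ?thesis using that[of A "W A"] le W(1)[OF A(1)] by simp
qed

lemma supp_set_le_OPT: "full_solution I A w \<Longrightarrow> supp_set I w A \<le> OPT I"
  by (rule OPT_attained)

lemma minsupp_le_OPT: "full S \<Longrightarrow> minsupp S \<le> OPT I"
  by (simp add: full_def minsupp_def supp_set_le_OPT)

section \<open>Bounds on the number of exchanges\<close>

text \<open>If there were more than \<open>seats I * Suc q\<close> exchanges, consider the solution
  after that many. It cannot have grown by \<open>(1 + \<epsilon>) ^ Suc q\<close>, which would put
  it above the optimum; so it has reached the average, where the search stops. Here \<open>j\<close>
  counts exchanges, one less than the iterations of an execution that returns.\<close>

lemma ls_steps_bound: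
  assumes A: "card A = seats I" and \<epsilon>: "0 < \<epsilon>" and full: "full S" and \<alpha>: "1 \<le> \<alpha>"
    and apx: "OPT I / \<alpha> \<le> minsupp S" and pos: "0 < OPT I"
    and steps: "(ls_step I (ls_threshold I \<epsilon> A) ^^ j) S S'"
  shows "real j \<le> real (seats I) * (1 + log (1 + \<epsilon>) \<alpha>)"
proof -
  let ?\<theta> = "ls_threshold I \<epsilon> A" and ?L = "log (1 + \<epsilon>) \<alpha>"
  \<comment> \<open>The floor makes \<open>Suc q\<close> the least exponent whose power of
    \<open>1 + \<epsilon>\<close> exceeds \<alpha>, while \<open>Suc q\<close> stays within one of
    the logarithm.\<close>
  define q where "q = nat \<lfloor>?L\<rfloor>"
  have L0: "0 \<le> ?L" using \<epsilon> \<alpha> by simp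
  have "real q \<le> ?L" "?L < real (Suc q)"
    unfolding q_def using L0 by (auto simp: of_nat_nat) linarith+
  then have "\<alpha> < (1 + \<epsilon>) powr real (Suc q)"
    using \<epsilon> \<alpha> by (simp add: log_less_iff)
  then have q: "\<alpha> < (1 + \<epsilon>) ^ Suc q" using \<epsilon> by (subst (asm) powr_realpow) auto
  have m: "0 < minsupp S" using apx pos \<alpha> by (smt (verit) divide_pos_pos)
  have "j \<le> seats I * Suc q"
  proof (rule ccontr)
    assume "\<not> j \<le> seats I * Suc q"
    then obtain i where "j = seats I * Suc q + Suc i" using less_iff_Suc_add[of "seats I * Suc q" j] by auto
    then have "((ls_step I ?\<theta> ^^ (seats I * Suc q)) OO (ls_step I ?\<theta> ^^ Suc i)) S S'"
      using steps relpowp_add[of "seats I * Suc q" "Suc i" "ls_step I ?\<theta>"] by simp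
    then obtain T where T: "(ls_step I ?\<theta> ^^ (seats I * Suc q)) S T" "(ls_step I ?\<theta> ^^ Suc i) T S'"
      by auto
    have fT: "full T" using ls_steps_full T full by blast
    have "OPT I < (1 + \<epsilon>) ^ Suc q * minsupp S"
    proof -
      have "OPT I \<le> \<alpha> * minsupp S" using apx \<alpha> by (simp add: field_simps)
      also have "\<dots> < (1 + \<epsilon>) ^ Suc q * minsupp S" using q m by (rule mult_strict_right_mono)
      finally show ?thesis .
    qed
    then have avg: "average \<le> minsupp T"
      using ls_steps_growth[OF A \<epsilon> full T(1)] minsupp_le_OPT[OF fT] by linarith
    have "0 < average" using m minsupp_le_average[OF full] by linarith
    then have tot: "0 < tot_str" using seats_pos by (simp add: zero_less_divide_iff)
    have "average \<le> ?\<theta> T" using avg ls_threshold_ge(1)[OF A \<epsilon> fT] by linarith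
    then have "ls_stop I ?\<theta> T" by (rule ls_stop_if_average[OF fT tot avg])
    moreover obtain y where "ls_step I ?\<theta> T y" using T(2) by (meson relpowp_Suc_D2)
    ultimately show False using not_ls_stop_if_ls_step by blast
  qed
  then have "real j \<le> real (seats I) * real (Suc q)" by (metis of_nat_le_iff of_nat_mult)
  also have "\<dots> \<le> real (seats I) * (1 + ?L)" using \<open>real q \<le> ?L\<close> by (intro mult_left_mono) auto
  finally show ?thesis .
qed

text \<open>The threshold is constantly the average, so the average itself can serve as the target
  \<open>x\<close>: a single batch of \<open>seats I\<close> exchanges lifts every support to
  it.\<close>

lemma ls_steps_inf_bound:
  assumes A: "card A = seats I" and full: "full S" and tot: "0 < tot_str"
    and steps: "(ls_step I (ls_threshold_inf I A) ^^ j) S S'"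
  shows "j \<le> seats I"
proof (rule ccontr)
  let ?\<theta> = "ls_threshold_inf I A"
  assume "\<not> j \<le> seats I"
  then obtain i where "j = seats I + Suc i" using less_iff_Suc_add[of "seats I" j] by auto
  then have "((ls_step I ?\<theta> ^^ seats I) OO (ls_step I ?\<theta> ^^ Suc i)) S S'"
    using steps relpowp_add[of "seats I" "Suc i" "ls_step I ?\<theta>"] by simp
  then obtain T where T: "(ls_step I ?\<theta> ^^ seats I) S T" "(ls_step I ?\<theta> ^^ Suc i) T S'"
    by auto
  have fT: "full T" using ls_steps_full T full by blast
  have "average \<le> minsupp T"
    by (rule ls_steps_minsupp[OF T(1) full order_refl order_refl])
       (use A ls_threshold_ge(2)[OF A zero_less_one] in \<open>auto simp: ls_threshold_eq\<close>)
  then have "ls_stop I ?\<theta> T"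
    using ls_stop_if_average[OF fT tot] ls_threshold_eq(2)[OF A] by simp
  moreover obtain y where "ls_step I ?\<theta> T y" using T(2) by (meson relpowp_Suc_D2)
  ultimately show False using not_ls_stop_if_ls_step by blast
qed

section \<open>Termination from an arbitrary start\<close>

text \<open>Ties are the only source of branching. Finiteness of the set of reachable solutions
  later turns bounds that depend on an intermediate solution into a common one.\<close>

lemma finite_ls_step:
  "finite {S'. ls_step I \<theta> S S'}" if "full S"
proof -
  obtain B u where S: "S = (B, u)" by (cases S)
  let ?g = "\<lambda>(cmin, cmax). insert_cand I (B - {cmin}) (\<lambda>n c. if c \<in> B - {cmin} then u n c else
      0) cmax (max_score I B u)"
  have "{S'. ls_step I \<theta> S S'} \<subseteq> ?g ` (B \<times> cands I)"
  proof
    fix S' assume "S' \<in> {S'. ls_step I \<theta> S S'}"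
    then have "ls_step I \<theta> (B, u) S'" using S by simp
    then show "S' \<in> ?g ` (B \<times> cands I)"
    proof cases
      case (1 cmin cmax tmax u0)
      then have "S' = ?g (cmin, cmax)" by simp
      moreover have "(cmin, cmax) \<in> B \<times> cands I" using 1 by simp
      ultimately show ?thesis by (rule image_eqI)
    qed
  qed
  moreover have "finite (B \<times> cands I)"
    using that S finite_cands full_solutionD(4)[of B u] by simp
  ultimately show ?thesis using finite_subset by blast
qed

lemma finite_ls_steps:
  assumes "full S"
  shows "finite {S'. (ls_step I \<theta> ^^ j) S S'}"
proof (induction j)
  case 0
  show ?case by simp
next
  case (Suc j)
  have "{S'. (ls_step I \<theta> ^^ Suc j) S S'} = (\<Union>T\<in>{T. (ls_step I \<theta> ^^ j) S T}. {S'. ls_step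
      I \<theta> T S'})"
    by auto
  moreover have "finite {S'. ls_step I \<theta> T S'}" if "T \<in> {T. (ls_step I \<theta> ^^ j) S T}" for T
    using that finite_ls_step ls_steps_full[OF _ assms] by blast
  ultimately show ?case using Suc by simp
qed

text \<open>The largest support that \<open>c\<close> can receive, and also its prescore at 0; so it
  is positive exactly if the score can be positive.\<close>

definition backing :: "'c \<Rightarrow> real" where
  "backing c = (\<Sum>n\<in>voters_of I c. strength I n)"

lemma prescore_0: "prescore I A w c 0 = backing c"
  by (simp add: prescore_def slack_def backing_def)

lemma score_pos:
  assumes "feasible I w" "0 < backing c"
  shows "0 < score I A w c"
proof -
  have "score I A w c \<noteq> 0"
    using score_props(2)[OF assms(1), of A c] prescore_0[of A w c] assms(2) by auto
  then show ?thesis using score_props(1)[OF assms(1), of A c] by linarith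
qed

lemma supp_le_backing:
  assumes "feasible I w"
  shows "supp I w c \<le> backing c"
  unfolding supp_def backing_def
  by (intro sum_mono weight_le_strength[OF assms]) (simp add: in_voters_of)

lemma strength_eq_0_if_backing:
  assumes "backing c \<le> 0" "n \<in> voters_of I c"
  shows "strength I n = 0"
proof -
  have nn: "\<And>n. n \<in> voters_of I c \<Longrightarrow> 0 \<le> strength I n" using strength_nonneg voters_of_subset by blast
  then have "backing c = 0" using assms(1) sum_nonneg[of "voters_of I c" "strength I"]
    by (simp add: backing_def)
  then show ?thesis
    using sum_nonneg_eq_0_iff[of "voters_of I c" "strength I"] finite_voters_of nn assms(2)
    by (simp add: backing_def)
qed

definition zeros :: "'c set \<times> ('v, 'c) weight \<Rightarrow> nat" where
  "zeros S = card {c \<in> fst S. supp I (snd S) c \<le> 0}"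

text \<open>The last summand flags that no outside candidate has backing, so that the next score is
  0. The factor 2 lets a drop in \<open>zeros\<close> outweigh the flag being raised.\<close>

definition potential :: "'c set \<times> ('v, 'c) weight \<Rightarrow> nat" where
  "potential S = 2 * zeros S + (if \<exists>c\<in>cands I - fst S. 0 < backing c then 0 else 1)"

text \<open>An exchange at score 0 gains nothing by itself. It happens only if every candidate outside the
  committee lacks backing; as \<open>0 < OPT I\<close>, the candidate it removes then has backing, so the next
  exchange has positive score.\<close>

lemma potential_decreases:
  assumes OPT: "0 < OPT I" and step: "ls_step I \<theta> S S'" and fullS: "full S" and z: "minsupp S \<le> 0"
  shows "potential S' < potential S"
proof -
  obtain B u B' u' where S: "S = (B, u)" "S' = (B', u')" by (cases S, cases S')
  have full: "full_solution I B u" using fullS S by simp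
  note F = full_solutionD[OF full]
  have step': "ls_step I \<theta> (B, u) (B', u')" using step S by simp
  obtain cmin cmax where p: "B' = insert cmax (B - {cmin})" "cmin \<in> B"
    "supp I u cmin = supp_set I u B" "cmax \<in> cands I - B"
    "max_score I B u \<le> supp I u' cmax"
    "\<And>c. c \<in> B - {cmin} \<Longrightarrow> min (supp I u c) (max_score I B u) \<le> supp I u' c"
    "\<And>c. \<forall>n\<in>voters_of I cmax. strength I n = 0 \<Longrightarrow> c \<in> B - {cmin} \<Longrightarrow>
       supp I u' c = supp I u c"
    by (rule ls_step_props[OF step' full]) blast
  let ?Z = "{c \<in> B. supp I u c \<le> 0}" and ?Z' = "{c \<in> B'. supp I u' c \<le> 0}"
  have finZ: "finite ?Z" using F by simp
  have cmin: "cmin \<in> ?Z" using p z S by simp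
  then have cardZ: "Suc (card (?Z - {cmin})) = card ?Z"
    using finZ by (metis card_Suc_Diff1)
  show ?thesis
  proof (cases "\<exists>c\<in>cands I - B. 0 < backing c")
    case True
    then obtain c where c: "c \<in> cands I - B" "0 < backing c" by blast
    have "0 < max_score I B u"
      using score_pos[OF F(1) c(2), of B] score_le_max_score[OF c(1), of u] by linarith
    have "?Z' \<subseteq> ?Z - {cmin}"
    proof
      fix c assume c: "c \<in> ?Z'"
      then have "c \<noteq> cmax" using p(5) \<open>0 < max_score I B u\<close> by auto
      then have "c \<in> B - {cmin}" using c p(1) by auto
      then show "c \<in> ?Z - {cmin}" using p(6)[of c] c \<open>0 < max_score I B u\<close> by auto
    qed
    then have "card ?Z' \<le> card (?Z - {cmin})" using finZ by (intro card_mono) auto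
    then have "zeros S' < zeros S" using cardZ by (simp add: zeros_def S)
    moreover have "potential S = 2 * zeros S" using True by (simp add: potential_def S)
    moreover have "potential S' \<le> 2 * zeros S' + 1" by (simp add: potential_def)
    ultimately show ?thesis by linarith
  next
    case False
    obtain A w where A: "full_solution I A w" "supp_set I w A = OPT I" by (rule OPT_attained)
    have posA: "0 < backing c" if "c \<in> A" for c
      using supp_set_le[OF A(1) that] supp_le_backing[OF full_solutionD(1)[OF A(1)], of c] A(2) OPT
      by linarith
    \<comment> \<open>All members of an optimal committee have backing, so here they lie in
      \<open>B\<close>, and equal cardinality makes that committee \<open>B\<close> itself. Hence
      the removed \<open>cmin\<close> has backing.\<close>
    have "A \<subseteq> B" using False posA full_solutionD(2)[OF A(1)] by blast
    then have "A = B" using F full_solutionD[OF A(1)] by (simp add: card_subset_eq)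
    then have "0 < backing cmin" using posA p by blast
    moreover have "cmin \<in> cands I - B'" using p F by auto
    ultimately have pot': "potential S' = 2 * zeros S'" by (auto simp: potential_def S)
    have "backing cmax \<le> 0" using False p(4) not_less by blast
    then have eq: "supp I u' c = supp I u c" if "c \<in> B - {cmin}" for c
      using p(7) strength_eq_0_if_backing that by simp
    have "?Z' \<subseteq> insert cmax (?Z - {cmin})" using eq p(1) by auto
    then have "card ?Z' \<le> card (insert cmax (?Z - {cmin}))" using finZ by (intro card_mono) auto
    also have "\<dots> \<le> card ?Z" using cardZ finZ by (simp add: card_insert_if)
    finally have "zeros S' \<le> zeros S" by (simp add: zeros_def S)
    moreover have "potential S = 2 * zeros S + 1" using False by (auto simp: potential_def S)
    ultimately show ?thesis using pot' by linarith
  qed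
qed

text \<open>A positive least support stays positive by monotonicity; as long as it is 0, each
  exchange costs one unit of potential.\<close>

lemma ls_steps_potential:
  assumes OPT: "0 < OPT I" and fullS: "full S" and \<theta>: "\<And>S. full S \<Longrightarrow> minsupp S \<le> \<theta> S"
    and "(ls_step I \<theta> ^^ j) S S'"
  shows "0 < minsupp S' \<or> potential S' + j \<le> potential S"
  using assms(4)
proof (induction j arbitrary: S')
  case 0
  then show ?case by simp
next
  case (Suc j)
  then obtain T where T: "(ls_step I \<theta> ^^ j) S T" "ls_step I \<theta> T S'" by (meson relpowp_Suc_E)
  have fT: "full T" by (rule ls_steps_full[OF T(1) fullS])
  have "(ls_step I \<theta> ^^ 1) T S'" using T(2) by (simp only: relpowp_1)
  then have mono: "minsupp T \<le> minsupp S'"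
    using ls_steps_low[OF _ fT order_refl \<theta>, of 1 S' "minsupp T"] order_trans[OF _ \<theta>] by blast
  show ?case
  proof (cases "0 < minsupp T")
    case True
    then show ?thesis using mono by linarith
  next
    case False
    then have "potential S' < potential T" using potential_decreases[OF OPT T(2) fT] by linarith
    then show ?thesis using Suc.IH[OF T(1)] False by linarith
  qed
qed

lemma potential_le: "full S \<Longrightarrow> potential S \<le> 2 * seats I + 1"
proof -
  assume f: "full S"
  have "zeros S \<le> card (fst S)"
    unfolding zeros_def using f full_solutionD(4)[of "fst S" "snd S"]
    by (intro card_mono) (auto simp: full_def)
  then have "zeros S \<le> seats I" using f full_solutionD(3)[of "fst S" "snd S"] by (simp add: full_def)
  then show ?thesis by (simp add: potential_def)
qed

text \<open>After \<open>J\<close> exchanges the least support is positive, so the solution is an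
  approximation with the finite factor \<open>?\<alpha>\<close>, and \<open>ls_steps_bound\<close>
  applies from there.\<close>

lemma ls_terminates:
  assumes A: "card A = seats I" and \<epsilon>: "0 < \<epsilon>" and fullS: "full S" and OPT: "0 < OPT I"
  shows "\<exists>b. \<forall>j S'. (ls_step I (ls_threshold I \<epsilon> A) ^^ j) S S' \<longrightarrow> real j \<le> b"
proof -
  let ?\<theta> = "ls_threshold I \<epsilon> A"
  \<comment> \<open>One more than the largest possible potential, so the potential cannot last for
    \<open>J\<close> exchanges.\<close>
  define J where "J = 2 * seats I + 2"
  let ?R = "{T. (ls_step I ?\<theta> ^^ J) S T}"
  let ?\<alpha> = "\<lambda>T. OPT I / minsupp T"
  let ?b = "\<lambda>T. real (seats I) * (1 + log (1 + \<epsilon>) (?\<alpha> T))"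
  have R: "full T" "0 < minsupp T" "1 \<le> ?\<alpha> T" "0 \<le> ?b T" if "T \<in> ?R" for T
  proof -
    show f: "full T" using that ls_steps_full[OF _ fullS] by blast
    show m: "0 < minsupp T"
      using ls_steps_potential[OF OPT fullS, of ?\<theta> J T] ls_threshold_ge(1)[OF A \<epsilon>] that
        potential_le[OF fullS] by (auto simp: J_def)
    show a: "1 \<le> ?\<alpha> T" using m minsupp_le_OPT[OF f] by simp
    show "0 \<le> ?b T" using a \<epsilon> by (intro mult_nonneg_nonneg add_nonneg_nonneg) auto
  qed
  have finR: "finite ?R" by (rule finite_ls_steps[OF fullS])
  \<comment> \<open>The sum of the nonnegative bounds over the finite set \<open>?R\<close> replaces
    a maximum and needs no case for an empty \<open>?R\<close>.\<close>
  have "real j \<le> real J + (\<Sum>T\<in>?R. ?b T)" if j: "(ls_step I ?\<theta> ^^ j) S S'" for j S'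
  proof (cases "j \<le> J")
    case True
    then show ?thesis using sum_nonneg[of ?R ?b] R(4) by force
  next
    case False
    then obtain i where i: "j = J + i" by (metis le_add_diff_inverse nat_le_linear)
    then obtain T where T: "(ls_step I ?\<theta> ^^ J) S T" "(ls_step I ?\<theta> ^^ i) T S'"
      using j relpowp_add[of J i "ls_step I ?\<theta>"] by auto
    have TR: "T \<in> ?R" using T by simp
    have "OPT I / ?\<alpha> T \<le> minsupp T" using R(2)[OF TR] OPT by simp
    then have "real i \<le> ?b T" using ls_steps_bound[OF A \<epsilon> R(1,3)[OF TR] _ OPT T(2)] by blast
    also have "\<dots> \<le> (\<Sum>T\<in>?R. ?b T)" by (rule member_le_sum[OF TR _ finR]) (use R(4) in blast)
    finally show ?thesis using i by simp
  qed
  then show ?thesis by blast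
qed

section \<open>Properties of returned solutions\<close>

lemma ls_terminates_withinI:
  assumes "full S" "\<And>j S'. (ls_step I \<theta> ^^ j) S S' \<Longrightarrow> real (Suc j) \<le> b"
  shows "ls_terminates_within I \<theta> S b"
  unfolding ls_terminates_within_def
proof (intro allI impI)
  fix j S' assume s: "(ls_step I \<theta> ^^ j) S S'"
  show "real (Suc j) \<le> b \<and> (ls_stop I \<theta> S' \<or> (\<exists>S''. ls_step I \<theta> S' S''))"
    using assms(2)[OF s] ls_step_exists[OF ls_steps_full[OF s assms(1)]] by blast
qed

text \<open>Scores are nonnegative, so the strict stopping test alone forces \<open>0 < t\<close>.
  PJR at the average follows since raising \<open>t\<close> leaves fewer groups entitled to
  seats.\<close>

lemma PJR_if_stop:
  assumes full: "full_solution I B u" and less: "max_score I B u < t" and t: "t \<le> average"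
  shows "Max ((\<lambda>c. prescore I B u c t) ` (cands I - B)) < t" "t_PJR I t B" "PJR I B"
proof -
  note F = full_solutionD[OF full]
  have t0: "0 < t" using max_score_nonneg[OF full] less by linarith
  have ps: "prescore I B u c t < t" if "c \<in> cands I - B" for c
    using that less max_score_less_iff[OF full] score_less_iff[OF F(1), of t B c] t0 by auto
  then show "Max ((\<lambda>c. prescore I B u c t) ` (cands I - B)) < t"
    using F(6) finite_cands by (subst Max_less_iff) auto
  show "t_PJR I t B" by (rule t_PJR_if_prescore_less[OF full t0 ps])
  then show "PJR I B" using t_PJR_mono t F(3) by (auto simp: PJR_def)
qed

lemma ls_returns_props:
  assumes A: "card A = seats I" and \<epsilon>: "0 < \<epsilon>" and full: "full_solution I A w"
    and ret: "ls_returns I (ls_threshold I \<epsilon> A) (A, w) i (A', w')"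
  shows "full_solution I A' w'" "supp_set I w A \<le> supp_set I w' A'"
    "max_score I A' w' < min ((1 + \<epsilon>) * supp_set I w' A') average"
proof -
  obtain j where j: "(ls_step I (ls_threshold I \<epsilon> A) ^^ j) (A, w) (A', w')"
    and st: "ls_stop I (ls_threshold I \<epsilon> A) (A', w')" using ret by (auto simp: ls_returns_def)
  show "full_solution I A' w'" using ls_steps_full[OF j] full by simp
  show "supp_set I w A \<le> supp_set I w' A'"
    using ls_steps_low[OF j _ order_refl ls_threshold_ge(1)[OF A \<epsilon>] order_trans[OF _
        ls_threshold_ge(1)[OF A \<epsilon>]]] full
    by simp
  show "max_score I A' w' < min ((1 + \<epsilon>) * supp_set I w' A') average"
    using st by (simp add: ls_stop_iff ls_threshold_eq(1)[OF A])
qed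

text \<open>Positivity of \<open>OPT I\<close> is derived from the return: with least support 0 the
  threshold would be at most 0, and no score is below that.\<close>

lemma ls_returns_bound:
  assumes A: "card A = seats I" and \<epsilon>: "0 < \<epsilon>" and \<alpha>: "1 \<le> \<alpha>"
    and apx: "approximation I \<alpha> A w"
    and ret: "ls_returns I (ls_threshold I \<epsilon> A) (A, w) i S'"
  shows "real i \<le> real (seats I) * (1 + log (1 + \<epsilon>) \<alpha>) + 1"
proof -
  obtain j where j: "(ls_step I (ls_threshold I \<epsilon> A) ^^ j) (A, w) S'" "i = Suc j"
    and st: "ls_stop I (ls_threshold I \<epsilon> A) S'" using ret by (auto simp: ls_returns_def)
  have full: "full (A, w)" using apx by (simp add: approximation_def)
  have fS': "full S'" by (rule ls_steps_full[OF j(1) full])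
  have "0 < minsupp S'"
  proof (rule ccontr)
    assume "\<not> 0 < minsupp S'"
    then have "minsupp S' = 0" using minsupp_nonneg[OF fS'] by linarith
    then have "ls_threshold I \<epsilon> A S' \<le> 0" by (simp add: ls_threshold_eq(1)[OF A])
    then show False
      using st max_score_nonneg[of "fst S'" "snd S'"] fS' by (simp add: ls_stop_iff full_def)
  qed
  then have "0 < OPT I" using minsupp_le_OPT[OF fS'] by linarith
  moreover have "OPT I / \<alpha> \<le> minsupp (A, w)" using apx by (simp add: approximation_def)
  ultimately have "real j \<le> real (seats I) * (1 + log (1 + \<epsilon>) \<alpha>)"
    by (intro ls_steps_bound[OF A \<epsilon> full \<alpha> _ _ j(1)])
  then show ?thesis using j(2) by simp
qed

lemma ls_returns_inf_props:
  assumes A: "card A = seats I" and full: "full_solution I A w"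
    and ret: "ls_returns I (ls_threshold_inf I A) (A, w) i (A', w')"
  shows "full_solution I A' w'" "PJR I A'" "i \<le> seats I + 1"
proof -
  obtain j where j: "(ls_step I (ls_threshold_inf I A) ^^ j) (A, w) (A', w')" "i = Suc j"
    and st: "ls_stop I (ls_threshold_inf I A) (A', w')" using ret by (auto simp: ls_returns_def)
  show f: "full_solution I A' w'" using ls_steps_full[OF j(1)] full by simp
  have less: "max_score I A' w' < average"
    using st by (simp add: ls_stop_iff ls_threshold_eq(2)[OF A])
  show "PJR I A'" by (rule PJR_if_stop(3)[OF f less order_refl])
  have "0 < average" using less max_score_nonneg[OF f] by linarith
  then have "0 < tot_str" using seats_pos by (simp add: zero_less_divide_iff)
  then show "i \<le> seats I + 1" using ls_steps_inf_bound[OF A _ _ j(1)] full j(2) by simp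
qed

end

section \<open>A cost calculus for the real RAM\<close>

fun iwrites :: "com \<Rightarrow> string set" where
  "iwrites Skip = {}"
| "iwrites (SetI a i e) = {a}"
| "iwrites (SetR a i e) = {}"
| "iwrites (Seq p q) = iwrites p \<union> iwrites q"
| "iwrites (Cond b p q) = iwrites p \<union> iwrites q"
| "iwrites (While b p) = iwrites p"

fun rwrites :: "com \<Rightarrow> string set" where
  "rwrites Skip = {}"
| "rwrites (SetI a i e) = {}"
| "rwrites (SetR a i e) = {a}"
| "rwrites (Seq p q) = rwrites p \<union> rwrites q"
| "rwrites (Cond b p q) = rwrites p \<union> rwrites q"
| "rwrites (While b p) = rwrites p"

definition frame :: "com \<Rightarrow> store \<Rightarrow> store \<Rightarrow> bool" where
  "frame p st st' \<longleftrightarrow> (\<forall>a. a \<notin> iwrites p \<longrightarrow> ints st' a = ints st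
      a) \<and> (\<forall>a. a \<notin> rwrites p \<longrightarrow> reals st' a = reals st a)"

lemma frameD:
  "frame p st st' \<Longrightarrow> a \<notin> iwrites p \<Longrightarrow> ints st' a = ints st a"
  "frame p st st' \<Longrightarrow> a \<notin> rwrites p \<Longrightarrow> reals st' a = reals st a"
  by (auto simp: frame_def)

lemma exec_frame: "exec p st m st' \<Longrightarrow> frame p st st'"
  by (induction rule: exec.induct) (auto simp: frame_def)

fun loopfree :: "com \<Rightarrow> bool" where
  "loopfree (Seq p q) \<longleftrightarrow> loopfree p \<and> loopfree q"
| "loopfree (Cond b p q) \<longleftrightarrow> loopfree p \<and> loopfree q"
| "loopfree (While b p) \<longleftrightarrow> False"
| "loopfree _ \<longleftrightarrow> True"

text \<open>Meaningful for \<open>loopfree\<close> programs; the \<open>While\<close> clause is a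
  dummy value that keeps the function total.\<close>

fun sem :: "com \<Rightarrow> store \<Rightarrow> store" where
  "sem Skip st = st"
| "sem (SetI a i e) st = st\<lparr>ints := (ints st)(a := (ints st a)(ival i st := ival e st))\<rparr>"
| "sem (SetR a i e) st = st\<lparr>reals := (reals st)(a := (reals st a)(ival i st := rval e st))\<rparr>"
| "sem (Seq p q) st = sem q (sem p st)"
| "sem (Cond b p q) st = (if bval b st then sem p st else sem q st)"
| "sem (While b p) st = st"

text \<open>Every loop is charged for a single round; the factor \<open>M\<close> of \<open>runs\<close> accounts
    for the others.\<close>

fun unit_cost :: "com \<Rightarrow> nat" where
  "unit_cost Skip = 1"
| "unit_cost (SetI a i e) = 1 + icost i + icost e"
| "unit_cost (SetR a i e) = 1 + icost i + rcost e"
| "unit_cost (Seq p q) = 1 + unit_cost p + unit_cost q"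
| "unit_cost (Cond b p q) = 1 + bcost b + unit_cost p + unit_cost q"
| "unit_cost (While b p) = 1 + bcost b + unit_cost p"

lemma exec_loopfree: "loopfree p \<Longrightarrow> \<exists>m\<le>unit_cost p. exec p st m (sem p st)"
proof (induction p arbitrary: st)
  case (Seq p q)
  then obtain m l where "m \<le> unit_cost p" "exec p st m (sem p st)"
    "l \<le> unit_cost q" "exec q (sem p st) l (sem q (sem p st))" by fastforce
  then show ?case using exec.Seq by (intro exI[of _ "1 + m + l"]) auto
next
  case (Cond b p q)
  show ?case
  proof (cases "bval b st")
    case True
    obtain m where "m \<le> unit_cost p" "exec p st m (sem p st)" using Cond by auto
    then show ?thesis using True exec.CondT[OF True, of p m] by (intro exI[of _ "1 + bcost b + m"]) auto
  next
    case False
    obtain m where "m \<le> unit_cost q" "exec q st m (sem q st)" using Cond by auto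
    then show ?thesis using False exec.CondF[OF False, of q m] by (intro exI[of _ "1 + bcost b + m"]) auto
  qed
next
  case (SetI a i e) then show ?case using exec.SetI by force
next
  case (SetR a i e) then show ?case using exec.SetR by force
next
  case Skip then show ?case using exec.Skip by force
qed simp

text \<open>Total correctness with a cost split into a constant of the program text and a
  data-dependent factor \<open>M\<close>. The constant of the final time bound is a multiple of the
  \<open>unit_cost\<close> of the whole program.\<close>

definition runs :: "com \<Rightarrow> store \<Rightarrow> nat \<Rightarrow> (store \<Rightarrow> bool) \<Rightarrow> bool" where
  "runs p st M Q \<longleftrightarrow> (\<exists>m st'. exec p st m st' \<and> m \<le> unit_cost p * M \<and> Q st')"

lemma runs_conseq: "runs p st M Q \<Longrightarrow> M \<le> M' \<Longrightarrow> (\<And>st'. frame p st st'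
    \<Longrightarrow> Q st' \<Longrightarrow> Q' st') \<Longrightarrow> runs p st M' Q'"
  unfolding runs_def using exec_frame by (meson mult_le_mono2 order_trans)

lemma runs_loopfree:
  assumes "loopfree p" "Q (sem p st)" "1 \<le> M"
  shows "runs p st M Q"
proof -
  obtain m where "m \<le> unit_cost p" "exec p st m (sem p st)" using exec_loopfree[OF assms(1)] by blast
  moreover have "unit_cost p \<le> unit_cost p * M" using assms(3) by simp
  ultimately show ?thesis unfolding runs_def using assms(2) by (meson order_trans)
qed

text \<open>Because \<open>unit_cost\<close> is additive, both parts may use the same
  \<open>M\<close>, and sequencing does not enlarge it.\<close>

lemma runs_Seq:
  assumes "runs p st M R" "1 \<le> M" "\<And>st'. frame p st st' \<Longrightarrow> R st' \<Longrightarrow> runs q st' M Q"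
  shows "runs (Seq p q) st M Q"
proof -
  obtain m st' where 1: "exec p st m st'" "m \<le> unit_cost p * M" "R st'" using assms by (auto simp: runs_def)
  then obtain l st'' where 2: "exec q st' l st''" "l \<le> unit_cost q * M" "Q st''"
    using assms(3)[OF exec_frame[OF 1(1)] 1(3)] by (auto simp: runs_def)
  have "1 + m + l \<le> unit_cost (Seq p q) * M" using 1 2 assms(2) by (auto simp: distrib_right)
  then show ?thesis unfolding runs_def using exec.Seq[OF 1(1) 2(1)] 2(3) by blast
qed

lemma runs_Cond:
  assumes "1 \<le> M" "bval b st \<Longrightarrow> runs p st M Q" "\<not> bval b st \<Longrightarrow> runs q st M Q"
  shows "runs (Cond b p q) st M Q"
proof -
  have le: "1 + bcost b \<le> (1 + bcost b) * M" using mult_le_mono2[of 1 M "1 + bcost b"] assms(1) by simp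
  show ?thesis
  proof (cases "bval b st")
    case True
    then obtain m st' where 1: "exec p st m st'" "m \<le> unit_cost p * M" "Q st'" using assms by (auto simp: runs_def)
    have "1 + bcost b + m \<le> unit_cost (Cond b p q) * M"
      using 1 le unfolding unit_cost.simps distrib_right by linarith
    then show ?thesis unfolding runs_def using exec.CondT[OF True 1(1)] 1(3) by blast
  next
    case False
    then obtain m st' where 1: "exec q st m st'" "m \<le> unit_cost q * M" "Q st'" using assms by (auto simp: runs_def)
    have "1 + bcost b + m \<le> unit_cost (Cond b p q) * M"
      using 1 le unfolding unit_cost.simps distrib_right by linarith
    then show ?thesis unfolding runs_def using exec.CondF[OF False 1(1)] 1(3) by blast
  qed
qed

text \<open>The index of the invariant bounds the number of remaining rounds.\<close>

lemma runs_While: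
  assumes "Inv r st" "1 \<le> M"
    and "\<And>r st. Inv r st \<Longrightarrow> bval b st \<Longrightarrow> \<exists>r'. r = Suc r' \<and> runs p st M (Inv r')"
  shows "runs (While b p) st (M * Suc r) (\<lambda>st'. \<not> bval b st' \<and> (\<exists>r'. Inv r' st'))"
  using assms(1)
proof (induction r arbitrary: st)
  case 0
  then have "\<not> bval b st" using assms(3) by blast
  moreover have "1 + bcost b \<le> (1 + bcost b + unit_cost p) * (M * Suc 0)"
    using mult_le_mono[of "1 + bcost b" "1 + bcost b + unit_cost p" 1 M] assms(2) by simp
  ultimately show ?case unfolding runs_def unit_cost.simps using exec.WhileF 0 by blast
next
  case (Suc r)
  show ?case
  proof (cases "bval b st")
    case True
    then obtain m st' where 1: "exec p st m st'" "m \<le> unit_cost p * M" "Inv r st'"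
      using assms(3)[OF Suc.prems] by (auto simp: runs_def)
    then obtain l st'' where 2: "exec (While b p) st' l st''"
      "l \<le> (1 + bcost b + unit_cost p) * (M * Suc r)" "\<not> bval b st''" "\<exists>r'. Inv r' st''"
      using Suc.IH[OF 1(3)] by (auto simp: runs_def)
    have "1 + bcost b \<le> (1 + bcost b) * M" using mult_le_mono2[of 1 M "1 + bcost b"] assms(2) by simp
    then have "1 + bcost b + m + l \<le> (1 + bcost b + unit_cost p) * M + (1 + bcost b + unit_cost p) * (M * Suc r)"
      using 1(2) 2(2) unfolding distrib_right by linarith
    also have "\<dots> = unit_cost (While b p) * (M * Suc (Suc r))" by (simp add: algebra_simps)
    finally show ?thesis unfolding runs_def using exec.WhileT[OF True 1(1) 2(1)] 2(3,4) by blast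
  next
    case False
    have "1 + bcost b \<le> (1 + bcost b + unit_cost p) * (M * Suc (Suc r))"
      using mult_le_mono[of "1 + bcost b" "1 + bcost b + unit_cost p" 1 "M * Suc (Suc r)"] assms(2) by simp
    then show ?thesis unfolding runs_def unit_cost.simps using exec.WhileF[OF False] False Suc.prems by blast
  qed
qed

abbreviation "ivar a \<equiv> IRead a (IConst 0)"
abbreviation "rvar a \<equiv> RRead a (IConst 0)"
abbreviation "setI a e \<equiv> SetI a (IConst 0) e"
abbreviation "setR a e \<equiv> SetR a (IConst 0) e"
abbreviation "idx \<equiv> ivar ''i''"
abbreviation "incr \<equiv> setI ''i'' (IAdd idx (IConst 1))"

text \<open>All loops share the counter \<open>i\<close>, so \<open>runs_For\<close> asks for bodies
  without loops and without assignments to \<open>i\<close>.\<close>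

definition For :: "string \<Rightarrow> com \<Rightarrow> com" where
  "For N p = Seq (setI ''i'' (IConst 0)) (While (ILess idx (ivar N)) (Seq p incr))"

lemma iwrites_For [simp]: "iwrites (For N p) = insert ''i'' (iwrites p)"
  and rwrites_For [simp]: "rwrites (For N p) = rwrites p"
  by (auto simp: For_def)

text \<open>A loop-free body costs at most its \<open>unit_cost\<close>, so the factor only has to
  cover the \<open>n\<close> rounds and the final test. The \<open>frame\<close> passed to
  \<open>step\<close> recovers, in each round, whatever the loop does not assign.\<close>

lemma runs_For:
  assumes p: "loopfree p" "''i'' \<notin> iwrites p" "N \<notin> iwrites p" "N \<noteq> ''i''"
    and n: "ints st N 0 = n" "Suc n \<le> M"
    and init: "Inv 0 (sem (setI ''i'' (IConst 0)) st)"
    and step: "\<And>j sj. j < n \<Longrightarrow> Inv j sj \<Longrightarrow> ints sj ''i'' 0 = j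
        \<Longrightarrow> frame (For N p) st sj \<Longrightarrow>
                 Inv (Suc j) (sem (Seq p incr) sj)"
  shows "runs (For N p) st M (Inv n)"
  unfolding For_def
proof (rule runs_conseq[OF _ n(2)])
  let ?Inv = "\<lambda>r sj. \<exists>j. j + r = n \<and> Inv j sj \<and> ints sj ''i'' 0 = j \<and> frame (For N p) st sj"
  show "runs (Seq (setI ''i'' (IConst 0)) (While (ILess idx (ivar N)) (Seq p incr))) st (Suc n) (Inv n)"
  proof (rule runs_Seq)
    show "runs (setI ''i'' (IConst 0)) st (Suc n) (?Inv n)"
      by (rule runs_loopfree) (use init in \<open>auto simp: frame_def\<close>)
    fix st' assume "?Inv n st'"
    have "runs (While (ILess idx (ivar N)) (Seq p incr)) st' (1 * Suc n)
        (\<lambda>sj. \<not> bval (ILess idx (ivar N)) sj \<and> (\<exists>r. ?Inv r sj))"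
    proof (rule runs_While)
      show "?Inv n st'" by fact
      fix r sj assume I: "?Inv r sj" and b: "bval (ILess idx (ivar N)) sj"
      then obtain j where j: "j + r = n" "Inv j sj" "ints sj ''i'' 0 = j" "frame (For N p) st sj" by blast
      have N: "ints sj N 0 = n" using frameD(1)[OF j(4), of N] p n by simp
      then have jn: "j < n" using b j by simp
      have nxt: "exec (Seq p incr) sj m sj' \<Longrightarrow> ints sj' ''i'' 0 = Suc j \<and> frame (For N p) st
          sj'" if "sj' = sem (Seq p incr) sj" for m sj'
      proof -
        obtain l where "exec p sj l (sem p sj)" using exec_loopfree[OF p(1)] by blast
        then have fr: "frame p sj (sem p sj)" by (rule exec_frame)
        then have "ints (sem p sj) ''i'' = ints sj ''i''" using frameD(1) p by blast
        then show ?thesis using that j fr by (auto simp: frame_def)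
      qed
      have "runs (Seq p incr) sj 1 (?Inv (r - 1))"
      proof -
        obtain m where m: "m \<le> unit_cost (Seq p incr)" "exec (Seq p incr) sj m (sem (Seq p incr) sj)"
          using exec_loopfree[of "Seq p incr" sj] p by auto
        have "Suc j + (r - 1) = n" using j jn by simp
        then have "?Inv (r - 1) (sem (Seq p incr) sj)"
          using step[OF jn j(2,3,4)] nxt[OF refl m(2)] by blast
        then show ?thesis unfolding runs_def using m by (metis mult_1_right)
      qed
      moreover have "r = Suc (r - 1)" using j jn by simp
      ultimately show "\<exists>r'. r = Suc r' \<and> runs (Seq p incr) sj 1 (?Inv r')" by blast
    qed simp
    then show "runs (While (ILess idx (ivar N)) (Seq p incr)) st' (Suc n) (Inv n)"
    proof (rule runs_conseq)
      fix sj assume "\<not> bval (ILess idx (ivar N)) sj \<and> (\<exists>r. ?Inv r sj)"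
      then obtain r j where j: "\<not> bval (ILess idx (ivar N)) sj" "j + r = n" "Inv j sj"
        "ints sj ''i'' 0 = j" "frame (For N p) st sj" by blast
      have "ints sj N 0 = n" using frameD(1)[OF j(5), of N] p n by simp
      then have "j = n" using j by simp
      then show "Inv n sj" using j by simp
    qed simp
  qed simp
qed

section \<open>Supports and scores on the real RAM\<close>

abbreviation "rzero \<equiv> RNat (IConst 0)"
abbreviation "rone \<equiv> RNat (IConst 1)"
abbreviation "is_member j \<equiv> ILess (IConst 0) (IRead ''member'' j)"
abbreviation "IEq e f \<equiv> BAnd (BNot (ILess e f)) (BNot (ILess f e))"
text \<open>Subtraction of naturals is truncated, so \<open>x - (x - y)\<close> is the
  minimum.\<close>

abbreviation "IMin e f \<equiv> ISub e (ISub e f)"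

abbreviation "cand_i \<equiv> IRead ''cand'' idx"
abbreviation "voter_i \<equiv> IRead ''voter'' idx"

abbreviation "add_weight \<equiv>
  SetR ''supp'' cand_i (RAdd (RRead ''supp'' cand_i) (RRead ''weight'' idx))"

definition supports_code :: com where
  "supports_code = Seq (For ''ncands'' (SetR ''supp'' idx rzero))
     (For ''nedges'' add_weight)"

text \<open>The out-of-range value \<open>ncands\<close> in \<open>cmin\<close> means that no member
  has been seen yet. It replaces an infinite initial value of \<open>tmin\<close>, which the machine
  cannot represent; \<open>cmax\<close> is treated alike.\<close>

abbreviation "update_cmin \<equiv>
  Cond (BAnd (is_member idx) (BNot (BAnd (ILess (ivar ''cmin'') (ivar ''ncands'')) 
      (BNot (RLess (RRead ''supp'' idx) (rvar ''tmin'')))))) (Seq (setI ''cmin'' idx) (setR ''tmin'' (RRead ''supp'' idx))) Skip"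

definition cmin_code :: com where
  "cmin_code = Seq (setI ''cmin'' (ivar ''ncands''))
     (For ''ncands'' update_cmin)"

abbreviation "append_support \<equiv>
  Cond (is_member idx) (Seq (SetR ''a'' (ivar ''cnt'') (RRead ''supp'' idx)) (setI ''cnt'' (IAdd (ivar ''cnt'')
      (IConst 1)))) Skip"

definition collect_code :: com where
  "collect_code = Seq (setI ''cnt'' (IConst 0))
     (For ''ncands'' append_support)"

definition average_code :: com where
  "average_code = Seq (setR ''avg'' rzero)
     (Seq (For ''nvoters'' (setR ''avg'' (RAdd (rvar ''avg'') (RRead ''strength'' idx))))
        (setR ''avg'' (RDiv (rvar ''avg'') (RNat (ivar ''seats'')))))"

abbreviation "use_weight \<equiv>
  Cond (is_member cand_i) (Cond (RLess (rvar ''th'') (RRead ''supp'' cand_i)) (SetR ''sq'' voter_i (RAdd (RRead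
      ''sq'' voter_i) (RDiv (RRead ''weight'' idx) (RRead ''supp'' cand_i)))) (SetR ''sp'' voter_i (RSub (RRead
          ''sp'' voter_i) (RRead ''weight'' idx)))) Skip"

abbreviation "init_voter \<equiv>
  Seq (SetR ''sp'' idx (RRead ''strength'' idx)) (SetR ''sq'' idx rzero)"

definition voter_code :: com where
  "voter_code = Seq (For ''nvoters'' init_voter)
     (For ''nedges'' use_weight)"

abbreviation "add_voter \<equiv>
  Seq (SetR ''cp'' cand_i (RAdd (RRead ''cp'' cand_i) (RRead ''sp'' voter_i))) (SetR ''cq'' cand_i (RAdd (RRead
      ''cq'' cand_i) (RRead ''sq'' voter_i)))"

definition cand_code :: com where
  "cand_code = Seq (For ''ncands'' (Seq (SetR ''cp'' idx rzero) (SetR ''cq'' idx rzero)))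
     (For ''nedges'' add_voter)"

abbreviation "tau_i \<equiv> RDiv (RRead ''cp'' idx) (RAdd rone (RRead ''cq'' idx))"

abbreviation "update_cmax \<equiv>
  Cond (BAnd (BNot (is_member idx)) (BNot (BAnd (ILess (ivar ''cmax'') (ivar ''ncands'')) (BNot (RLess (rvar
      ''best'') tau_i))))) (Seq (setI ''cmax'' idx) (setR ''best'' tau_i)) Skip"

definition cmax_code :: com where
  "cmax_code = Seq (setI ''cmax'' (ivar ''ncands''))
     (For ''ncands'' update_cmax)"

definition probe_code :: com where
  "probe_code = Seq voter_code (Seq cand_code cmax_code)"

text \<open>Contents of the input arrays, detached from elections, so that the programs can be
  verified on index sums. \<open>sizes\<close> bounds every single loop by the number of
  edges.\<close>

locale instance_data =
  fixes nv nc ne k :: nat and vt cd mem :: "nat \<Rightarrow> nat" and str wt :: "nat \<Rightarrow> real" and eps :: real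
  assumes vt_less: "e < ne \<Longrightarrow> vt e < nv" and cd_less: "e < ne \<Longrightarrow> cd e < nc"
    and sizes: "nv \<le> ne" "nc \<le> ne" "k \<le> ne"
begin

definition inp :: "store \<Rightarrow> bool" where
  "inp st \<longleftrightarrow> ints st ''nvoters'' 0 = nv \<and> ints st ''ncands'' 0 = nc \<and> ints st
      ''nedges'' 0 = ne \<and>
     ints st ''seats'' 0 = k \<and> ints st ''voter'' = vt \<and> ints st ''cand'' = cd \<and> ints st ''member'' = mem \<and>
     reals st ''strength'' = str \<and> reals st ''weight'' = wt \<and> reals st ''eps'' 0 = eps"

lemma inpD:
  assumes "inp st"
  shows "ints st ''nvoters'' 0 = nv" "ints st ''ncands'' 0 = nc" "ints st ''nedges'' 0 = ne"
     "ints st ''seats'' 0 = k" "ints st ''voter'' = vt" "ints st ''cand'' = cd" "ints st ''member'' = mem"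
     "reals st ''strength'' = str" "reals st ''weight'' = wt" "reals st ''eps'' 0 = eps"
  using assms by (auto simp: inp_def)

definition inp_free :: "com \<Rightarrow> bool" where [simp]:
  "inp_free p \<longleftrightarrow> ''nvoters'' \<notin> iwrites p \<and> ''ncands'' \<notin> iwrites p \<and>
      ''nedges'' \<notin> iwrites p \<and> ''seats'' \<notin> iwrites p \<and>
     ''voter'' \<notin> iwrites p \<and> ''cand'' \<notin> iwrites p \<and> ''member'' \<notin> iwrites p \<and>
     ''strength'' \<notin> rwrites p \<and> ''weight'' \<notin> rwrites p \<and> ''eps'' \<notin> rwrites p"

lemma inp_frame: "inp st \<Longrightarrow> frame p st st' \<Longrightarrow> inp_free p \<Longrightarrow> inp st'"
  unfolding inp_def inp_free_def by (elim conjE) (simp only: frameD simp_thms)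

abbreviation "M \<equiv> Suc ne"

definition csup :: "nat \<Rightarrow> real" where
  "csup c = (\<Sum>e<ne. if cd e = c then wt e else 0)"

lemma supports_code:
  assumes "inp st"
  shows "runs supports_code st M (\<lambda>st'. \<forall>c<nc. reals st' ''supp'' c = csup c)"
  unfolding supports_code_def
proof (rule runs_Seq)
  show "runs (For ''ncands'' (SetR ''supp'' idx rzero)) st M (\<lambda>st'. \<forall>c<nc. reals st' ''supp'' c = 0)"
    by (rule runs_For) (use inpD[OF assms] sizes in \<open>auto simp: less_Suc_eq\<close>)
  fix st1 assume f: "frame (For ''ncands'' (SetR ''supp'' idx rzero)) st st1" and z: "\<forall>c<nc. reals st1 ''supp'' c = 0"
  have i1: "inp st1" by (rule inp_frame[OF assms f]) simp
  note D = inpD[OF i1]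
  show "runs (For ''nedges'' add_weight) st1 M
     (\<lambda>st'. \<forall>c<nc. reals st' ''supp'' c = csup c)"
    unfolding csup_def
  proof (rule runs_For)
    fix j sj
    assume j: "j < ne" and inv: "\<forall>c<nc. reals sj ''supp'' c = (\<Sum>e<j. if cd e = c then wt e else 0)"
      and i: "ints sj ''i'' 0 = j" and fr: "frame (For ''nedges'' add_weight) st1 sj"
    note T = inpD[OF inp_frame[OF i1 fr]]
    show "\<forall>c<nc. reals (sem (Seq add_weight incr) sj) ''supp'' c = (\<Sum>e<Suc j. if cd e = c then wt e else 0)"
      using inv cd_less[OF j] by (simp add: T i)
  qed (use D z in simp_all)
qed simp

definition has_supp :: "store \<Rightarrow> bool" where
  "has_supp st \<longleftrightarrow> (\<forall>c<nc. reals st ''supp'' c = csup c)"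

lemma has_supp_frame: "has_supp st \<Longrightarrow> frame p st st' \<Longrightarrow> ''supp'' \<notin> rwrites p
    \<Longrightarrow> has_supp st'"
  by (simp add: has_supp_def frameD)

lemma cmin_code:
  assumes "inp st" "has_supp st" "\<exists>c<nc. 0 < mem c"
  shows "runs cmin_code st M (\<lambda>st'. ints st' ''cmin'' 0 < nc \<and> 0 < mem (ints st' ''cmin'' 0) \<and>
     reals st' ''tmin'' 0 = csup (ints st' ''cmin'' 0) \<and>
     (\<forall>c<nc. 0 < mem c \<longrightarrow> csup (ints st' ''cmin'' 0) \<le> csup c))"
  unfolding cmin_code_def
proof (rule runs_Seq)
  show "runs (setI ''cmin'' (ivar ''ncands'')) st M (\<lambda>st'. ints st' ''cmin'' 0 = nc)"
    by (rule runs_loopfree) (use inpD[OF assms(1)] in auto)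
  fix st1 assume f: "frame (setI ''cmin'' (ivar ''ncands'')) st st1" and c0: "ints st1 ''cmin'' 0 = nc"
  have i1: "inp st1" by (rule inp_frame[OF assms(1) f]) simp
  have s1: "has_supp st1" by (rule has_supp_frame[OF assms(2) f]) simp
  note D = inpD[OF i1]
  let ?Inv = "\<lambda>j sj. if ints sj ''cmin'' 0 < nc then 0 < mem (ints sj ''cmin'' 0) \<and>
     reals sj ''tmin'' 0 = csup (ints sj ''cmin'' 0) \<and> (\<forall>c<j. 0 < mem c \<longrightarrow> csup (ints
         sj ''cmin'' 0) \<le> csup c)
     else (\<forall>c<j. mem c = 0)"
  have "runs (For ''ncands'' update_cmin) st1 M (?Inv nc)"
  proof (rule runs_For[where Inv = ?Inv])
    fix j sj
    assume j: "j < nc" and inv: "?Inv j sj"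
      and i: "ints sj ''i'' 0 = j" and fr: "frame (For ''ncands'' update_cmin) st1 sj"
    note T = inpD[OF inp_frame[OF i1 fr]]
    have "has_supp sj" by (rule has_supp_frame[OF s1 fr]) simp
    then have s: "reals sj ''supp'' j = csup j" using j by (simp add: has_supp_def)
    show "?Inv (Suc j) (sem (Seq update_cmin incr) sj)"
      using inv j by (auto simp: T i s less_Suc_eq split: if_splits)
  qed (use D sizes c0 in simp_all)
  then show "runs (For ''ncands'' update_cmin) st1 M (\<lambda>st'. ints st' ''cmin'' 0 < nc \<and> 0 < mem (ints
      st' ''cmin'' 0) \<and>
     reals st' ''tmin'' 0 = csup (ints st' ''cmin'' 0) \<and>
     (\<forall>c<nc. 0 < mem c \<longrightarrow> csup (ints st' ''cmin'' 0) \<le> csup c))"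
    by (rule runs_conseq) (use assms(3) in \<open>auto split: if_splits\<close>)
qed simp

lemma lessThan_Suc_diff: "{..<Suc n} \<inter> {x. x \<noteq> n} = {..<n}"
  by auto

lemma collect_code:
  assumes "inp st" "has_supp st" "card {c. c < nc \<and> 0 < mem c} = k"
  shows "runs collect_code st M (\<lambda>st'. reals st' ''a'' ` {..<k} = csup ` {c. c < nc \<and> 0 < mem c})"
  unfolding collect_code_def
proof (rule runs_Seq)
  show "runs (setI ''cnt'' (IConst 0)) st M (\<lambda>st'. ints st' ''cnt'' 0 = 0)"
    by (rule runs_loopfree) auto
  fix st1 assume f: "frame (setI ''cnt'' (IConst 0)) st st1" and c0: "ints st1 ''cnt'' 0 = 0"
  have i1: "inp st1" by (rule inp_frame[OF assms(1) f]) simp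
  have s1: "has_supp st1" by (rule has_supp_frame[OF assms(2) f]) simp
  note D = inpD[OF i1]
  let ?C = "\<lambda>j. {c. c < j \<and> 0 < mem c}"
  let ?Inv = "\<lambda>j sj. ints sj ''cnt'' 0 = card (?C j) \<and> reals sj ''a'' ` {..<card (?C j)} = csup ` ?C j"
  have "runs (For ''ncands'' append_support) st1 M (?Inv nc)"
  proof (rule runs_For[where Inv = ?Inv])
    fix j sj
    assume j: "j < nc" and inv: "?Inv j sj"
      and i: "ints sj ''i'' 0 = j" and fr: "frame (For ''ncands'' append_support) st1 sj"
    note T = inpD[OF inp_frame[OF i1 fr]]
    have "has_supp sj" by (rule has_supp_frame[OF s1 fr]) simp
    then have s: "reals sj ''supp'' j = csup j" using j by (simp add: has_supp_def)
    show "?Inv (Suc j) (sem (Seq append_support incr) sj)"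
    proof (cases "0 < mem j")
      case True
      then have C: "?C (Suc j) = insert j (?C j)" by (auto simp: less_Suc_eq)
      have card: "card (insert j (?C j)) = Suc (card (?C j))" by (subst card_insert_disjoint) auto
      show ?thesis
        unfolding C card using inv True by (simp add: T i s lessThan_Suc_diff)
    next
      case False
      then have C: "?C (Suc j) = ?C j" by (auto simp: less_Suc_eq)
      show ?thesis unfolding C using inv False by (simp add: T i)
    qed
  qed (use D sizes c0 in simp_all)
  then show "runs (For ''ncands'' append_support) st1 M (\<lambda>st'. reals st' ''a'' ` {..<k} = csup ` ?C nc)"
    by (rule runs_conseq) (use assms(3) in auto)
qed simp

lemma average_code:
  assumes "inp st"
  shows "runs average_code st M (\<lambda>st'. reals st' ''avg'' 0 = (\<Sum>v<nv. str v) / real k)"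
  unfolding average_code_def
proof (rule runs_Seq)
  show "runs (setR ''avg'' rzero) st M (\<lambda>st'. reals st' ''avg'' 0 = 0)"
    by (rule runs_loopfree) auto
  fix st1 assume f: "frame (setR ''avg'' rzero) st st1" and c0: "reals st1 ''avg'' 0 = 0"
  have i1: "inp st1" by (rule inp_frame[OF assms(1) f]) simp
  note D = inpD[OF i1]
  let ?p = "setR ''avg'' (RAdd (rvar ''avg'') (RRead ''strength'' idx))"
  show "runs (Seq (For ''nvoters'' ?p) (setR ''avg'' (RDiv (rvar ''avg'') (RNat (ivar ''seats''))))) st1 M
     (\<lambda>st'. reals st' ''avg'' 0 = (\<Sum>v<nv. str v) / real k)"
  proof (rule runs_Seq)
    show "runs (For ''nvoters'' ?p) st1 M (\<lambda>sj. reals sj ''avg'' 0 = (\<Sum>v<nv. str v))"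
    proof (rule runs_For)
      fix j sj assume j: "j < nv" and inv: "reals sj ''avg'' 0 = (\<Sum>v<j. str v)"
        and i: "ints sj ''i'' 0 = j" and fr: "frame (For ''nvoters'' ?p) st1 sj"
      note T = inpD[OF inp_frame[OF i1 fr]]
      show "reals (sem (Seq ?p incr) sj) ''avg'' 0 = (\<Sum>v<Suc j. str v)" by (simp add: inv T i)
    qed (use D sizes c0 in simp_all)
    fix st2 assume f: "frame (For ''nvoters'' ?p) st1 st2" and a: "reals st2 ''avg'' 0 = (\<Sum>v<nv. str v)"
    have "inp st2" by (rule inp_frame[OF i1 f]) simp
    note T = inpD[OF this]
    show "runs (setR ''avg'' (RDiv (rvar ''avg'') (RNat (ivar ''seats'')))) st2 M
       (\<lambda>st'. reals st' ''avg'' 0 = (\<Sum>v<nv. str v) / real k)"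
      by (rule runs_loopfree) (simp_all add: a T)
  qed simp
qed simp

text \<open>For \<open>x\<close> between \<open>t\<close> and the next larger support, the slack of voter \<open>v\<close> is
  \<open>P1 t v - x * Q1 t v\<close> and the prescore of candidate \<open>c\<close> is \<open>P2 t c - x * Q2 t
      c\<close>, so \<open>tau t c\<close> is
  the score of \<open>c\<close> if it lies in that range.\<close>

definition P1 :: "real \<Rightarrow> nat \<Rightarrow> real" where
  "P1 t v = str v - (\<Sum>e<ne. if vt e = v \<and> 0 < mem (cd e) \<and> \<not> t < csup (cd e) then wt e else 0)"

definition Q1 :: "real \<Rightarrow> nat \<Rightarrow> real" where
  "Q1 t v = (\<Sum>e<ne. if vt e = v \<and> 0 < mem (cd e) \<and> t < csup (cd e) then wt e / csup (cd e) else 0)"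

definition P2 :: "real \<Rightarrow> nat \<Rightarrow> real" where
  "P2 t c = (\<Sum>e<ne. if cd e = c then P1 t (vt e) else 0)"

definition Q2 :: "real \<Rightarrow> nat \<Rightarrow> real" where
  "Q2 t c = (\<Sum>e<ne. if cd e = c then Q1 t (vt e) else 0)"

definition tau :: "real \<Rightarrow> nat \<Rightarrow> real" where
  "tau t c = P2 t c / (1 + Q2 t c)"

lemma voter_code:
  assumes "inp st" "has_supp st" "reals st ''th'' 0 = t"
  shows "runs voter_code st M (\<lambda>st'. \<forall>v<nv. reals st' ''sp'' v = P1 t v \<and> reals st' ''sq'' v = Q1 t v)"
  unfolding voter_code_def
proof (rule runs_Seq)
  show "runs (For ''nvoters'' init_voter) st M (\<lambda>st'. \<forall>v<nv. reals st' ''sp'' v = str v \<and>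
      reals st' ''sq'' v = 0)"
  proof (rule runs_For)
    fix j sj assume j: "j < nv" and inv: "\<forall>v<j. reals sj ''sp'' v = str v \<and> reals sj ''sq'' v = 0"
      and i: "ints sj ''i'' 0 = j" and fr: "frame (For ''nvoters'' init_voter) st sj"
    note T = inpD[OF inp_frame[OF assms(1) fr]]
    show "\<forall>v<Suc j. reals (sem (Seq init_voter incr) sj) ''sp'' v = str v \<and> reals (sem (Seq
        init_voter incr) sj) ''sq'' v = 0"
      using inv by (simp add: less_Suc_eq T i)
  qed (use inpD[OF assms(1)] sizes in simp_all)
  fix st1 assume f: "frame (For ''nvoters'' init_voter) st st1"
    and z: "\<forall>v<nv. reals st1 ''sp'' v = str v \<and> reals st1 ''sq'' v = 0"
  have i1: "inp st1" by (rule inp_frame[OF assms(1) f]) simp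
  have s1: "has_supp st1" by (rule has_supp_frame[OF assms(2) f]) simp
  have t1: "reals st1 ''th'' 0 = t" using frameD(2)[OF f, of "''th''"] assms(3) by simp
  note D = inpD[OF i1]
  let ?Inv = "\<lambda>j sj. \<forall>v<nv.
     reals sj ''sp'' v = str v - (\<Sum>e<j. if vt e = v \<and> 0 < mem (cd e) \<and> \<not> t < csup (cd e) then
         wt e else 0) \<and>
     reals sj ''sq'' v = (\<Sum>e<j. if vt e = v \<and> 0 < mem (cd e) \<and> t < csup (cd e) then wt e / csup (cd e) else 0)"
  have "runs (For ''nedges'' use_weight) st1 M (?Inv ne)"
  proof (rule runs_For[where Inv = ?Inv])
    fix j sj assume j: "j < ne" and inv: "?Inv j sj"
      and i: "ints sj ''i'' 0 = j" and fr: "frame (For ''nedges'' use_weight) st1 sj"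
    note T = inpD[OF inp_frame[OF i1 fr]]
    have "has_supp sj" by (rule has_supp_frame[OF s1 fr]) simp
    then have s: "reals sj ''supp'' (cd j) = csup (cd j)" using cd_less[OF j] by (simp add: has_supp_def)
    have th: "reals sj ''th'' 0 = t" using frameD(2)[OF fr, of "''th''"] t1 by simp
    show "?Inv (Suc j) (sem (Seq use_weight incr) sj)"
      using inv vt_less[OF j] by (simp add: T i s th)
  qed (use D z in simp_all)
  then show "runs (For ''nedges'' use_weight) st1 M (\<lambda>st'. \<forall>v<nv. reals st' ''sp'' v = P1 t v
      \<and> reals st' ''sq'' v = Q1 t v)"
    by (simp only: P1_def Q1_def)
qed simp

lemma cand_code:
  assumes "inp st" and PQ: "\<forall>v<nv. reals st ''sp'' v = P1 t v \<and> reals st ''sq'' v = Q1 t v"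
  shows "runs cand_code st M (\<lambda>st'. \<forall>c<nc. reals st' ''cp'' c = P2 t c \<and> reals st' ''cq'' c = Q2 t c)"
  unfolding cand_code_def
proof (rule runs_Seq)
  let ?p = "Seq (SetR ''cp'' idx rzero) (SetR ''cq'' idx rzero)"
  show "runs (For ''ncands'' ?p) st M (\<lambda>st'. \<forall>c<nc. reals st' ''cp'' c = 0 \<and> reals st' ''cq'' c = 0)"
    by (rule runs_For) (use inpD[OF assms(1)] sizes in \<open>auto simp: less_Suc_eq\<close>)
  fix st1 assume f: "frame (For ''ncands'' ?p) st st1"
    and z: "\<forall>c<nc. reals st1 ''cp'' c = 0 \<and> reals st1 ''cq'' c = 0"
  have i1: "inp st1" by (rule inp_frame[OF assms(1) f]) simp
  have pq1: "\<forall>v<nv. reals st1 ''sp'' v = P1 t v \<and> reals st1 ''sq'' v = Q1 t v"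
    using frameD(2)[OF f, of "''sp''"] frameD(2)[OF f, of "''sq''"] PQ by simp
  note D = inpD[OF i1]
  let ?Inv = "\<lambda>j sj. \<forall>c<nc.
     reals sj ''cp'' c = (\<Sum>e<j. if cd e = c then P1 t (vt e) else 0) \<and>
     reals sj ''cq'' c = (\<Sum>e<j. if cd e = c then Q1 t (vt e) else 0)"
  have "runs (For ''nedges'' add_voter) st1 M (?Inv ne)"
  proof (rule runs_For[where Inv = ?Inv])
    fix j sj assume j: "j < ne" and inv: "?Inv j sj"
      and i: "ints sj ''i'' 0 = j" and fr: "frame (For ''nedges'' add_voter) st1 sj"
    note T = inpD[OF inp_frame[OF i1 fr]]
    have s: "reals sj ''sp'' (vt j) = P1 t (vt j)" "reals sj ''sq'' (vt j) = Q1 t (vt j)"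
      using frameD(2)[OF fr, of "''sp''"] frameD(2)[OF fr, of "''sq''"] pq1 vt_less[OF j] by simp_all
    show "?Inv (Suc j) (sem (Seq add_voter incr) sj)"
      using inv cd_less[OF j] by (simp add: T i s)
  qed (use D z in simp_all)
  then show "runs (For ''nedges'' add_voter) st1 M (\<lambda>st'. \<forall>c<nc. reals st' ''cp'' c = P2 t c
      \<and> reals st' ''cq'' c = Q2 t c)"
    by (simp only: P2_def Q2_def)
qed simp

definition best_cand :: "real \<Rightarrow> store \<Rightarrow> bool" where
  "best_cand t st \<longleftrightarrow> ints st ''cmax'' 0 < nc \<and> mem (ints st ''cmax'' 0) = 0 \<and>
     reals st ''best'' 0 = tau t (ints st ''cmax'' 0) \<and>
     (\<forall>c<nc. mem c = 0 \<longrightarrow> tau t c \<le> tau t (ints st ''cmax'' 0))"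

lemma cmax_code:
  assumes "inp st" "\<exists>c<nc. mem c = 0"
    and PQ: "\<forall>c<nc. reals st ''cp'' c = P2 t c \<and> reals st ''cq'' c = Q2 t c"
  shows "runs cmax_code st M (best_cand t)"
  unfolding cmax_code_def
proof (rule runs_Seq)
  show "runs (setI ''cmax'' (ivar ''ncands'')) st M (\<lambda>st'. ints st' ''cmax'' 0 = nc)"
    by (rule runs_loopfree) (use inpD[OF assms(1)] in auto)
  fix st1 assume f: "frame (setI ''cmax'' (ivar ''ncands'')) st st1" and c0: "ints st1 ''cmax'' 0 = nc"
  have i1: "inp st1" by (rule inp_frame[OF assms(1) f]) simp
  have pq1: "\<forall>v<nc. reals st1 ''cp'' v = P2 t v \<and> reals st1 ''cq'' v = Q2 t v"
    using frameD(2)[OF f, of "''cp''"] frameD(2)[OF f, of "''cq''"] PQ by simp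
  note D = inpD[OF i1]
  let ?Inv = "\<lambda>j sj. if ints sj ''cmax'' 0 < nc then mem (ints sj ''cmax'' 0) = 0 \<and>
     reals sj ''best'' 0 = tau t (ints sj ''cmax'' 0) \<and> (\<forall>c<j. mem c = 0 \<longrightarrow> tau t c
         \<le> tau t (ints sj ''cmax'' 0))
     else (\<forall>c<j. 0 < mem c)"
  have "runs (For ''ncands'' update_cmax) st1 M (?Inv nc)"
  proof (rule runs_For[where Inv = ?Inv])
    fix j sj
    assume j: "j < nc" and inv: "?Inv j sj"
      and i: "ints sj ''i'' 0 = j" and fr: "frame (For ''ncands'' update_cmax) st1 sj"
    note T = inpD[OF inp_frame[OF i1 fr]]
    have s: "reals sj ''cp'' j / (1 + reals sj ''cq'' j) = tau t j"
      using frameD(2)[OF fr, of "''cp''"] frameD(2)[OF fr, of "''cq''"] pq1 j by (simp add: tau_def)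
    show "?Inv (Suc j) (sem (Seq update_cmax incr) sj)"
      using inv j by (auto simp: T i s less_Suc_eq split: if_splits)
  qed (use D sizes c0 in simp_all)
  then show "runs (For ''ncands'' update_cmax) st1 M (best_cand t)"
    by (rule runs_conseq) (use assms(2) in \<open>auto simp: best_cand_def split: if_splits\<close>)
qed simp

lemma probe_code:
  assumes "inp st" "has_supp st" "reals st ''th'' 0 = t" "\<exists>c<nc. mem c = 0"
  shows "runs probe_code st M (best_cand t)"
  unfolding probe_code_def
proof (rule runs_Seq[OF voter_code[OF assms(1-3)]])
  fix st1 assume f: "frame voter_code st st1"
    and PQ: "\<forall>v<nv. reals st1 ''sp'' v = P1 t v \<and> reals st1 ''sq'' v = Q1 t v"
  have i1: "inp st1" by (rule inp_frame[OF assms(1) f]) (simp add: voter_code_def)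
  show "runs (Seq cand_code cmax_code) st1 M (best_cand t)"
  proof (rule runs_Seq[OF cand_code[OF i1 PQ]])
    fix st2 assume f: "frame cand_code st1 st2"
      and PQ: "\<forall>c<nc. reals st2 ''cp'' c = P2 t c \<and> reals st2 ''cq'' c = Q2 t c"
    have i2: "inp st2" by (rule inp_frame[OF i1 f]) (simp add: cand_code_def)
    show "runs cmax_code st2 M (best_cand t)" by (rule cmax_code[OF i2 assms(4) PQ])
  qed simp
qed simp

end

section \<open>Sorting the supports\<close>

text \<open>State of a bottom-up merge pass from \<open>a\<close> to \<open>b\<close> with runs of length
    \<open>h\<close>: positions below \<open>j\<close> are
  written, and \<open>{p..<m}\<close> and \<open>{q..<e}\<close> are the parts of the current two runs still to be merged.
  Only the set of values is tracked, not multiplicities, as the values serve as search thresholds.\<close>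

definition merge_inv :: "nat \<Rightarrow> nat \<Rightarrow> (nat \<Rightarrow> real) \<Rightarrow> nat
    \<Rightarrow> nat \<Rightarrow> nat \<Rightarrow> nat \<Rightarrow> nat \<Rightarrow> (nat \<Rightarrow> real)
        \<Rightarrow> bool" where
  "merge_inv h k a j p m q e b \<longleftrightarrow>
     p \<le> m \<and> m \<le> q \<and> q \<le> e \<and> e \<le> k \<and> j + (m - p) + (e - q) = e \<and> (e = k
         \<or> 2 * h dvd e) \<and>
     (\<forall>z. j \<le> z \<and> z < e \<longrightarrow> z div (2 * h) = j div (2 * h)) \<and>
     (\<forall>x y. p \<le> x \<and> x \<le> y \<and> y < m \<longrightarrow> a x \<le> a y) \<and>
     (\<forall>x y. q \<le> x \<and> x \<le> y \<and> y < e \<longrightarrow> a x \<le> a y) \<and>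
     (\<forall>x y. x \<le> y \<and> y < j \<and> x div (2 * h) = y div (2 * h) \<longrightarrow> b x \<le> b y) \<and>
     (\<forall>x. x < j \<and> j < e \<and> x div (2 * h) = j div (2 * h) \<longrightarrow>
        (\<forall>y. p \<le> y \<and> y < m \<longrightarrow> b x \<le> a y) \<and> (\<forall>y. q \<le> y \<and>
            y < e \<longrightarrow> b x \<le> a y)) \<and>
     b ` {..<j} = a ` ({..<p} \<union> {m..<q})"

text \<open>Aligned blocks of length \<open>h\<close> are the classes of indices with equal
  \<open>div h\<close>; the last one may be shorter.\<close>

definition blocks_sorted :: "nat \<Rightarrow> nat \<Rightarrow> (nat \<Rightarrow> real) \<Rightarrow> bool" where
  "blocks_sorted h k a \<longleftrightarrow> (\<forall>x y. x \<le> y \<and> y < k \<and> x div h = y div h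
      \<longrightarrow> a x \<le> a y)"

lemma merge_invD:
  assumes "merge_inv h k a j p m q e b"
  shows "p \<le> m" "m \<le> q" "q \<le> e" "e \<le> k" "j + (m - p) + (e - q) = e" "e = k \<or> 2 * h dvd e"
    "\<forall>z. j \<le> z \<and> z < e \<longrightarrow> z div (2 * h) = j div (2 * h)"
    "\<forall>x y. p \<le> x \<and> x \<le> y \<and> y < m \<longrightarrow> a x \<le> a y"
    "\<forall>x y. q \<le> x \<and> x \<le> y \<and> y < e \<longrightarrow> a x \<le> a y"
    "\<forall>x y. x \<le> y \<and> y < j \<and> x div (2 * h) = y div (2 * h) \<longrightarrow> b x \<le> b y"
    "\<forall>x. x < j \<and> j < e \<and> x div (2 * h) = j div (2 * h) \<longrightarrow>
        (\<forall>y. p \<le> y \<and> y < m \<longrightarrow> b x \<le> a y) \<and> (\<forall>y. q \<le> y \<and>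
            y < e \<longrightarrow> b x \<le> a y)"
    "b ` {..<j} = a ` ({..<p} \<union> {m..<q})"
  using assms unfolding merge_inv_def by - (elim conjE, assumption)+

text \<open>At \<open>j = e\<close> both runs are used up, and \<open>j < k\<close> leaves only the
  case that \<open>e\<close> is a multiple of \<open>2 * h\<close>. So \<open>j\<close> opens a new
  block, and the conditions comparing the unmerged values with those written in the same block hold
  vacuously.\<close>

lemma merge_inv_next_block:
  assumes inv: "merge_inv h k a j p m q e b" and j: "j = e" "j < k" and h: "0 < h"
    and a: "blocks_sorted h k a"
  shows "merge_inv h k a j j (min (j + h) k) (min (j + h) k) (min (min (j + h) k + h) k) b"
proof -
  note I1 = merge_invD(1,2,3,5,6)[OF inv]
  have pm: "p = m" "q = e" using I1 j by linarith+
  have "2 * h dvd j" using I1(5) j by auto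
  then obtain c where c: "j = 2 * h * c" by blast
  have d1: "x div h = 2 * c" if "j \<le> x" "x < j + h" for x
    using that h c by (intro div_nat_eqI) (auto simp: algebra_simps)
  have d2: "x div h = 2 * c + 1" if "j + h \<le> x" "x < j + 2 * h" for x
    using that h c by (intro div_nat_eqI) (auto simp: algebra_simps)
  have d3: "x div (2 * h) = c" if "j \<le> x" "x < j + 2 * h" for x
    using that h c by (intro div_nat_eqI) (auto simp: algebra_simps)
  have d4: "x div (2 * h) < c" if "x < j" for x
    using that h c by (simp add: div_less_iff_less_mult mult.commute)
  have jc: "j div (2 * h) = c" using d3[of j] h by simp
  let ?m = "min (j + h) k" and ?e = "min (min (j + h) k + h) k"
  \<comment> \<open>The two nested minima amount to \<open>min (j + 2 * h) k\<close>: the next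
    multiple of \<open>2 * h\<close>, or the end of the array.\<close>
  have e: "?e = k \<or> 2 * h dvd ?e"
  proof (cases "j + 2 * h \<le> k")
    case True
    then have "?e = 2 * h * (c + 1)" using c by (simp add: algebra_simps)
    then show ?thesis by (metis dvd_triv_left)
  qed auto
  have s1: "a x \<le> a y" if "j \<le> x" "x \<le> y" "y < ?m" for x y
  proof -
    have "x div h = y div h" using d1[of x] d1[of y] that by simp
    then show ?thesis using a that by (simp add: blocks_sorted_def)
  qed
  have s2: "a x \<le> a y" if "?m \<le> x" "x \<le> y" "y < ?e" for x y
  proof -
    have "j + h \<le> x" "y < j + 2 * h" using that by (auto simp: min_def split: if_splits)
    then have "x div h = y div h" using d2[of x] d2[of y] that by simp
    then show ?thesis using a that by (simp add: blocks_sorted_def)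
  qed
  note old = merge_invD(10,12)[OF inv]
  have set: "{..<p} \<union> {m..<q} = {..<j}" using pm j I1(2) by auto
  have "z div (2 * h) = j div (2 * h)" if "j \<le> z" "z < ?e" for z
    using d3[of z] jc that by (auto simp: min_def split: if_splits)
  then have blk: "\<forall>z. j \<le> z \<and> z < ?e \<longrightarrow> z div (2 * h) = j div (2 * h)" by blast
  have new: "\<not> x div (2 * h) = j div (2 * h)" if "x < j" for x using d4[OF that] jc by simp
  have le: "j \<le> ?m" "?m \<le> ?e" "j + (?m - j) + (?e - ?m) = ?e" using j by auto
  show ?thesis
    unfolding merge_inv_def
  proof (intro conjI allI impI)
    show "j \<le> ?m" "?m \<le> ?m" "?m \<le> ?e" "?e \<le> k" "j + (?m - j) + (?e - ?m) = ?e" using le by simp_all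
    show "?e = k \<or> 2 * h dvd ?e" by (fact e)
    show "b ` {..<j} = a ` ({..<j} \<union> {?m..<?m})" using old(2)[unfolded set] by simp
  next
    fix z assume "j \<le> z \<and> z < ?e" then show "z div (2 * h) = j div (2 * h)" using blk by blast
  next
    fix x y assume "j \<le> x \<and> x \<le> y \<and> y < ?m" then show "a x \<le> a y" using s1 by blast
  next
    fix x y assume "?m \<le> x \<and> x \<le> y \<and> y < ?e" then show "a x \<le> a y" using s2 by blast
  next
    fix x y assume "x \<le> y \<and> y < j \<and> x div (2 * h) = y div (2 * h)"
    then show "b x \<le> b y" using old(1) by blast
  next
    fix x y assume "x < j \<and> j < ?e \<and> x div (2 * h) = j div (2 * h)"
    then show "b x \<le> a y" "b x \<le> a y" using new by blast+
  qed
qed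

text \<open>The chosen head is at most everything left in either run, so it may follow all values
  already written in the block and precede all that are still to come.\<close>

lemma merge_inv_left:
  assumes inv: "merge_inv h k a j p m q e b" and p: "p < m" "q < e \<Longrightarrow> a p \<le> a q"
  shows "merge_inv h k a (Suc j) (Suc p) m q e (b(j := a p))"
proof -
  note I1 = merge_invD(1-6)[OF inv] and I2 = merge_invD(7)[OF inv] and I3 = merge_invD(8)[OF inv]
    and I4 = merge_invD(9)[OF inv] and I5 = merge_invD(10)[OF inv] and I6 = merge_invD(11)[OF inv]
    and set = merge_invD(12)[OF inv]
  have je: "j < e" using I1 p by linarith
  have sA: "a x \<le> a y" if "p \<le> x" "x \<le> y" "y < m" for x y using I3 that by blast
  have sB: "a x \<le> a y" if "q \<le> x" "x \<le> y" "y < e" for x y using I4 that by blast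
  have sb: "b x \<le> b y" if "x \<le> y" "y < j" "x div (2 * h) = y div (2 * h)" for x y using I5 that by blast
  have pB: "a p \<le> a y" if "q \<le> y" "y < e" for y
    using order_trans[OF p(2) sB[of q y]] that by simp
  have blk: "z div (2 * h) = j div (2 * h)" if "j \<le> z" "z < e" for z using I2 that by blast
  have ba: "b x \<le> a y" if "x < j" "x div (2 * h) = j div (2 * h)" "p \<le> y \<and> y < m \<or> q \<le> y
      \<and> y < e" for x y
    using I6 that je by blast
  have "(b(j := a p)) ` {..<Suc j} = insert (a p) (b ` {..<j})" by (auto simp: lessThan_Suc)
  then have set': "(b(j := a p)) ` {..<Suc j} = a ` ({..<Suc p} \<union> {m..<q})"
    unfolding set by (auto simp: lessThan_Suc)
  have 4: "(b(j := a p)) x \<le> (b(j := a p)) y" if "x \<le> y" "y < Suc j" "x div (2 * h) = y div (2 * h)" for x y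
  proof (cases "y = j")
    case True
    then show ?thesis using ba[of x p] that p(1) by (cases "x = j") simp_all
  next
    case False
    then show ?thesis using sb[of x y] that by simp
  qed
  have 5: "(b(j := a p)) x \<le> a y" if "x < Suc j" "Suc j < e" "x div (2 * h) = Suc j div (2 * h)"
    "Suc p \<le> y \<and> y < m \<or> q \<le> y \<and> y < e" for x y
  proof (cases "x = j")
    case True then show ?thesis using that(4) sA[of p y] pB[of y] by auto
  next
    case False
    then have "x < j" "x div (2 * h) = j div (2 * h)" using that blk[of "Suc j"] by simp_all
    moreover have "p \<le> y \<and> y < m \<or> q \<le> y \<and> y < e" using that(4) by linarith
    ultimately show ?thesis using ba[of x y] False by simp
  qed
  have blk': "z div (2 * h) = Suc j div (2 * h)" if "Suc j \<le> z" "z < e" for z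
    using blk[of z] blk[of "Suc j"] that by simp
  show ?thesis
    unfolding merge_inv_def
  proof (intro conjI allI impI)
    show "Suc p \<le> m" "Suc j + (m - Suc p) + (e - q) = e" using p(1) I1(5) by linarith+
    show "m \<le> q" "q \<le> e" "e \<le> k" "e = k \<or> 2 * h dvd e" by (fact I1)+
    show "(b(j := a p)) ` {..<Suc j} = a ` ({..<Suc p} \<union> {m..<q})" by (fact set')
  next
    fix z assume "Suc j \<le> z \<and> z < e" then show "z div (2 * h) = Suc j div (2 * h)" using blk' by blast
  next
    fix x y assume "Suc p \<le> x \<and> x \<le> y \<and> y < m" then show "a x \<le> a y" using sA[of x y] by simp
  next
    fix x y assume "q \<le> x \<and> x \<le> y \<and> y < e" then show "a x \<le> a y" using sB by blast
  next
    fix x y assume "x \<le> y \<and> y < Suc j \<and> x div (2 * h) = y div (2 * h)"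
    then show "(b(j := a p)) x \<le> (b(j := a p)) y" using 4 by blast
  next
    fix x y assume "x < Suc j \<and> Suc j < e \<and> x div (2 * h) = Suc j div (2 * h)" "Suc p \<le> y \<and> y < m"
    then show "(b(j := a p)) x \<le> a y" using 5 by blast
  next
    fix x y assume "x < Suc j \<and> Suc j < e \<and> x div (2 * h) = Suc j div (2 * h)" "q \<le> y \<and> y < e"
    then show "(b(j := a p)) x \<le> a y" using 5 by blast
  qed
qed

lemma merge_inv_right:
  assumes inv: "merge_inv h k a j p m q e b" and q: "q < e" "p < m \<Longrightarrow> a q \<le> a p"
  shows "merge_inv h k a (Suc j) p m (Suc q) e (b(j := a q))"
proof -
  note I1 = merge_invD(1-6)[OF inv] and I2 = merge_invD(7)[OF inv] and I3 = merge_invD(8)[OF inv]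
    and I4 = merge_invD(9)[OF inv] and I5 = merge_invD(10)[OF inv] and I6 = merge_invD(11)[OF inv]
    and set = merge_invD(12)[OF inv]
  have je: "j < e" using I1 q by linarith
  have sA: "a x \<le> a y" if "p \<le> x" "x \<le> y" "y < m" for x y using I3 that by blast
  have sB: "a x \<le> a y" if "q \<le> x" "x \<le> y" "y < e" for x y using I4 that by blast
  have sb: "b x \<le> b y" if "x \<le> y" "y < j" "x div (2 * h) = y div (2 * h)" for x y using I5 that by blast
  have pA: "a q \<le> a y" if "p \<le> y" "y < m" for y
    using order_trans[OF q(2) sA[of p y]] that by simp
  have blk: "z div (2 * h) = j div (2 * h)" if "j \<le> z" "z < e" for z using I2 that by blast
  have ba: "b x \<le> a y" if "x < j" "x div (2 * h) = j div (2 * h)" "p \<le> y \<and> y < m \<or> q \<le> y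
      \<and> y < e" for x y
    using I6 that je by blast
  have "(b(j := a q)) ` {..<Suc j} = insert (a q) (b ` {..<j})" by (auto simp: lessThan_Suc)
  also have "\<dots> = a ` ({..<p} \<union> insert q {m..<q})" unfolding set by auto
  also have "insert q {m..<q} = {m..<Suc q}" using I1 by auto
  finally have set': "(b(j := a q)) ` {..<Suc j} = a ` ({..<p} \<union> {m..<Suc q})" .
  have 4: "(b(j := a q)) x \<le> (b(j := a q)) y" if "x \<le> y" "y < Suc j" "x div (2 * h) = y div (2 * h)" for x y
  proof (cases "y = j")
    case True
    then show ?thesis using ba[of x q] that q(1) by (cases "x = j") simp_all
  next
    case False
    then show ?thesis using sb[of x y] that by simp
  qed
  have 5: "(b(j := a q)) x \<le> a y" if "x < Suc j" "Suc j < e" "x div (2 * h) = Suc j div (2 * h)"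
    "p \<le> y \<and> y < m \<or> Suc q \<le> y \<and> y < e" for x y
  proof (cases "x = j")
    case True then show ?thesis using that(4) sB[of q y] pA[of y] by auto
  next
    case False
    then have "x < j" "x div (2 * h) = j div (2 * h)" using that blk[of "Suc j"] by simp_all
    moreover have "p \<le> y \<and> y < m \<or> q \<le> y \<and> y < e" using that(4) by linarith
    ultimately show ?thesis using ba[of x y] False by simp
  qed
  have blk': "z div (2 * h) = Suc j div (2 * h)" if "Suc j \<le> z" "z < e" for z
    using blk[of z] blk[of "Suc j"] that by simp
  show ?thesis
    unfolding merge_inv_def
  proof (intro conjI allI impI)
    show "Suc q \<le> e" "m \<le> Suc q" "Suc j + (m - p) + (e - Suc q) = e" using q(1) I1(2,5) by linarith+
    show "p \<le> m" "e \<le> k" "e = k \<or> 2 * h dvd e" by (fact I1)+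
    show "(b(j := a q)) ` {..<Suc j} = a ` ({..<p} \<union> {m..<Suc q})" by (fact set')
  next
    fix z assume "Suc j \<le> z \<and> z < e" then show "z div (2 * h) = Suc j div (2 * h)" using blk' by blast
  next
    fix x y assume "p \<le> x \<and> x \<le> y \<and> y < m" then show "a x \<le> a y" using sA by blast
  next
    fix x y assume "Suc q \<le> x \<and> x \<le> y \<and> y < e" then show "a x \<le> a y" using sB[of x y] by simp
  next
    fix x y assume "x \<le> y \<and> y < Suc j \<and> x div (2 * h) = y div (2 * h)"
    then show "(b(j := a q)) x \<le> (b(j := a q)) y" using 4 by blast
  next
    fix x y assume "x < Suc j \<and> Suc j < e \<and> x div (2 * h) = Suc j div (2 * h)" "p \<le> y \<and> y < m"
    then show "(b(j := a q)) x \<le> a y" using 5 by blast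
  next
    fix x y assume "x < Suc j \<and> Suc j < e \<and> x div (2 * h) = Suc j div (2 * h)" "Suc q \<le> y \<and> y < e"
    then show "(b(j := a q)) x \<le> a y" using 5 by blast
  qed
qed

lemma merge_inv_init: "merge_inv h k a 0 0 0 0 0 b"
  by (simp add: merge_inv_def)

text \<open>At \<open>j = k\<close> the balance \<open>j + (m - p) + (e - q) = e\<close> together
  with \<open>e \<le> k\<close> forces \<open>e = k\<close> and empties both runs.\<close>

lemma merge_inv_final:
  assumes "merge_inv h k a k p m q e b"
  shows "b ` {..<k} = a ` {..<k}" "blocks_sorted (2 * h) k b"
proof -
  note I1 = merge_invD(1-5)[OF assms]
  then have "e = k" "p = m" "q = k" "m \<le> q" by linarith+
  then have "{..<p} \<union> {m..<q} = {..<k}" by auto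
  then show "b ` {..<k} = a ` {..<k}" "blocks_sorted (2 * h) k b"
    using assms by (simp_all add: merge_inv_def blocks_sorted_def)
qed

definition merge_next_code :: com where
  "merge_next_code = Cond (ILess idx (ivar ''e'')) Skip
     (Seq (setI ''p'' idx) (Seq (setI ''m'' (IMin (IAdd idx (ivar ''h'')) (ivar ''seats'')))
       (Seq (setI ''q'' (ivar ''m'')) (setI ''e'' (IMin (IAdd (ivar ''m'') (ivar ''h'')) (ivar ''seats''))))))"

definition merge_pick_code :: com where
  "merge_pick_code = Cond (BAnd (ILess (ivar ''p'') (ivar ''m''))
        (BNot (BAnd (ILess (ivar ''q'') (ivar ''e'')) (RLess (RRead ''a'' (ivar ''q'')) (RRead ''a'' (ivar ''p''))))))
     (Seq (SetR ''b'' idx (RRead ''a'' (ivar ''p''))) (setI ''p'' (IAdd (ivar ''p'') (IConst 1))))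
     (Seq (SetR ''b'' idx (RRead ''a'' (ivar ''q''))) (setI ''q'' (IAdd (ivar ''q'') (IConst 1))))"

text \<open>One loop over the output positions performs all merges of a pass:
  \<open>merge_next_code\<close> opens the next pair of runs whenever the current pair is used up.
  Thus the loop body stays loop-free, as \<open>runs_For\<close> demands.\<close>

definition pass_code :: com where
  "pass_code = Seq (Seq (setI ''p'' (IConst 0)) (Seq (setI ''m'' (IConst 0)) (Seq (setI ''q'' (IConst 0)) (setI
      ''e'' (IConst 0)))))
     (Seq (For ''seats'' (Seq merge_next_code merge_pick_code))
        (Seq (For ''seats'' (SetR ''a'' idx (RRead ''b'' idx))) (setI ''h'' (IAdd (ivar ''h'') (ivar ''h'')))))"

definition sort_code :: com where
  "sort_code = Seq (setI ''h'' (IConst 1)) (While (ILess (ivar ''h'') (ivar ''seats'')) pass_code)"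

context instance_data
begin

lemma diff_diff_eq_min: "x - (x - y) = min x y" for x y :: nat
  by auto

lemma merge_code:
  assumes inp: "inp st" and z: "ints st ''p'' 0 = 0" "ints st ''m'' 0 = 0" "ints st ''q'' 0 = 0" "ints st ''e'' 0 = 0"
    and h: "0 < h" "ints st ''h'' 0 = h" and a: "blocks_sorted h k a" "reals st ''a'' = a"
  shows "runs (For ''seats'' (Seq merge_next_code merge_pick_code)) st M
     (\<lambda>st'. reals st' ''b'' ` {..<k} = a ` {..<k} \<and> blocks_sorted (2 * h) k (reals st' ''b''))"
proof -
  let ?Inv = "\<lambda>j sj. merge_inv h k a j (ints sj ''p'' 0) (ints sj ''m'' 0) (ints sj ''q'' 0) (ints sj
      ''e'' 0) (reals sj ''b'')"
  let ?p = "Seq merge_next_code merge_pick_code"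
  have "runs (For ''seats'' ?p) st M (?Inv k)"
  proof (rule runs_For[where Inv = ?Inv])
    fix j sj assume j: "j < k" and inv: "?Inv j sj"
      and i: "ints sj ''i'' 0 = j" and fr: "frame (For ''seats'' ?p) st sj"
    have "inp sj" by (rule inp_frame[OF inp fr]) (simp add: merge_next_code_def merge_pick_code_def)
    note T = inpD[OF this]
    have ht: "ints sj ''h'' 0 = h" using frameD(1)[OF fr, of "''h''"] h by (simp add: merge_next_code_def merge_pick_code_def)
    have at: "reals sj ''a'' = a" using frameD(2)[OF fr, of "''a''"] a by (simp add: merge_next_code_def merge_pick_code_def)
    define \<upsilon> where "\<upsilon> = sem merge_next_code sj"
    have u: "ints \<upsilon> ''i'' 0 = j" "reals \<upsilon> ''a'' = a" by (simp_all add: \<upsilon>_def merge_next_code_def i at)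
    have inv': "?Inv j \<upsilon>" and je: "j < ints \<upsilon> ''e'' 0"
    proof -
      have "?Inv j \<upsilon> \<and> j < ints \<upsilon> ''e'' 0"
      proof (cases "j < ints sj ''e'' 0")
        case True
        then show ?thesis using inv by (simp add: \<upsilon>_def merge_next_code_def i)
      next
        case False
        then have "j = ints sj ''e'' 0" using merge_invD(1-5)[OF inv] by linarith
        from merge_inv_next_block[OF inv this j h(1) a(1)]
        show ?thesis using False j h(1)
          by (simp add: \<upsilon>_def merge_next_code_def i T ht diff_diff_eq_min)
      qed
      then show "?Inv j \<upsilon>" "j < ints \<upsilon> ''e'' 0" by auto
    qed
    have sem: "sem (Seq ?p incr) sj = sem incr (sem merge_pick_code \<upsilon>)" by (simp add: \<upsilon>_def)
    show "?Inv (Suc j) (sem (Seq ?p incr) sj)"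
    proof (cases "ints \<upsilon> ''p'' 0 < ints \<upsilon> ''m'' 0 \<and> \<not> (ints \<upsilon> ''q'' 0 < ints
        \<upsilon> ''e'' 0 \<and> a (ints \<upsilon> ''q'' 0) < a (ints \<upsilon> ''p'' 0))")
      case True
      then have "merge_inv h k a (Suc j) (Suc (ints \<upsilon> ''p'' 0)) (ints \<upsilon> ''m'' 0) (ints \<upsilon> ''q'' 0)
          (ints \<upsilon> ''e'' 0) ((reals \<upsilon> ''b'')(j := a (ints \<upsilon> ''p'' 0)))"
        by (intro merge_inv_left[OF inv']) auto
      then show ?thesis unfolding sem using True by (simp add: merge_pick_code_def u)
    next
      case False
      then have "ints \<upsilon> ''q'' 0 < ints \<upsilon> ''e'' 0" using merge_invD(1-5)[OF inv'] je by linarith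
      then have "merge_inv h k a (Suc j) (ints \<upsilon> ''p'' 0) (ints \<upsilon> ''m'' 0) (Suc (ints \<upsilon> ''q'' 0))
          (ints \<upsilon> ''e'' 0) ((reals \<upsilon> ''b'')(j := a (ints \<upsilon> ''q'' 0)))"
        using False by (intro merge_inv_right[OF inv']) auto
      then show ?thesis unfolding sem using False by (simp add: merge_pick_code_def u) blast
    qed
  qed (use inpD[OF inp] sizes z merge_inv_init in \<open>simp_all add: merge_next_code_def merge_pick_code_def\<close>)
  then show ?thesis
  proof (rule runs_conseq)
    fix sj assume "?Inv k sj"
    from merge_inv_final[OF this]
    show "reals sj ''b'' ` {..<k} = a ` {..<k} \<and> blocks_sorted (2 * h) k (reals sj ''b'')" by simp
  qed simp
qed

text \<open>\<open>r\<close> is a number of doublings of \<open>h\<close> that suffices to reach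
  \<open>k\<close>, hence the bound on the remaining passes.\<close>

definition sort_inv :: "(nat \<Rightarrow> real) \<Rightarrow> nat \<Rightarrow> store \<Rightarrow> bool" where
  "sort_inv a r st \<longleftrightarrow> inp st \<and> 0 < ints st ''h'' 0 \<and> k \<le> ints st ''h'' 0 * 2 ^ r \<and>
     blocks_sorted (ints st ''h'' 0) k (reals st ''a'') \<and> reals st ''a'' ` {..<k} = a ` {..<k}"

lemma pass_code:
  assumes inv: "sort_inv a r st" and less: "ints st ''h'' 0 < k"
  shows "\<exists>r'. r = Suc r' \<and> runs pass_code st M (sort_inv a r')"
proof -
  let ?h = "ints st ''h'' 0"
  have inp: "inp st" and h0: "0 < ?h" and hr: "k \<le> ?h * 2 ^ r" and bs: "blocks_sorted ?h k (reals st ''a'')"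
    and set: "reals st ''a'' ` {..<k} = a ` {..<k}"
    using inv by (auto simp: sort_inv_def)
  obtain r' where r': "r = Suc r'" using hr less by (cases r) auto
  let ?z = "Seq (setI ''p'' (IConst 0)) (Seq (setI ''m'' (IConst 0)) (Seq (setI ''q'' (IConst 0)) (setI ''e'' (IConst 0))))"
  let ?f = "For ''seats'' (Seq merge_next_code merge_pick_code)"
  let ?c = "For ''seats'' (SetR ''a'' idx (RRead ''b'' idx))"
  let ?d = "setI ''h'' (IAdd (ivar ''h'') (ivar ''h''))"
  have "runs pass_code st M (sort_inv a r')"
    unfolding pass_code_def
  proof (rule runs_Seq)
    show "runs ?z st M (\<lambda>sj. ints sj ''p'' 0 = 0 \<and> ints sj ''m'' 0 = 0 \<and> ints sj ''q'' 0 = 0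
        \<and> ints sj ''e'' 0 = 0)"
      by (rule runs_loopfree) auto
    fix st1 assume f1: "frame ?z st st1"
      and z: "ints st1 ''p'' 0 = 0 \<and> ints st1 ''m'' 0 = 0 \<and> ints st1 ''q'' 0 = 0 \<and> ints st1 ''e'' 0 = 0"
    have i1: "inp st1" by (rule inp_frame[OF inp f1]) simp
    have h1: "ints st1 ''h'' = ints st ''h''" "reals st1 ''a'' = reals st ''a''"
      using frameD[OF f1] by simp_all
    show "runs (Seq ?f (Seq ?c ?d)) st1 M (sort_inv a r')"
    proof (rule runs_Seq)
      show "runs ?f st1 M (\<lambda>sj. reals sj ''b'' ` {..<k} = reals st ''a'' ` {..<k} \<and> blocks_sorted (2
          * ?h) k (reals sj ''b''))"
        by (rule merge_code[OF i1 _ _ _ _ h0 _ bs]) (use z h1 in simp_all)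
      fix st2 assume f2: "frame ?f st1 st2"
        and b: "reals st2 ''b'' ` {..<k} = reals st ''a'' ` {..<k} \<and> blocks_sorted (2 * ?h) k (reals st2 ''b'')"
      have i2: "inp st2" by (rule inp_frame[OF i1 f2]) (simp add: merge_next_code_def merge_pick_code_def)
      have h2: "ints st2 ''h'' = ints st ''h''"
        using frameD[OF f2] h1 by (simp add: merge_next_code_def merge_pick_code_def)
      show "runs (Seq ?c ?d) st2 M (sort_inv a r')"
      proof (rule runs_Seq)
        show "runs ?c st2 M (\<lambda>sj. \<forall>x<k. reals sj ''a'' x = reals st2 ''b'' x)"
        proof (rule runs_For)
          fix j sj assume inv: "\<forall>x<j. reals sj ''a'' x = reals st2 ''b'' x" and i: "ints sj ''i'' 0 = j"
            and fr: "frame ?c st2 sj"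
          have "reals sj ''b'' = reals st2 ''b''" using frameD(2)[OF fr, of "''b''"] by simp
          then show "\<forall>x<Suc j. reals (sem (Seq (SetR ''a'' idx (RRead ''b'' idx)) incr) sj) ''a'' x = reals st2 ''b'' x"
            using inv by (simp add: i less_Suc_eq)
        qed (use inpD[OF i2] sizes in simp_all)
        fix st3 assume f3: "frame ?c st2 st3" and cp: "\<forall>x<k. reals st3 ''a'' x = reals st2 ''b'' x"
        have i3: "inp st3" by (rule inp_frame[OF i2 f3]) simp
        have h3: "ints st3 ''h'' = ints st ''h''" using frameD[OF f3] h2 by simp
        have "reals st3 ''a'' ` {..<k} = reals st2 ''b'' ` {..<k}" using cp by (intro image_cong) auto
        then have s3: "reals st3 ''a'' ` {..<k} = a ` {..<k}" using b set by simp
        have b3: "blocks_sorted (2 * ?h) k (reals st3 ''a'')" using b cp by (auto simp: blocks_sorted_def)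
        show "runs ?d st3 M (sort_inv a r')"
        proof (rule runs_loopfree)
          have "frame ?d st3 (sem ?d st3)" by (simp add: frame_def)
          then have "inp (sem ?d st3)" by (rule inp_frame[OF i3]) simp
          then show "sort_inv a r' (sem ?d st3)"
            using s3 b3 h0 hr r' by (simp add: sort_inv_def h3 mult_2 algebra_simps)
        qed auto
      qed simp
    qed simp
  qed simp
  then show ?thesis using r' by blast
qed

text \<open>Blocks of length 1 are trivially sorted; once \<open>k \<le> h\<close>, all positions
  lie in a single block.\<close>

lemma sort_code:
  assumes inp: "inp st" and k: "k \<le> 2 ^ r"
  shows "runs sort_code st (M * Suc r) (\<lambda>st'. reals st' ''a'' ` {..<k} = reals st ''a'' ` {..<k} \<and>
     (\<forall>x y. x \<le> y \<and> y < k \<longrightarrow> reals st' ''a'' x \<le> reals st' ''a'' y))"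
  unfolding sort_code_def
proof (rule runs_Seq)
  let ?a = "reals st ''a''"
  have "frame (setI ''h'' (IConst 1)) st (sem (setI ''h'' (IConst 1)) st)" by (simp add: frame_def)
  then have i: "inp (sem (setI ''h'' (IConst 1)) st)" by (rule inp_frame[OF inp]) simp
  show "runs (setI ''h'' (IConst 1)) st (M * Suc r) (sort_inv ?a r)"
    by (rule runs_loopfree) (use i k in \<open>auto simp: sort_inv_def blocks_sorted_def\<close>)
  fix st1 assume inv: "sort_inv ?a r st1"
  show "runs (While (ILess (ivar ''h'') (ivar ''seats'')) pass_code) st1 (M * Suc r) (\<lambda>st'. reals st'
      ''a'' ` {..<k} = ?a ` {..<k} \<and>
     (\<forall>x y. x \<le> y \<and> y < k \<longrightarrow> reals st' ''a'' x \<le> reals st' ''a'' y))"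
  proof (rule runs_conseq[OF runs_While[where Inv = "sort_inv ?a", OF inv]])
    fix r sj assume I: "sort_inv ?a r sj" and b: "bval (ILess (ivar ''h'') (ivar ''seats'')) sj"
    have "inp sj" using I by (simp add: sort_inv_def)
    then show "\<exists>r'. r = Suc r' \<and> runs pass_code sj M (sort_inv ?a r')"
      using pass_code[OF I] b inpD(4) by simp
  next
    fix sj assume "\<not> bval (ILess (ivar ''h'') (ivar ''seats'')) sj \<and> (\<exists>r'. sort_inv ?a r' sj)"
    then obtain r' where I: "sort_inv ?a r' sj" and b: "\<not> bval (ILess (ivar ''h'') (ivar ''seats'')) sj" by blast
    have "inp sj" using I by (simp add: sort_inv_def)
    then have "k \<le> ints sj ''h'' 0" using b inpD(4) by simp
    then show "reals sj ''a'' ` {..<k} = ?a ` {..<k} \<and> (\<forall>x y. x \<le> y \<and> y < k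
        \<longrightarrow> reals sj ''a'' x \<le> reals sj ''a'' y)"
      using I by (auto simp: sort_inv_def blocks_sorted_def)
  qed simp_all
qed simp

end

section \<open>Binary search and exchange\<close>

definition probe_mid_code :: com where
  "probe_mid_code = Seq (setI ''mid'' (IHalf (IAdd (ivar ''lo'') (ivar ''hi''))))
     (setR ''th'' (RRead ''a'' (ivar ''mid'')))"

text \<open>\<open>beta\<close> remembers the last probed support that does not exceed the maximum
  score.\<close>

abbreviation "halve_step \<equiv>
  Cond (RLess (rvar ''best'') (rvar ''th'')) (setI ''hi'' (ivar ''mid'')) (Seq (setR ''beta'' (rvar ''th'')) (setI
      ''lo'' (IAdd (ivar ''mid'') (IConst 1))))"

definition halve_code :: com where
  "halve_code = Seq probe_mid_code (Seq probe_code
     halve_step)"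

text \<open>The last probe takes place at \<open>beta\<close>, the left end of the linear piece that
  contains the maximum score. The initial value 0 covers the case that all supports exceed that
  score.\<close>

definition search_code :: com where
  "search_code = Seq (Seq (setI ''lo'' (IConst 0)) (Seq (setI ''hi'' (ivar ''seats'')) (setR ''beta'' rzero)))
     (Seq (While (ILess (ivar ''lo'') (ivar ''hi'')) halve_code)
        (Seq (setR ''th'' (rvar ''beta'')) probe_code))"

lemmas probe_defs = probe_code_def voter_code_def cand_code_def cmax_code_def

lemma midpoint_bounds:
  fixes l h x :: nat
  assumes "l < h" "h - l < 2 * x"
  shows "l \<le> (l + h) div 2" "(l + h) div 2 < h" "(l + h) div 2 - l < x" "h - Suc ((l + h) div 2) < x"
  using assms by linarith+

lemma frame_loopfree: "loopfree p \<Longrightarrow> frame p st (sem p st)"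
  using exec_loopfree exec_frame by blast

section \<open>The program for an exchange and for a whole iteration\<close>

abbreviation "init_remainder \<equiv>
  Seq (SetI ''ap'' idx (IConst 0)) (SetR ''rem'' idx (RRead ''strength'' idx))"

text \<open>\<open>cmin\<close> leaves \<open>member\<close> at once, so that the later loops treat
  its edges like those of any non-member and zero their weights.\<close>

definition reset_code :: com where
  "reset_code = Seq (SetI ''member'' (ivar ''cmin'') (IConst 0))
     (For ''nvoters'' init_remainder)"

text \<open>An unordered edge list offers no constant-time adjacency test, so the voters of
  \<open>cmax\<close> are flagged beforehand.\<close>

abbreviation "approve_voter \<equiv>
  Cond (IEq cand_i (ivar ''cmax'')) (SetI ''ap'' voter_i (IConst 1)) Skip"

definition approve_code :: com where
  "approve_code = For ''nedges'' approve_voter"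

text \<open>\<open>supp\<close> still holds the supports from before the exchange, as the quotients
  require. What is subtracted from \<open>rem\<close> is the weight after scaling.\<close>

abbreviation "scale_weight \<equiv>
  Cond (is_member cand_i) (Seq (Cond (BAnd (ILess (IConst 0) (IRead ''ap'' voter_i)) (RLess (rvar ''best'') (RRead
      ''supp'' cand_i))) (SetR ''weight'' idx (RDiv (RMul (RRead ''weight'' idx) (rvar ''best'')) (RRead ''supp''
          cand_i))) Skip) (SetR ''rem'' voter_i (RSub (RRead ''rem'' voter_i) (RRead ''weight'' idx)))) (SetR
              ''weight'' idx rzero)"

definition scale_code :: com where
  "scale_code = For ''nedges'' scale_weight"

text \<open>This needs a loop of its own, because the remainder of a voter is known only after all
  its edges have been scaled.\<close>

abbreviation "fill_weight \<equiv>
  Cond (IEq cand_i (ivar ''cmax'')) (SetR ''weight'' idx (RRead ''rem'' voter_i)) Skip"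

definition fill_code :: com where
  "fill_code = For ''nedges'' fill_weight"

text \<open>\<open>cmax\<close> joins \<open>member\<close> only here: the scaling loop must not
  subtract its old weights from the remainders.\<close>

abbreviation "finish_update \<equiv>
  Seq (SetI ''member'' (ivar ''cmax'') (IConst 1)) (setI ''return'' (IConst 0))"

definition update_code :: com where
  "update_code = Seq reset_code (Seq approve_code (Seq scale_code (Seq fill_code
     finish_update)))"

abbreviation "stop_test \<equiv>
  BAnd (RLess (rvar ''best'') (RMul (RAdd rone (rvar ''eps'')) (rvar ''tmin''))) (RLess (rvar ''best'') (rvar ''avg''))"

definition iteration_code :: com where
  "iteration_code = Seq supports_code (Seq cmin_code (Seq collect_code (Seq sort_code (Seq average_code
     (Seq search_code
       (Cond stop_test
          (setI ''return'' (IConst 1)) update_code))))))"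

section \<open>Correctness of search, exchange and iteration\<close>

context instance_data
begin

text \<open>\<open>s\<close> stands for the maximum score, which the program does not know;
  \<open>r\<close> bounds the number of halvings still to come.\<close>

definition search_inv :: "real \<Rightarrow> (nat \<Rightarrow> real) \<Rightarrow> nat \<Rightarrow> store
    \<Rightarrow> bool" where
  "search_inv s a r st \<longleftrightarrow> inp st \<and> has_supp st \<and> reals st ''a'' = a \<and>
     ints st ''lo'' 0 \<le> ints st ''hi'' 0 \<and> ints st ''hi'' 0 \<le> k \<and> ints st ''hi'' 0 - ints st
         ''lo'' 0 < 2 ^ r \<and>
     0 \<le> reals st ''beta'' 0 \<and> reals st ''beta'' 0 \<le> s \<and>
     (\<forall>x<ints st ''lo'' 0. a x \<le> reals st ''beta'' 0) \<and>
     (\<forall>x. ints st ''hi'' 0 \<le> x \<and> x < k \<longrightarrow> s < a x)"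

text \<open>The hypothesis on \<open>s\<close> compares it with \<open>t\<close> through
  \<open>tau\<close> at the very same \<open>t\<close>; so the best candidate of a single probe
  decides which half to keep.\<close>

lemma halve_code:
  assumes inv: "search_inv s a r st" and less: "ints st ''lo'' 0 < ints st ''hi'' 0"
    and sorted: "\<forall>x y. x \<le> y \<and> y < k \<longrightarrow> a x \<le> a y" and nonneg: "\<forall>x<k. 0 \<le> a x"
    and s: "\<And>t. 0 \<le> t \<Longrightarrow> t \<le> s \<longleftrightarrow> (\<exists>c<nc. mem c = 0 \<and>
        t \<le> tau t c)" and ne: "\<exists>c<nc. mem c = 0"
  shows "\<exists>r'. r = Suc r' \<and> runs halve_code st M (search_inv s a r')"
proof -
  let ?lo = "ints st ''lo'' 0" and ?hi = "ints st ''hi'' 0" and ?\<beta> = "reals st ''beta'' 0"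
  note I = inv[unfolded search_inv_def]
  have inp: "inp st" and hs: "has_supp st" and a: "reals st ''a'' = a" and hik: "?hi \<le> k"
    and d: "?hi - ?lo < 2 ^ r" and \<beta>: "0 \<le> ?\<beta>" "?\<beta> \<le> s" and lo: "\<forall>x<?lo. a x \<le> ?\<beta>"
    and hi: "\<forall>x. ?hi \<le> x \<and> x < k \<longrightarrow> s < a x"
    using I by - (elim conjE, assumption)+
  obtain r' where r': "r = Suc r'" using d less by (cases r) auto
  define mid where "mid = (?lo + ?hi) div 2"
  have mid: "?lo \<le> mid" "mid < ?hi" "mid - ?lo < 2 ^ r'" "?hi - Suc mid < 2 ^ r'"
    using midpoint_bounds[OF less, of "2 ^ r'"] d r' unfolding mid_def by simp_all
  have midk: "mid < k" using mid hik by simp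
  let ?t = "a mid"
  have t0: "0 \<le> ?t" using nonneg midk by blast
  have "runs halve_code st M (search_inv s a r')"
    unfolding halve_code_def
  proof (rule runs_Seq)
    show "runs probe_mid_code st M (\<lambda>sj. ints sj ''mid'' 0 = mid \<and> reals sj ''th'' 0 = ?t)"
      by (rule runs_loopfree) (simp_all add: probe_mid_code_def mid_def a)
    fix st1 assume f1: "frame probe_mid_code st st1" and v1: "ints st1 ''mid'' 0 = mid \<and> reals st1 ''th'' 0 = ?t"
    have i1: "inp st1" by (rule inp_frame[OF inp f1]) (simp add: probe_mid_code_def)
    have s1: "has_supp st1" by (rule has_supp_frame[OF hs f1]) (simp add: probe_mid_code_def)
    have t1: "reals st1 ''th'' 0 = ?t" using v1 by simp
    show "runs (Seq probe_code
     halve_step) st1 M (search_inv s a r')"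
    proof (rule runs_Seq[OF probe_code[OF i1 s1 t1 ne]])
      fix st2 assume f2: "frame probe_code st1 st2" and best: "best_cand ?t st2"
      have i2: "inp st2" by (rule inp_frame[OF i1 f2]) (simp add: probe_defs)
      have s2: "has_supp st2" by (rule has_supp_frame[OF s1 f2]) (simp add: probe_defs)
      have e2: "ints st2 ''lo'' = ints st ''lo''" "ints st2 ''hi'' = ints st ''hi''" "ints st2 ''mid'' 0 = mid"
        "reals st2 ''th'' 0 = ?t" "reals st2 ''beta'' = reals st ''beta''" "reals st2 ''a'' = a"
        using v1 a frameD[OF f1] frameD[OF f2] by (simp_all add: probe_defs probe_mid_code_def)
      have iff: "?t \<le> s \<longleftrightarrow> ?t \<le> reals st2 ''best'' 0"
      proof
        assume "?t \<le> s"
        then obtain c where c: "c < nc" "mem c = 0" "?t \<le> tau ?t c" using s[OF t0] by blast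
        have "tau ?t c \<le> tau ?t (ints st2 ''cmax'' 0)" using best c unfolding best_cand_def by blast
        then show "?t \<le> reals st2 ''best'' 0" using c(3) best unfolding best_cand_def by linarith
      next
        assume le: "?t \<le> reals st2 ''best'' 0"
        have "ints st2 ''cmax'' 0 < nc" "mem (ints st2 ''cmax'' 0) = 0"
          "reals st2 ''best'' 0 = tau ?t (ints st2 ''cmax'' 0)" using best by (auto simp: best_cand_def)
        then show "?t \<le> s" using s[OF t0] le by auto
      qed
      show "runs halve_step st2 M (search_inv s a r')"
      proof (rule runs_Cond)
        assume "bval (RLess (rvar ''best'') (rvar ''th'')) st2"
        then have nxt: "s < ?t" using iff e2 by simp
        let ?p = "setI ''hi'' (ivar ''mid'')"
        have fr: "frame ?p st2 (sem ?p st2)" by (rule frame_loopfree) simp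
        have i3: "inp (sem ?p st2)" by (rule inp_frame[OF i2 fr]) simp
        have s3: "has_supp (sem ?p st2)" by (rule has_supp_frame[OF s2 fr]) simp
        have hi': "s < a x" if "mid \<le> x" "x < k" for x
          using order_less_le_trans[OF nxt, of "a x"] sorted that by blast
        show "runs ?p st2 M (search_inv s a r')"
          by (rule runs_loopfree)
             (use i3 s3 mid midk \<beta> lo hi' in \<open>simp_all add: search_inv_def e2\<close>)
      next
        assume "\<not> bval (RLess (rvar ''best'') (rvar ''th'')) st2"
        then have nxt: "?t \<le> s" using iff e2 by simp
        let ?p = "Seq (setR ''beta'' (rvar ''th'')) (setI ''lo'' (IAdd (ivar ''mid'') (IConst 1)))"
        have fr: "frame ?p st2 (sem ?p st2)" by (rule frame_loopfree) simp
        have i3: "inp (sem ?p st2)" by (rule inp_frame[OF i2 fr]) simp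
        have s3: "has_supp (sem ?p st2)" by (rule has_supp_frame[OF s2 fr]) simp
        have lo': "a x \<le> ?t" if "x < Suc mid" for x
        proof -
          have "x \<le> mid" using that by simp
          then show ?thesis using sorted midk by blast
        qed
        show "runs ?p st2 M (search_inv s a r')"
          by (rule runs_loopfree)
             (use i3 s3 mid hik t0 nxt lo' hi in \<open>simp_all add: search_inv_def e2\<close>)
      qed simp
    qed simp
  qed simp
  then show ?thesis using r' by blast
qed

text \<open>The last conjunct says that no stored support lies above \<beta> and up to
  \<open>s\<close>, so that \<beta> and \<open>s\<close> belong to the same linear piece.\<close>

definition search_result :: "real \<Rightarrow> (nat \<Rightarrow> real) \<Rightarrow> store \<Rightarrow> bool" where
  "search_result s a st' \<longleftrightarrow> (\<exists>\<beta>. best_cand \<beta> st' \<and> 0 \<le> \<beta>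
      \<and> \<beta> \<le> s \<and> (\<forall>x<k. a x \<le> \<beta> \<or> s < a x))"

lemma search_code:
  assumes inp: "inp st" and hs: "has_supp st" and a: "reals st ''a'' = a" and k: "k < 2 ^ r"
    and sorted: "\<forall>x y. x \<le> y \<and> y < k \<longrightarrow> a x \<le> a y" and nonneg: "\<forall>x<k. 0 \<le> a x"
    and s: "\<And>t. 0 \<le> t \<Longrightarrow> t \<le> s \<longleftrightarrow> (\<exists>c<nc. mem c = 0 \<and>
        t \<le> tau t c)" and ne: "\<exists>c<nc. mem c = 0"
    and s0: "0 \<le> s"
  shows "runs search_code st (M * Suc r) (search_result s a)"
  unfolding search_code_def
proof (rule runs_Seq)
  let ?z = "Seq (setI ''lo'' (IConst 0)) (Seq (setI ''hi'' (ivar ''seats'')) (setR ''beta'' rzero))"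
  have fr: "frame ?z st (sem ?z st)" by (rule frame_loopfree) simp
  have i1: "inp (sem ?z st)" by (rule inp_frame[OF inp fr]) simp
  have s1: "has_supp (sem ?z st)" by (rule has_supp_frame[OF hs fr]) simp
  show "runs ?z st (M * Suc r) (search_inv s a r)"
    by (rule runs_loopfree) (use i1 s1 a k s0 inpD[OF inp] in \<open>simp_all add: search_inv_def\<close>)
  fix st1 assume inv: "search_inv s a r st1"
  show "runs (Seq (While (ILess (ivar ''lo'') (ivar ''hi'')) halve_code)
        (Seq (setR ''th'' (rvar ''beta'')) probe_code)) st1 (M * Suc r)
        (search_result s a)"
  proof (rule runs_Seq[OF runs_While[where Inv = "search_inv s a", OF inv]])
    fix r sj assume I: "search_inv s a r sj" and b: "bval (ILess (ivar ''lo'') (ivar ''hi'')) sj"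
    show "\<exists>r'. r = Suc r' \<and> runs halve_code sj M (search_inv s a r')"
      by (rule halve_code[OF I _ sorted nonneg s ne]) (use b in simp_all)
  next
    fix sj assume "\<not> bval (ILess (ivar ''lo'') (ivar ''hi'')) sj \<and> (\<exists>r'. search_inv s a r' sj)"
    then obtain r' where I: "search_inv s a r' sj" and b: "\<not> ints sj ''lo'' 0 < ints sj ''hi'' 0" by auto
    let ?\<beta> = "reals sj ''beta'' 0"
    have i: "inp sj" "has_supp sj" and \<beta>: "0 \<le> ?\<beta>" "?\<beta> \<le> s"
      and lo: "\<forall>x<ints sj ''lo'' 0. a x \<le> ?\<beta>" and hi: "\<forall>x. ints sj ''hi'' 0 \<le> x
          \<and> x < k \<longrightarrow> s < a x"
      using I unfolding search_inv_def by - (elim conjE, assumption)+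
    have sep: "\<forall>x<k. a x \<le> ?\<beta> \<or> s < a x"
    proof (intro allI impI)
      fix x assume "x < k"
      show "a x \<le> ?\<beta> \<or> s < a x"
        using lo hi b \<open>x < k\<close> by (cases "x < ints sj ''lo'' 0") auto
    qed
    show "runs (Seq (setR ''th'' (rvar ''beta'')) probe_code) sj (M * Suc r)
        (search_result s a)"
    proof (rule runs_Seq)
      show "runs (setR ''th'' (rvar ''beta'')) sj (M * Suc r) (\<lambda>\<upsilon>. reals \<upsilon> ''th'' 0 = ?\<beta>)"
        by (rule runs_loopfree) simp_all
      fix st2 assume f2: "frame (setR ''th'' (rvar ''beta'')) sj st2" and t: "reals st2 ''th'' 0 = ?\<beta>"
      have i2: "inp st2" by (rule inp_frame[OF i(1) f2]) simp
      have s2: "has_supp st2" by (rule has_supp_frame[OF i(2) f2]) simp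
      show "runs probe_code st2 (M * Suc r)
        (search_result s a)"
      proof (rule runs_conseq[OF probe_code[OF i2 s2 t ne]])
        fix st3 assume "best_cand ?\<beta> st3"
        then show "search_result s a st3"
          using \<beta> sep unfolding search_result_def by blast
      qed simp
    qed simp
  qed simp_all
qed simp

definition approves :: "nat \<Rightarrow> nat \<Rightarrow> bool" where
  "approves c v \<longleftrightarrow> (\<exists>e<ne. vt e = v \<and> cd e = c)"

definition kept :: "nat \<Rightarrow> nat \<Rightarrow> bool" where
  "kept c0 e \<longleftrightarrow> cd e \<noteq> c0 \<and> 0 < mem (cd e)"

definition scaled :: "nat \<Rightarrow> nat \<Rightarrow> real \<Rightarrow> nat \<Rightarrow> real" where
  "scaled c0 c1 t e = (if kept c0 e
     then (if approves c1 (vt e) \<and> t < csup (cd e) then wt e * t / csup (cd e) else wt e) else 0)"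

definition remainder :: "nat \<Rightarrow> nat \<Rightarrow> real \<Rightarrow> nat \<Rightarrow> real" where
  "remainder c0 c1 t v = str v - (\<Sum>e<ne. if vt e = v \<and> kept c0 e then scaled c0 c1 t e else 0)"

definition new_weight :: "nat \<Rightarrow> nat \<Rightarrow> real \<Rightarrow> nat \<Rightarrow> real" where
  "new_weight c0 c1 t e = (if cd e = c1 then remainder c0 c1 t (vt e) else scaled c0 c1 t e)"

definition updated :: "nat \<Rightarrow> nat \<Rightarrow> real \<Rightarrow> store \<Rightarrow> bool" where
  "updated c0 c1 t st' \<longleftrightarrow> ints st' ''return'' 0 = 0 \<and> ints st' ''member'' = mem(c0 := 0, c1 := 1) \<and>
     (\<forall>e<ne. reals st' ''weight'' e = new_weight c0 c1 t e)"

lemma update_code: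
  assumes inp: "inp st" and hs: "has_supp st" and c: "ints st ''cmin'' 0 = c0" "ints st ''cmax'' 0 = c1"
    and t: "reals st ''best'' 0 = t"
  shows "runs update_code st M (updated c0 c1 t)"
  unfolding update_code_def
proof (rule runs_Seq)
  note D = inpD[OF inp]
  \<comment> \<open>\<open>inp\<close> fails as soon as \<open>member\<close> or
    \<open>weight\<close> is overwritten; this is the part of the state on which all later loops can
    still rely.\<close>
  define const where "const sj \<longleftrightarrow> ints sj ''nedges'' 0 = ne \<and> ints sj ''voter'' = vt
      \<and> ints sj ''cand'' = cd \<and>
     ints sj ''cmax'' 0 = c1 \<and> reals sj ''best'' 0 = t \<and> has_supp sj" for sj
  have constD: "ints sj ''nedges'' 0 = ne" "ints sj ''voter'' = vt" "ints sj ''cand'' = cd"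
     "ints sj ''cmax'' 0 = c1" "reals sj ''best'' 0 = t" "has_supp sj" if "const sj" for sj
    using that by (auto simp: const_def)
  have const_frame: "const sj'" if "const sj" "frame p sj sj'" "''nedges'' \<notin> iwrites p" "''voter'' \<notin>
      iwrites p" "''cand'' \<notin> iwrites p"
    "''cmax'' \<notin> iwrites p" "''best'' \<notin> rwrites p" "''supp'' \<notin> rwrites p" for p sj sj'
    using that(1) unfolding const_def
    by (simp add: frameD(1)[OF that(2)] frameD(2)[OF that(2)] that(3-) has_supp_frame[OF _ that(2) that(8)])
  let ?mem = "mem(c0 := 0)"
  let ?z = "SetI ''member'' (ivar ''cmin'') (IConst 0)"
  show "runs reset_code st M (\<lambda>sj. ints sj ''member'' = ?mem \<and> (\<forall>v<nv. ints sj ''ap'' v = 0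
      \<and> reals sj ''rem'' v = str v))"
    unfolding reset_code_def
  proof (rule runs_Seq)
    show "runs ?z st M (\<lambda>sj. ints sj ''member'' = ?mem)"
      by (rule runs_loopfree) (simp_all add: c D)
    fix st1 assume f: "frame ?z st st1" and m: "ints st1 ''member'' = ?mem"
    have e1: "ints st1 ''nvoters'' 0 = nv" "reals st1 ''strength'' = str" using frameD[OF f] D by simp_all
    let ?Inv = "\<lambda>j sj. ints sj ''member'' = ?mem \<and> (\<forall>v<j. ints sj ''ap'' v = 0 \<and> reals
        sj ''rem'' v = str v)"
    show "runs (For ''nvoters'' init_remainder) st1 M (?Inv nv)"
    proof (rule runs_For[where Inv = ?Inv])
      fix j sj assume inv: "?Inv j sj" and i: "ints sj ''i'' 0 = j" and fr: "frame (For ''nvoters'' init_remainder) st1 sj"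
      have "reals sj ''strength'' = str" using frameD[OF fr] e1 by simp
      then show "?Inv (Suc j) (sem (Seq init_remainder incr) sj)" using inv by (simp add: i less_Suc_eq)
    qed (use e1 m sizes in simp_all)
  qed simp
  fix st1 assume f1: "frame reset_code st st1"
    and r1: "ints st1 ''member'' = ?mem \<and> (\<forall>v<nv. ints st1 ''ap'' v = 0 \<and> reals st1 ''rem'' v = str v)"
  have "const st" using D c t hs by (simp add: const_def)
  then have k1: "const st1" by (rule const_frame[OF _ f1]) (simp_all add: reset_code_def)
  have w1: "reals st1 ''weight'' = wt" using frameD(2)[OF f1] D by (simp add: reset_code_def)
  show "runs (Seq approve_code (Seq scale_code (Seq fill_code
     finish_update))) st1 M (updated c0 c1 t)"
  proof (rule runs_Seq)
    let ?Inv = "\<lambda>j sj. \<forall>v<nv. 0 < ints sj ''ap'' v \<longleftrightarrow> (\<exists>e<j. vt e = v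
        \<and> cd e = c1)"
    show "runs approve_code st1 M (\<lambda>sj. \<forall>v<nv. 0 < ints sj ''ap'' v \<longleftrightarrow> approves c1 v)"
      unfolding approve_code_def approves_def
    proof (rule runs_For[where Inv = ?Inv])
      fix j sj assume j: "j < ne" and inv: "?Inv j sj" and i: "ints sj ''i'' 0 = j" and fr: "frame (For ''nedges''
          approve_voter) st1 sj"
      have "const sj" by (rule const_frame[OF k1 fr]) simp_all
      note T = constD[OF this]
      show "?Inv (Suc j) (sem (Seq approve_voter incr) sj)"
        using inv by (auto simp: i T less_Suc_eq)
    qed (use constD[OF k1] r1 in simp_all)
    fix st2 assume f2: "frame approve_code st1 st2" and ap: "\<forall>v<nv. 0 < ints st2 ''ap'' v
        \<longleftrightarrow> approves c1 v"
    have k2: "const st2" by (rule const_frame[OF k1 f2]) (simp_all add: approve_code_def)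
    have r2: "reals st2 ''weight'' = wt" "ints st2 ''member'' = ?mem" "\<forall>v<nv. reals st2 ''rem'' v = str v"
      using frameD[OF f2] w1 r1 by (simp_all add: approve_code_def)
    show "runs (Seq scale_code (Seq fill_code
     finish_update)) st2 M (updated c0 c1 t)"
    proof (rule runs_Seq)
      let ?s = "scaled c0 c1 t"
      let ?Inv = "\<lambda>j sj. (\<forall>e. reals sj ''weight'' e = (if e < j then ?s e else wt e)) \<and>
         (\<forall>v<nv. reals sj ''rem'' v = str v - (\<Sum>e<j. if vt e = v \<and> kept c0 e then ?s e else 0))"
      show "runs scale_code st2 M (?Inv ne)"
        unfolding scale_code_def
      proof (rule runs_For[where Inv = ?Inv])
        fix j sj assume j: "j < ne" and inv: "?Inv j sj" and i: "ints sj ''i'' 0 = j" and fr: "frame (For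
            ''nedges'' scale_weight) st2 sj"
        have k: "const sj" by (rule const_frame[OF k2 fr]) simp_all
        note T = constD(1-5)[OF k]
        have s: "reals sj ''supp'' (cd j) = csup (cd j)" using constD(6)[OF k] cd_less[OF j] by (simp add: has_supp_def)
        have apj: "0 < ints sj ''ap'' (vt j) \<longleftrightarrow> approves c1 (vt j)" and mj: "ints sj ''member'' = ?mem"
          using frameD(1)[OF fr] ap vt_less[OF j] r2 by simp_all
        have kj: "0 < ?mem (cd j) \<longleftrightarrow> kept c0 j" by (simp add: kept_def)
        have wj: "reals sj ''weight'' j = wt j" using inv by simp
        define sj' where "sj' = sem (Seq scale_weight incr) sj"
        have W: "reals sj' ''weight'' = (reals sj ''weight'')(j := ?s j)"
          using kj apj s wj by (auto simp: sj'_def i T mj scaled_def)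
        have R: "reals sj' ''rem'' = (if kept c0 j then (reals sj ''rem'')(vt j := reals sj ''rem'' (vt j) - ?s j)
            else reals sj ''rem'')"
          using kj apj s wj by (auto simp: sj'_def i T mj scaled_def)
        have "?Inv (Suc j) sj'"
          using inv vt_less[OF j] by (simp add: W R less_Suc_eq)
        then show "?Inv (Suc j) (sem (Seq scale_weight incr) sj)" unfolding sj'_def .
      qed (use constD[OF k2] r2 in simp_all)
      fix st3 assume f3: "frame scale_code st2 st3" and inv3: "?Inv ne st3"
      have k3: "const st3" by (rule const_frame[OF k2 f3]) (simp_all add: scale_code_def)
      have r3: "ints st3 ''member'' = ?mem" using frameD[OF f3] r2 by (simp add: scale_code_def)
      have rem3: "\<forall>v<nv. reals st3 ''rem'' v = remainder c0 c1 t v" using inv3 by (simp add: remainder_def)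
      have w3: "\<forall>e<ne. reals st3 ''weight'' e = ?s e" using inv3 by simp
      show "runs (Seq fill_code
       finish_update) st3 M (updated c0 c1 t)"
      proof (rule runs_Seq)
        let ?Inv = "\<lambda>j sj. \<forall>e<ne. reals sj ''weight'' e = (if e < j then new_weight c0 c1 t e else ?s e)"
        show "runs fill_code st3 M (?Inv ne)"
          unfolding fill_code_def
        proof (rule runs_For[where Inv = ?Inv])
          fix j sj assume j: "j < ne" and inv: "?Inv j sj" and i: "ints sj ''i'' 0 = j" and fr: "frame (For
              ''nedges'' fill_weight) st3 sj"
          have "const sj" by (rule const_frame[OF k3 fr]) simp_all
          note T = constD[OF this]
          have "reals sj ''rem'' (vt j) = remainder c0 c1 t (vt j)"
            using frameD(2)[OF fr] rem3 vt_less[OF j] by simp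
          then show "?Inv (Suc j) (sem (Seq fill_weight incr) sj)"
            using inv by (auto simp: i T less_Suc_eq new_weight_def)
        qed (use constD[OF k3] w3 in simp_all)
        fix st4 assume f4: "frame fill_code st3 st4" and inv4: "?Inv ne st4"
        have k4: "ints st4 ''cmax'' 0 = c1" "ints st4 ''member'' = ?mem"
          using frameD[OF f4] constD[OF k3] r3 by (simp_all add: fill_code_def)
        show "runs finish_update st4 M (updated c0 c1 t)"
          by (rule runs_loopfree) (use inv4 k4 in \<open>simp_all add: updated_def\<close>)
      qed simp
    qed simp
  qed simp
qed simp

end

context instance_data
begin

definition iteration_result :: "real \<Rightarrow> store \<Rightarrow> bool" where
  "iteration_result s st' \<longleftrightarrow> (\<exists>c0 c1 \<beta>. c0 < nc \<and> 0 < mem c0 \<and>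
     (\<forall>c<nc. 0 < mem c \<longrightarrow> csup c0 \<le> csup c) \<and> c1 < nc \<and> mem c1 = 0 \<and>
     (\<forall>c<nc. mem c = 0 \<longrightarrow> tau \<beta> c \<le> tau \<beta> c1) \<and> 0 \<le> \<beta> \<and>
         \<beta> \<le> s \<and>
     (\<forall>c<nc. 0 < mem c \<longrightarrow> csup c \<le> \<beta> \<or> s < csup c) \<and>
     (if tau \<beta> c1 < (1 + eps) * csup c0 \<and> tau \<beta> c1 < (\<Sum>v<nv. str v) / real k
      then ints st' ''return'' 0 = 1 \<and> inp st' else updated c0 c1 (tau \<beta> c1) st'))"

lemma iteration_code:
  assumes inp: "inp st" and mem1: "\<exists>c<nc. 0 < mem c" and mem0: "\<exists>c<nc. mem c = 0"
    and card: "card {c. c < nc \<and> 0 < mem c} = k" and k: "k < 2 ^ r"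
    and nonneg: "\<And>c. c < nc \<Longrightarrow> 0 < mem c \<Longrightarrow> 0 \<le> csup c" and s0: "0 \<le> s"
    and s: "\<And>t. 0 \<le> t \<Longrightarrow> t \<le> s \<longleftrightarrow> (\<exists>c<nc. mem c = 0 \<and>
        t \<le> tau t c)"
  shows "runs iteration_code st (M * Suc r) (iteration_result s)"
    (is "runs _ _ ?M ?Q")
  unfolding iteration_code_def
proof (rule runs_Seq)
  have M: "M \<le> ?M" by simp
  show "runs supports_code st ?M (\<lambda>sj. \<forall>c<nc. reals sj ''supp'' c = csup c)"
    by (rule runs_conseq[OF supports_code[OF inp] M])
  fix st1 assume f1: "frame supports_code st st1" and "\<forall>c<nc. reals st1 ''supp'' c = csup c"
  then have s1: "has_supp st1" by (simp add: has_supp_def)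
  have i1: "inp st1" by (rule inp_frame[OF inp f1]) (simp add: supports_code_def)
  let ?end = "Cond stop_test
          (setI ''return'' (IConst 1)) update_code"
  show "runs (Seq cmin_code (Seq collect_code (Seq sort_code (Seq average_code (Seq search_code ?end))))) st1 ?M ?Q"
  proof (rule runs_Seq[OF runs_conseq[OF cmin_code[OF i1 s1 mem1] M]])
    fix st2 assume f2: "frame cmin_code st1 st2"
      and m2: "ints st2 ''cmin'' 0 < nc \<and> 0 < mem (ints st2 ''cmin'' 0) \<and>
     reals st2 ''tmin'' 0 = csup (ints st2 ''cmin'' 0) \<and>
     (\<forall>c<nc. 0 < mem c \<longrightarrow> csup (ints st2 ''cmin'' 0) \<le> csup c)"
    define c0 where "c0 = ints st2 ''cmin'' 0"
    have c0: "c0 < nc" "0 < mem c0" "\<forall>c<nc. 0 < mem c \<longrightarrow> csup c0 \<le> csup c"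
      and v2: "ints st2 ''cmin'' 0 = c0" "reals st2 ''tmin'' 0 = csup c0"
      using m2 by (auto simp: c0_def)
    have i2: "inp st2" by (rule inp_frame[OF i1 f2]) (simp add: cmin_code_def)
    have s2: "has_supp st2" by (rule has_supp_frame[OF s1 f2]) (simp add: cmin_code_def)
    show "runs (Seq collect_code (Seq sort_code (Seq average_code (Seq search_code ?end)))) st2 ?M ?Q"
    proof (rule runs_Seq[OF runs_conseq[OF collect_code[OF i2 s2 card] M]])
      fix st3 assume f3: "frame collect_code st2 st3"
        and a3: "reals st3 ''a'' ` {..<k} = csup ` {c. c < nc \<and> 0 < mem c}"
      have i3: "inp st3" by (rule inp_frame[OF i2 f3]) (simp add: collect_code_def)
      have s3: "has_supp st3" by (rule has_supp_frame[OF s2 f3]) (simp add: collect_code_def)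
      have v3: "ints st3 ''cmin'' 0 = c0" "reals st3 ''tmin'' 0 = csup c0"
        using frameD[OF f3] v2 by (simp_all add: collect_code_def)
      show "runs (Seq sort_code (Seq average_code (Seq search_code ?end))) st3 ?M ?Q"
      proof (rule runs_Seq[OF sort_code[OF i3 less_imp_le[OF k]]])
        fix st4 assume f4: "frame sort_code st3 st4"
          and a4: "reals st4 ''a'' ` {..<k} = reals st3 ''a'' ` {..<k} \<and>
            (\<forall>x y. x \<le> y \<and> y < k \<longrightarrow> reals st4 ''a'' x \<le> reals st4 ''a'' y)"
        note sdefs = sort_code_def pass_code_def merge_next_code_def merge_pick_code_def
        have i4: "inp st4" by (rule inp_frame[OF i3 f4]) (simp add: sdefs)
        have s4: "has_supp st4" by (rule has_supp_frame[OF s3 f4]) (simp add: sdefs)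
        have v4: "ints st4 ''cmin'' 0 = c0" "reals st4 ''tmin'' 0 = csup c0"
          using frameD[OF f4] v3 by (simp_all add: sdefs)
        define a where "a = reals st4 ''a''"
        have aset: "a ` {..<k} = csup ` {c. c < nc \<and> 0 < mem c}"
          and sorted: "\<forall>x y. x \<le> y \<and> y < k \<longrightarrow> a x \<le> a y" using a3 a4 by (simp_all add: a_def)
        have ann: "\<forall>x<k. 0 \<le> a x"
        proof (intro allI impI)
          fix x assume "x < k"
          then have "a x \<in> csup ` {c. c < nc \<and> 0 < mem c}" unfolding aset[symmetric] by simp
          then show "0 \<le> a x" using nonneg by auto
        qed
        show "runs (Seq average_code (Seq search_code ?end)) st4 ?M ?Q"
        proof (rule runs_Seq[OF runs_conseq[OF average_code[OF i4] M]])
          fix st5 assume f5: "frame average_code st4 st5" and avg: "reals st5 ''avg'' 0 = (\<Sum>v<nv. str v) / real k"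
          have i5: "inp st5" by (rule inp_frame[OF i4 f5]) (simp add: average_code_def)
          have s5: "has_supp st5" by (rule has_supp_frame[OF s4 f5]) (simp add: average_code_def)
          have v5: "ints st5 ''cmin'' 0 = c0" "reals st5 ''tmin'' 0 = csup c0" "reals st5 ''a'' = a"
            using frameD[OF f5] v4 by (simp_all add: average_code_def a_def)
          show "runs (Seq search_code ?end) st5 ?M ?Q"
          proof (rule runs_Seq[OF search_code[OF i5 s5 v5(3) k sorted ann s mem0 s0]])
            fix st6 assume f6: "frame search_code st5 st6"
              and "search_result s a st6"
            then obtain \<beta> where best: "best_cand \<beta> st6" and \<beta>: "0 \<le> \<beta>" "\<beta> \<le>
                s" "\<forall>x<k. a x \<le> \<beta> \<or> s < a x"
              unfolding search_result_def by blast
            note qdefs = search_code_def halve_code_def probe_mid_code_def probe_defs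
            have i6: "inp st6" by (rule inp_frame[OF i5 f6]) (simp add: qdefs)
            have s6: "has_supp st6" by (rule has_supp_frame[OF s5 f6]) (simp add: qdefs)
            have v6: "ints st6 ''cmin'' 0 = c0" "reals st6 ''tmin'' 0 = csup c0" "reals st6 ''avg'' 0 =
                (\<Sum>v<nv. str v) / real k"
              using frameD[OF f6] v5 avg by (simp_all add: qdefs)
            define c1 where "c1 = ints st6 ''cmax'' 0"
            have c1: "c1 < nc" "mem c1 = 0" "\<forall>c<nc. mem c = 0 \<longrightarrow> tau \<beta> c \<le> tau \<beta> c1"
              and b6: "reals st6 ''best'' 0 = tau \<beta> c1" using best by (auto simp: best_cand_def c1_def)
            have sep: "\<forall>c<nc. 0 < mem c \<longrightarrow> csup c \<le> \<beta> \<or> s < csup c"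
            proof (intro allI impI)
              fix c assume "c < nc" "0 < mem c"
              then have "csup c \<in> a ` {..<k}" unfolding aset by simp
              then show "csup c \<le> \<beta> \<or> s < csup c" using \<beta>(3) by auto
            qed
            let ?cond = "tau \<beta> c1 < (1 + eps) * csup c0 \<and> tau \<beta> c1 < (\<Sum>v<nv. str v) / real k"
            have bval: "bval stop_test st6 \<longleftrightarrow> ?cond"
              by (simp add: b6 v6 inpD[OF i6])
            have Q: "?Q sj" if "if ?cond then ints sj ''return'' 0 = 1 \<and> inp sj else updated c0 c1 (tau
                \<beta> c1) sj" for sj
              unfolding iteration_result_def using c0 c1 \<beta>(1,2) sep that by blast
            show "runs ?end st6 ?M ?Q"
            proof (rule runs_Cond)
              assume b: "bval stop_test st6"
              let ?p = "setI ''return'' (IConst 1)"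
              have fr: "frame ?p st6 (sem ?p st6)" by (rule frame_loopfree) simp
              have i7: "inp (sem ?p st6)" by (rule inp_frame[OF i6 fr]) simp
              have c: ?cond using b bval by blast
              have "?Q (sem ?p st6)"
                by (rule Q, subst if_P[OF c]) (use i7 in simp)
              then show "runs ?p st6 ?M ?Q" by (intro runs_loopfree) simp_all
            next
              assume b: "\<not> bval stop_test st6"
              then have c: "\<not> ?cond" using bval by blast
              show "runs update_code st6 ?M ?Q"
                by (rule runs_conseq[OF update_code[OF i6 s6 v6(1) c1_def[symmetric] b6] M])
                   (rule Q, subst if_not_P[OF c])
            qed simp
          qed simp_all
        qed simp_all
      qed simp
    qed simp_all
  qed simp_all
qed simp

lemma frame_iteration_code:
  assumes "frame iteration_code st st'"
  shows "ints st' ''nvoters'' = ints st ''nvoters''" "ints st' ''ncands'' = ints st ''ncands''"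
    "ints st' ''nedges'' = ints st ''nedges''" "ints st' ''seats'' = ints st ''seats''"
    "ints st' ''voter'' = ints st ''voter''" "ints st' ''cand'' = ints st ''cand''"
    "reals st' ''strength'' = reals st ''strength''" "reals st' ''eps'' = reals st ''eps''"
  using frameD[OF assms]
  by (simp_all add: iteration_code_def supports_code_def cmin_code_def collect_code_def average_code_def
      sort_code_def pass_code_def merge_next_code_def merge_pick_code_def search_code_def halve_code_def
      probe_mid_code_def probe_defs update_code_def reset_code_def approve_code_def scale_code_def fill_code_def)

end

section \<open>From stores to elections\<close>

locale encoded_solution = election_instance I for I :: "('v, 'c) election" +
  fixes vs :: "'v list" and cs :: "'c list" and es :: "('v \<times> 'c) list" and \<epsilon> :: real
    and B :: "'c set" and u :: "('v, 'c) weight" and st :: store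
  assumes enc: "encodes vs cs es I \<epsilon> (B, u) st" and sol: "full_solution I B u"
begin

lemma encD:
  "distinct vs" "set vs = voters I" "distinct cs" "set cs = cands I" "distinct es" "set es = edges I"
  "ints st ''nvoters'' 0 = length vs" "ints st ''ncands'' 0 = length cs" "ints st ''nedges'' 0 = length es"
  "ints st ''seats'' 0 = seats I" "reals st ''eps'' 0 = \<epsilon>"
  "i < length vs \<Longrightarrow> reals st ''strength'' i = strength I (vs ! i)"
  "j < length cs \<Longrightarrow> ints st ''member'' j = (if cs ! j \<in> B then 1 else 0)"
  "e < length es \<Longrightarrow> ints st ''voter'' e < length vs" "e < length es \<Longrightarrow> vs ! ints st
      ''voter'' e = fst (es ! e)"
  "e < length es \<Longrightarrow> ints st ''cand'' e < length cs" "e < length es \<Longrightarrow> cs ! ints st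
      ''cand'' e = snd (es ! e)"
  "e < length es \<Longrightarrow> reals st ''weight'' e = u (fst (es ! e)) (snd (es ! e))"
  using enc unfolding encodes_def by simp_all

lemma length_eqs: "length vs = card (voters I)" "length cs = card (cands I)" "length es = card (edges I)"
  using distinct_card encD(1-6) by metis+

lemma finite_edges: "finite (edges I)"
  using finite_subset[OF edges_subset] finite_voters finite_cands by simp

text \<open>No voter is isolated, so the edges project onto all voters. This is what makes loops
  over voters linear in the number of edges.\<close>

lemma card_voters_le: "card (voters I) \<le> card (edges I)"
proof -
  have "voters I \<subseteq> fst ` edges I" using valid by (force simp: valid_election_def)
  then show ?thesis using finite_edges by (meson surj_card_le)
qed

lemma card_cands_le: "card (cands I) \<le> card (edges I)"
proof -
  have "cands I \<subseteq> snd ` edges I" using valid by (force simp: valid_election_def)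
  then show ?thesis using finite_edges by (meson surj_card_le)
qed

sublocale instance_data "length vs" "length cs" "length es" "seats I" "ints st ''voter''" "ints st ''cand''"
  "ints st ''member''" "reals st ''strength''" "reals st ''weight''" \<epsilon>
  by unfold_locales
     (use encD(14,16) card_voters_le card_cands_le seats_less in \<open>simp_all add: length_eqs\<close>)

abbreviation "nc \<equiv> length cs"
abbreviation "nv \<equiv> length vs"
abbreviation "ne \<equiv> length es"
abbreviation "vt \<equiv> ints st ''voter''"
abbreviation "cd \<equiv> ints st ''cand''"
abbreviation "mem \<equiv> ints st ''member''"

lemma inp_self: "inp st"
  using encD(7-11) by (simp add: inp_def)

lemma edge_nth: "e < ne \<Longrightarrow> (fst (es ! e), snd (es ! e)) \<in> edges I"
  using encD(6) nth_mem by fastforce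

lemma cs_nth_in: "j < nc \<Longrightarrow> cs ! j \<in> cands I"
  using encD(4) nth_mem by blast

lemma cd_eq_iff: "e < ne \<Longrightarrow> j < nc \<Longrightarrow> cd e = j \<longleftrightarrow> snd (es ! e) = cs ! j"
  using encD(16)[of e] encD(17)[of e] nth_eq_iff_index_eq[OF encD(3), of "cd e" j] by auto

lemma vt_eq_iff: "e < ne \<Longrightarrow> i < nv \<Longrightarrow> vt e = i \<longleftrightarrow> fst (es ! e) = vs ! i"
  using encD(14)[of e] encD(15)[of e] nth_eq_iff_index_eq[OF encD(1), of "vt e" i] by auto

lemma sum_nth_edges: "(\<Sum>e<ne. h (es ! e)) = (\<Sum>x\<in>edges I. h x)"
  using sum.reindex_bij_betw[OF bij_betw_nth[OF encD(5) refl encD(6)[symmetric]], of h] .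

text \<open>Bridge from sums over positions in the edge list to sums over the graph;
  \<open>f\<close> is constrained only at the edges of the candidate in question.\<close>

lemma sum_at_cand:
  assumes j: "j < nc" and f: "\<And>e. e < ne \<Longrightarrow> cd e = j \<Longrightarrow> f e = g (fst (es ! e))"
  shows "(\<Sum>e<ne. if cd e = j then f e else 0) = (\<Sum>n\<in>voters_of I (cs ! j). g n)"
proof -
  have "(\<Sum>e<ne. if cd e = j then f e else 0) =
      (\<Sum>e<ne. (\<lambda>x. if snd x = cs ! j then g (fst x) else 0) (es ! e))"
    by (rule sum.cong) (use cd_eq_iff[OF _ j] f in auto)
  also have "\<dots> = (\<Sum>x\<in>edges I. if snd x = cs ! j then g (fst x) else 0)"
    by (rule sum_nth_edges)
  also have "\<dots> = (\<Sum>x\<in>{x \<in> edges I. snd x = cs ! j}. g (fst x))"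
    by (rule sum.inter_filter[symmetric]) (rule finite_edges)
  also have "\<dots> = (\<Sum>n\<in>voters_of I (cs ! j). g n)"
    by (rule sum.reindex_bij_witness[of _ "\<lambda>n. (n, cs ! j)" fst]) (auto simp: voters_of_def)
  finally show ?thesis .
qed

lemma sum_at_voter:
  assumes i: "i < nv" and f: "\<And>e. e < ne \<Longrightarrow> vt e = i \<Longrightarrow> f e = g (snd (es ! e))"
  shows "(\<Sum>e<ne. if vt e = i then f e else 0) = (\<Sum>c\<in>cands_of I (vs ! i). g c)"
proof -
  have "(\<Sum>e<ne. if vt e = i then f e else 0) =
      (\<Sum>e<ne. (\<lambda>x. if fst x = vs ! i then g (snd x) else 0) (es ! e))"
    by (rule sum.cong) (use vt_eq_iff[OF _ i] f in auto)
  also have "\<dots> = (\<Sum>x\<in>edges I. if fst x = vs ! i then g (snd x) else 0)"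
    by (rule sum_nth_edges)
  also have "\<dots> = (\<Sum>x\<in>{x \<in> edges I. fst x = vs ! i}. g (snd x))"
    by (rule sum.inter_filter[symmetric]) (rule finite_edges)
  also have "\<dots> = (\<Sum>c\<in>cands_of I (vs ! i). g c)"
    by (rule sum.reindex_bij_witness[of _ "\<lambda>c. (vs ! i, c)" snd]) (auto simp: cands_of_def)
  finally show ?thesis .
qed

lemma csup_eq: "j < nc \<Longrightarrow> csup j = supp I u (cs ! j)"
  unfolding csup_def supp_def
  by (rule sum_at_cand) (use encD(17,18) in auto)

lemma mem_iff: "j < nc \<Longrightarrow> 0 < mem j \<longleftrightarrow> cs ! j \<in> B" "j < nc \<Longrightarrow>
    mem j = 0 \<longleftrightarrow> cs ! j \<notin> B"
  by (simp_all add: encD(13))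

lemma edge_facts:
  assumes "e < ne"
  shows "csup (cd e) = supp I u (snd (es ! e))" "0 < mem (cd e) \<longleftrightarrow> snd (es ! e) \<in> B"
  using csup_eq[OF encD(16)[OF assms]] mem_iff(1)[OF encD(16)[OF assms]] encD(17)[OF assms] by simp_all

lemma P1_eq:
  assumes i: "i < nv"
  shows "P1 t i = strength I (vs ! i) - (\<Sum>c\<in>cands_of I (vs ! i). if c \<in> B \<and> \<not> t < supp I u
      c then u (vs ! i) c else 0)"
proof -
  let ?f = "\<lambda>e. if 0 < mem (cd e) \<and> \<not> t < csup (cd e) then reals st ''weight'' e else 0"
  have "P1 t i = strength I (vs ! i) - (\<Sum>e<ne. if vt e = i then ?f e else 0)"
    unfolding P1_def using encD(12)[OF i] by (simp add: if_if_eq_conj)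
  also have "(\<Sum>e<ne. if vt e = i then ?f e else 0) =
     (\<Sum>c\<in>cands_of I (vs ! i). if c \<in> B \<and> \<not> t < supp I u c then u (vs ! i) c else 0)"
  proof (rule sum_at_voter[OF i])
    fix e assume e: "e < ne" "vt e = i"
    then have "fst (es ! e) = vs ! i" using vt_eq_iff[OF _ i] by blast
    then show "?f e = (if snd (es ! e) \<in> B \<and> \<not> t < supp I u (snd (es ! e)) then u (vs ! i) (snd (es ! e)) else 0)"
      using edge_facts[OF e(1)] encD(18)[OF e(1)] by simp
  qed
  finally show ?thesis .
qed

lemma Q1_eq:
  assumes i: "i < nv"
  shows "Q1 t i = (\<Sum>c\<in>cands_of I (vs ! i). if c \<in> B \<and> t < supp I u c then u (vs ! i) c / supp I u c else 0)"
proof -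
  let ?f = "\<lambda>e. if 0 < mem (cd e) \<and> t < csup (cd e) then reals st ''weight'' e / csup (cd e) else 0"
  have "Q1 t i = (\<Sum>e<ne. if vt e = i then ?f e else 0)"
    unfolding Q1_def by (simp add: if_if_eq_conj)
  also have "\<dots> = (\<Sum>c\<in>cands_of I (vs ! i). if c \<in> B \<and> t < supp I u c then u (vs ! i) c /
      supp I u c else 0)"
  proof (rule sum_at_voter[OF i])
    fix e assume e: "e < ne" "vt e = i"
    then have "fst (es ! e) = vs ! i" using vt_eq_iff[OF _ i] by blast
    then show "?f e = (if snd (es ! e) \<in> B \<and> t < supp I u (snd (es ! e)) then u (vs ! i) (snd (es ! e)) /
        supp I u (snd (es ! e)) else 0)"
      using edge_facts[OF e(1)] encD(18)[OF e(1)] by simp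
  qed
  finally show ?thesis .
qed

lemma feas: "feasible I u"
  by (rule full_solutionD(1)[OF sol])

text \<open>No support lies strictly between \<open>t\<close> and \<open>x\<close>, so the slack is linear between
    the two.\<close>

lemma slack_linear:
  assumes i: "i < nv" and t: "0 \<le> t" "0 \<le> x"
    and sep: "\<And>c. c \<in> B \<Longrightarrow> supp I u c \<le> t \<and> supp I u c \<le> x \<or> t < supp I u
        c \<and> x \<le> supp I u c"
  shows "slack I B u (vs ! i) x = P1 t i - x * Q1 t i"
proof -
  let ?n = "vs ! i"
  have "(\<Sum>c\<in>B \<inter> cands_of I ?n. capped u x ?n c) = (\<Sum>c\<in>cands_of I ?n. if c \<in> B then
      capped u x ?n c else 0)"
    using sum.inter_restrict[OF finite_cands_of[of ?n], of "capped u x ?n" B]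
    by (simp add: Int_commute)
  also have "\<dots> = (\<Sum>c\<in>cands_of I ?n. (if c \<in> B \<and> \<not> t < supp I u c then u ?n c else 0) +
      x * (if c \<in> B \<and> t < supp I u c then u ?n c / supp I u c else 0))"
  proof (rule sum.cong)
    fix c assume "c \<in> cands_of I ?n"
    then have e: "(?n, c) \<in> edges I" by (simp add: in_cands_of)
    show "(if c \<in> B then capped u x ?n c else 0) = (if c \<in> B \<and> \<not> t < supp I u c then u ?n c else 0) +
      x * (if c \<in> B \<and> t < supp I u c then u ?n c / supp I u c else 0)"
    proof (cases "c \<in> B")
      case True
      show ?thesis
      proof (cases "t < supp I u c")
        case True
        then have "capped u x ?n c = x * (u ?n c / supp I u c)"
          using capped_eq[OF feas e t(2)] sep[OF \<open>c \<in> B\<close>] t(1) by (auto simp: field_simps)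
        then show ?thesis using True \<open>c \<in> B\<close> by simp
      next
        case False
        then have "capped u x ?n c = u ?n c"
          using capped_eq[OF feas e t(2)] sep[OF \<open>c \<in> B\<close>] by auto
        then show ?thesis using False \<open>c \<in> B\<close> by simp
      qed
    qed simp
  qed simp
  finally show ?thesis
    unfolding slack_capped P1_eq[OF i] Q1_eq[OF i] by (simp add: sum.distrib sum_distrib_left)
qed

lemma prescore_linear:
  assumes j: "j < nc" and t: "0 \<le> t" "0 \<le> x"
    and sep: "\<And>c. c \<in> B \<Longrightarrow> supp I u c \<le> t \<and> supp I u c \<le> x \<or> t < supp I u
        c \<and> x \<le> supp I u c"
  shows "prescore I B u (cs ! j) x = P2 t j - x * Q2 t j"
proof -
  have "P2 t j - x * Q2 t j = (\<Sum>e<ne. if cd e = j then P1 t (vt e) - x * Q1 t (vt e) else 0)"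
    unfolding P2_def Q2_def sum_distrib_left sum_subtractf[symmetric] by (intro sum.cong) auto
  also have "\<dots> = prescore I B u (cs ! j) x"
    unfolding prescore_def
    by (rule sum_at_cand[OF j]) (use slack_linear[OF encD(14) t sep] encD(15) in simp)
  finally show ?thesis by simp
qed

lemma Q2_nonneg:
  assumes t: "0 \<le> t"
  shows "0 \<le> Q2 t j"
proof -
  have "0 \<le> Q1 t (vt e)" if e: "e < ne" for e
    unfolding Q1_eq[OF encD(14)[OF e]]
    by (intro sum_nonneg) (use t in \<open>auto simp: in_cands_of intro!: divide_nonneg_nonneg weight_nonneg[OF feas]\<close>)
  then show ?thesis unfolding Q2_def by (intro sum_nonneg) auto
qed

text \<open>\<open>tau t j\<close> is the root of \<open>x = P2 t j - x * Q2 t j\<close>, and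
  \<open>1 + Q2 t j\<close> is positive.\<close>

lemma le_tau_iff:
  assumes t: "0 \<le> t"
  shows "x \<le> tau t j \<longleftrightarrow> x \<le> P2 t j - x * Q2 t j"
  using Q2_nonneg[OF t, of j] by (simp add: tau_def field_simps)

text \<open>At \<open>x = t\<close> the linear form is exact wherever the supports lie, so its
  separation condition is trivial here and one probe decides the comparison.\<close>

lemma le_max_score_iff:
  assumes t: "0 \<le> t"
  shows "t \<le> max_score I B u \<longleftrightarrow> (\<exists>j<nc. mem j = 0 \<and> t \<le> tau t j)"
proof -
  have "t \<le> max_score I B u \<longleftrightarrow> (\<exists>c\<in>cands I - B. t \<le> score I B u c)"
    using max_score_less_iff[OF sol, of t] by (meson not_le)
  also have "\<dots> \<longleftrightarrow> (\<exists>j<nc. mem j = 0 \<and> t \<le> score I B u (cs ! j))"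
    using encD(4) mem_iff(2) by (metis (no_types, opaque_lifting) DiffD1 DiffD2 DiffI in_set_conv_nth)
  also have "\<dots> \<longleftrightarrow> (\<exists>j<nc. mem j = 0 \<and> t \<le> tau t j)"
  proof -
    have "t \<le> score I B u (cs ! j) \<longleftrightarrow> t \<le> tau t j" if "j < nc" for j
      unfolding le_score_iff[OF feas t] le_tau_iff[OF t]
      by (subst prescore_linear[OF that t t]) auto
    then show ?thesis by blast
  qed
  finally show ?thesis .
qed

lemma card_members: "card {c. c < nc \<and> 0 < mem c} = seats I"
proof -
  have "bij_betw ((!) cs) {c. c < nc \<and> 0 < mem c} B"
    unfolding bij_betw_def
  proof
    show "inj_on ((!) cs) {c. c < nc \<and> 0 < mem c}" by (auto simp: inj_on_def nth_eq_iff_index_eq[OF encD(3)])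
    show "(!) cs ` {c. c < nc \<and> 0 < mem c} = B"
    proof
      show "(!) cs ` {c. c < nc \<and> 0 < mem c} \<subseteq> B" using mem_iff(1) by auto
      show "B \<subseteq> (!) cs ` {c. c < nc \<and> 0 < mem c}"
      proof
        fix c assume c: "c \<in> B"
        then have "c \<in> set cs" using full_solutionD(2)[OF sol] encD(4) by auto
        then obtain j where "j < nc" "cs ! j = c" by (auto simp: in_set_conv_nth)
        then show "c \<in> (!) cs ` {c. c < nc \<and> 0 < mem c}" using mem_iff(1)[of j] c by auto
      qed
    qed
  qed
  from bij_betw_same_card[OF this] show ?thesis using full_solutionD(3)[OF sol] by simp
qed

lemma sum_strength: "(\<Sum>i<nv. reals st ''strength'' i) = tot_str"
proof -
  have "(\<Sum>i<nv. reals st ''strength'' i) = (\<Sum>i<nv. strength I (vs ! i))"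
    by (rule sum.cong) (simp_all add: encD(12))
  also have "\<dots> = tot_str"
    using sum.reindex_bij_betw[OF bij_betw_nth[OF encD(1) refl encD(2)[symmetric]], of "strength I"] .
  finally show ?thesis .
qed

text \<open>The score of another candidate may lie on a different piece, where its
  \<open>tau\<close> at \<beta> need not be the score. But comparing \<open>tau\<close> with the
  maximum \<open>s\<close> involves only prescores at \<open>s\<close>, where the piece at \<beta>
  is exact: \<open>tau\<close> is at most \<open>s\<close> for all non-members and equals
  \<open>s\<close> for those of maximal score.\<close>

lemma tau_best:
  assumes c1: "c1 < nc" "mem c1 = 0" "\<forall>c<nc. mem c = 0 \<longrightarrow> tau \<beta> c \<le> tau \<beta> c1"
    and \<beta>: "0 \<le> \<beta>" "\<beta> \<le> max_score I B u" "\<forall>c<nc. 0 < mem c \<longrightarrow>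
        csup c \<le> \<beta> \<or> max_score I B u < csup c"
  shows "tau \<beta> c1 = max_score I B u" "score I B u (cs ! c1) = max_score I B u"
proof -
  let ?s = "max_score I B u"
  have s0: "0 \<le> ?s" using \<beta> by linarith
  have sep: "supp I u c \<le> \<beta> \<and> supp I u c \<le> ?s \<or> \<beta> < supp I u c \<and> ?s \<le> supp I
      u c" if c: "c \<in> B" for c
  proof -
    have "c \<in> set cs" using c full_solutionD(2)[OF sol] encD(4) by auto
    then obtain j where j: "j < nc" "cs ! j = c" by (auto simp: in_set_conv_nth)
    then have "csup j \<le> \<beta> \<or> ?s < csup j" using \<beta>(3) mem_iff(1)[of j] c by blast
    then show ?thesis using csup_eq[OF j(1)] j(2) \<beta>(2) by auto
  qed
  have lin: "prescore I B u (cs ! j) ?s = P2 \<beta> j - ?s * Q2 \<beta> j" if "j < nc" for j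
    by (rule prescore_linear[OF that \<beta>(1) s0 sep])
  have Q: "0 < 1 + Q2 \<beta> j" for j using Q2_nonneg[OF \<beta>(1), of j] by linarith
  have tau_s: "tau \<beta> j = ?s \<longleftrightarrow> prescore I B u (cs ! j) ?s = ?s" if "j < nc" for j
  proof -
    have "tau \<beta> j = ?s \<longleftrightarrow> P2 \<beta> j = ?s * (1 + Q2 \<beta> j)"
      unfolding tau_def using Q[of j] by (simp add: divide_eq_eq)
    then show ?thesis unfolding lin[OF that] distrib_left by linarith
  qed
  have le: "tau \<beta> j \<le> ?s" if j: "j < nc" "mem j = 0" for j
  proof -
    have "score I B u (cs ! j) \<le> ?s"
      by (rule score_le_max_score) (use j cs_nth_in mem_iff(2) in auto)
    then have "prescore I B u (cs ! j) ?s \<le> ?s"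
      using prescore_antimono[OF feas, of "score I B u (cs ! j)" ?s B "cs ! j"] score_props(2)[OF feas, of B "cs ! j"] by linarith
    then have "P2 \<beta> j \<le> ?s * (1 + Q2 \<beta> j)" unfolding lin[OF j(1)] distrib_left by linarith
    then show ?thesis unfolding tau_def using Q[of j] by (simp add: divide_le_eq)
  qed
  obtain c where c: "c \<in> cands I - B" "score I B u c = ?s" by (rule max_score_attained[OF sol])
  then have "c \<in> set cs" using encD(4) by simp
  then obtain j where j: "j < nc" "cs ! j = c" by (auto simp: in_set_conv_nth)
  have "tau \<beta> j = ?s" using tau_s[OF j(1)] score_props(2)[OF feas, of B c] c(2) j(2) by simp
  moreover have "tau \<beta> j \<le> tau \<beta> c1" using c1(3) mem_iff(2)[OF j(1)] c(1) j by blast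
  ultimately show t: "tau \<beta> c1 = ?s" using le[OF c1(1,2)] by linarith
  then show "score I B u (cs ! c1) = ?s"
    using tau_s[OF c1(1)] by (intro score_eqI[OF feas s0]) blast
qed

lemma approves_iff: "c1 < nc \<Longrightarrow> i < nv \<Longrightarrow> approves c1 i \<longleftrightarrow> vs ! i
    \<in> voters_of I (cs ! c1)"
proof -
  assume c1: "c1 < nc" and i: "i < nv"
  have "approves c1 i \<longleftrightarrow> (\<exists>e<ne. es ! e = (vs ! i, cs ! c1))"
    unfolding approves_def by (intro ex_cong) (use vt_eq_iff[OF _ i] cd_eq_iff[OF _ c1] in \<open>simp add: prod_eq_iff\<close>)
  also have "\<dots> \<longleftrightarrow> (vs ! i, cs ! c1) \<in> set es" by (simp add: in_set_conv_nth)
  finally show ?thesis using encD(6) by (simp add: in_voters_of)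
qed

lemma new_weight_eq:
  assumes c0: "c0 < nc" and c1: "c1 < nc" and e: "e < ne"
    and u0: "u0 = (\<lambda>n c. if c \<in> B - {cs ! c0} then u n c else 0)"
  shows "new_weight c0 c1 t e = snd (insert_cand I (B - {cs ! c0}) u0 (cs ! c1) t) (fst (es ! e)) (snd (es ! e))"
proof -
  let ?A = "B - {cs ! c0}" and ?c1 = "cs ! c1"
  define w1 where "w1 n c = (if n \<in> voters_of I ?c1 \<and> c \<in> ?A \<inter> cands_of I n \<and> supp I u0 c > t
                      then u0 n c * t / supp I u0 c else u0 n c)" for n c
  have supp0: "supp I u0 c = supp I u c" if "c \<in> ?A" for c
    using that by (simp add: supp_def u0)
  have kept: "kept c0 e \<longleftrightarrow> snd (es ! e) \<in> ?A" if e: "e < ne" for e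
    using cd_eq_iff[OF e c0] edge_facts(2)[OF e] by (auto simp: kept_def)
  have scaled: "scaled c0 c1 t e = w1 (fst (es ! e)) (snd (es ! e))" if e: "e < ne" for e
  proof -
    have "approves c1 (vt e) \<longleftrightarrow> fst (es ! e) \<in> voters_of I ?c1"
      using approves_iff[OF c1 encD(14)[OF e]] encD(15)[OF e] by simp
    moreover have "snd (es ! e) \<in> cands_of I (fst (es ! e))" using edge_nth[OF e] by (simp add: in_cands_of)
    ultimately show ?thesis
      unfolding scaled_def w1_def kept[OF e] edge_facts(1)[OF e] encD(18)[OF e]
      using supp0[of "snd (es ! e)"] by (auto simp: u0)
  qed
  have rem: "remainder c0 c1 t i = strength I (vs ! i) - (\<Sum>d\<in>?A \<inter> cands_of I (vs ! i). w1 (vs ! i) d)"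
    if i: "i < nv" for i
  proof -
    have "(\<Sum>e<ne. if vt e = i \<and> kept c0 e then scaled c0 c1 t e else 0) =
        (\<Sum>e<ne. if vt e = i then (if kept c0 e then scaled c0 c1 t e else 0) else 0)"
      by (intro sum.cong) auto
    also have "\<dots> = (\<Sum>d\<in>cands_of I (vs ! i). if d \<in> ?A then w1 (vs ! i) d else 0)"
    proof (rule sum_at_voter[OF i])
      fix e assume e: "e < ne" "vt e = i"
      then have "fst (es ! e) = vs ! i" using vt_eq_iff[OF _ i] by blast
      then show "(if kept c0 e then scaled c0 c1 t e else 0) = (if snd (es ! e) \<in> ?A then w1 (vs ! i) (snd (es ! e)) else 0)"
        using kept[OF e(1)] scaled[OF e(1)] by simp
    qed
    also have "\<dots> = (\<Sum>d\<in>?A \<inter> cands_of I (vs ! i). w1 (vs ! i) d)"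
      using sum.inter_restrict[OF finite_cands_of[of "vs ! i"], of "w1 (vs ! i)" ?A] by (simp add: Int_commute)
    finally show ?thesis unfolding remainder_def encD(12)[OF i] by simp
  qed
  have ins: "snd (insert_cand I ?A u0 ?c1 t) n c = (if n \<in> voters_of I ?c1 \<and> c = ?c1
      then strength I n - (\<Sum>d\<in>?A \<inter> cands_of I n. w1 n d) else w1 n c)" for n c
    unfolding insert_cand_def Let_def snd_conv w1_def ..
  show ?thesis
  proof (cases "cd e = c1")
    case True
    then have "snd (es ! e) = ?c1" using cd_eq_iff[OF e c1] by simp
    moreover have "fst (es ! e) \<in> voters_of I ?c1"
      using edge_nth[OF e] calculation by (simp add: in_voters_of)
    ultimately show ?thesis
      unfolding new_weight_def ins using True rem[OF encD(14)[OF e]] encD(15)[OF e] by simp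
  next
    case False
    then have "snd (es ! e) \<noteq> ?c1" using cd_eq_iff[OF e c1] by simp
    then show ?thesis unfolding new_weight_def ins using False scaled[OF e] by simp
  qed
qed

lemma iteration_correct:
  assumes A: "card A = seats I" and r: "seats I < 2 ^ r"
  shows "runs iteration_code st (Suc ne * Suc r) (\<lambda>st'.
           ls_stop I (ls_threshold I \<epsilon> A) (B, u) \<and>
              ints st' ''return'' 0 = 1 \<and> encodes vs cs es I \<epsilon> (B, u) st' \<or>
            (\<exists>S'. ls_step I (ls_threshold I \<epsilon> A) (B, u) S' \<and>
              ints st' ''return'' 0 = 0 \<and> encodes vs cs es I \<epsilon> S' st'))" (is "runs _ _ _ ?Q")
proof -
  let ?s = "max_score I B u"
  have mem1: "\<exists>c<nc. 0 < mem c"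
  proof -
    have "{c. c < nc \<and> 0 < mem c} \<noteq> {}" using card_members seats_pos by (metis card.empty less_irrefl)
    then show ?thesis by blast
  qed
  have mem0: "\<exists>c<nc. mem c = 0"
  proof -
    obtain c where "c \<in> cands I - B" using full_solutionD(6)[OF sol] by blast
    moreover then obtain j where "j < nc" "cs ! j = c" using encD(4) by (metis DiffD1 in_set_conv_nth)
    ultimately show ?thesis using mem_iff(2) by auto
  qed
  have nonneg: "0 \<le> csup c" if "c < nc" for c using csup_eq[OF that] supp_nonneg[OF feas] by simp
  show ?thesis
  proof (rule runs_conseq[OF iteration_code[OF inp_self mem1 mem0 card_members r nonneg max_score_nonneg[OF sol]
      le_max_score_iff] order_refl])
    fix st' assume fr: "frame iteration_code st st'"
    assume "iteration_result ?s st'"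
    then obtain c0 c1 \<beta> where c0: "c0 < nc" "0 < mem c0" "\<forall>c<nc. 0 < mem c \<longrightarrow> csup c0 \<le> csup c"
      and c1: "c1 < nc" "mem c1 = 0" "\<forall>c<nc. mem c = 0 \<longrightarrow> tau \<beta> c \<le> tau \<beta> c1"
      and \<beta>: "0 \<le> \<beta>" "\<beta> \<le> ?s" "\<forall>c<nc. 0 < mem c \<longrightarrow> csup c \<le>
          \<beta> \<or> ?s < csup c"
      and res: "if tau \<beta> c1 < (1 + \<epsilon>) * csup c0 \<and> tau \<beta> c1 < (\<Sum>v<nv. reals st
          ''strength'' v) / real (seats I)
      then ints st' ''return'' 0 = 1 \<and> inp st'
      else updated c0 c1 (tau \<beta> c1) st'"
      unfolding iteration_result_def by (elim exE conjE) (rule that)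
    note best = tau_best[OF c1 \<beta>]
    have c0B: "cs ! c0 \<in> B" using mem_iff(1)[OF c0(1)] c0(2) by simp
    have c1B: "cs ! c1 \<in> cands I - B" using mem_iff(2)[OF c1(1)] c1(2) cs_nth_in[OF c1(1)] by simp
    have "supp I u (cs ! c0) \<le> supp_set I u B"
    proof (rule supp_set_geI[OF sol])
      fix c assume c: "c \<in> B"
      then have "c \<in> set cs" using full_solutionD(2)[OF sol] encD(4) by auto
      then obtain j where j: "j < nc" "cs ! j = c" by (auto simp: in_set_conv_nth)
      then have "csup c0 \<le> csup j" using c0(3) mem_iff(1)[of j] c by blast
      then show "supp I u (cs ! c0) \<le> supp I u c" using csup_eq[OF j(1)] csup_eq[OF c0(1)] j(2) by simp
    qed
    then have min: "supp I u (cs ! c0) = supp_set I u B" using supp_set_le[OF sol c0B] by linarith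
    have stop: "ls_stop I (ls_threshold I \<epsilon> A) (B, u) \<longleftrightarrow>
       tau \<beta> c1 < (1 + \<epsilon>) * csup c0 \<and> tau \<beta> c1 < (\<Sum>v<nv. reals st ''strength'' v) / real (seats I)"
      unfolding ls_stop_iff ls_threshold_eq(1)[OF A] best(1) sum_strength csup_eq[OF c0(1)] min by simp
    note same = frame_iteration_code[OF fr]
    show "?Q st'"
    proof (cases "ls_stop I (ls_threshold I \<epsilon> A) (B, u)")
      case True
      then have "ints st' ''return'' 0 = 1" "inp st'" using res unfolding stop[symmetric] by simp_all
      moreover have "encodes vs cs es I \<epsilon> (B, u) st'"
        using enc inpD[OF \<open>inp st'\<close>] unfolding encodes_def by (simp add: encD(10))
      ultimately show ?thesis using True by blast
    next
      case False
      then have res': "ints st' ''return'' 0 = 0" "ints st' ''member'' = mem(c0 := 0, c1 := 1)"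
        "\<And>e. e < ne \<Longrightarrow> reals st' ''weight'' e = new_weight c0 c1 (tau \<beta> c1) e"
        using res unfolding stop[symmetric] updated_def by simp_all
      define u0 where "u0 = (\<lambda>n c. if c \<in> B - {cs ! c0} then u n c else 0)"
      let ?S = "insert_cand I (B - {cs ! c0}) u0 (cs ! c1) ?s"
      have step: "ls_step I (ls_threshold I \<epsilon> A) (B, u) ?S"
        by (rule ls_step.intros[OF c0B min c1B best(2)[symmetric] refl False u0_def])
      have fstS: "fst ?S = B - {cs ! c0} \<union> {cs ! c1}" by (simp add: insert_cand_def Let_def)
      have m: "ints st' ''member'' j = (if cs ! j \<in> fst ?S then 1 else 0)" if j: "j < nc" for j
        unfolding res'(2) fstS
        using encD(13)[OF j] nth_eq_iff_index_eq[OF encD(3) j c0(1)] nth_eq_iff_index_eq[OF encD(3) j c1(1)] by auto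
      have w: "reals st' ''weight'' e = snd ?S (fst (es ! e)) (snd (es ! e))" if e: "e < ne" for e
        unfolding res'(3)[OF e] best(1) by (rule new_weight_eq[OF c0(1) c1(1) e u0_def])
      have "encodes vs cs es I \<epsilon> ?S st'"
        using enc m w unfolding encodes_def same by simp
      then show ?thesis using step res'(1) by blast
    qed
  qed simp_all
qed

end

section \<open>Time bound for an iteration and final assembly\<close>

text \<open>With \<open>n\<close> the rounded-down binary logarithm of \<open>k\<close> and
  \<open>r = n + 1\<close>, there are \<open>n + 2\<close> rounds, at most
  \<open>3 * max 1 (log 2 k)\<close>; and \<open>Suc E\<close> is at most \<open>2 * E\<close>. This
  is the factor 6. The \<open>max 1\<close> accounts for \<open>k = 1\<close>, whose logarithm is
  0.\<close>

lemma iteration_time: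
  assumes "0 < k" "1 \<le> E"
  obtains r where "k < 2 ^ r" "real (Suc E * Suc r) \<le> 6 * (real E * max 1 (log 2 (real k)))"
proof -
  obtain n where n: "2 ^ n \<le> k" "k < 2 ^ (n + 1)" using ex_power_ivl1[of 2 k] assms(1) by auto
  let ?l = "max 1 (log 2 (real k))"
  have "real (2 ^ n) \<le> real k" using n(1) by (simp only: of_nat_le_iff)
  then have "real n \<le> log 2 (real k)" using assms(1) by (simp add: le_log_iff powr_realpow)
  then have "real (Suc (n + 1)) \<le> 3 * ?l" by simp
  moreover have "real (Suc E) \<le> 2 * real E" using assms(2) by simp
  ultimately have "real (Suc E) * real (Suc (n + 1)) \<le> (2 * real E) * (3 * ?l)"
    by (intro mult_mono) auto
  then show ?thesis using that[OF n(2)] by (simp only: of_nat_mult mult.assoc)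
qed

lemma (in election_instance) performs_iteration_code:
  assumes sol: "full S" and A: "card A = seats I"
  shows "performs_iteration iteration_code I \<epsilon> A S
    (6 * real (unit_cost iteration_code) * (real (card (edges I)) * max 1 (log 2 (real (seats I)))))" (is
        "performs_iteration _ _ _ _ _ ?T")
  unfolding performs_iteration_def
proof (intro allI impI)
  fix vs cs es st assume enc: "encodes vs cs es I \<epsilon> S st"
  obtain B u where S: "S = (B, u)" by (cases S)
  interpret encoded_solution I vs cs es \<epsilon> B u st
    using enc sol unfolding S by unfold_locales simp_all
  have "1 \<le> length es" using card_cands_le seats_less by (simp add: length_eqs)
  then obtain r where r: "seats I < 2 ^ r"
    "real (Suc (length es) * Suc r) \<le> 6 * (real (length es) * max 1 (log 2 (real (seats I))))"
    by (rule iteration_time[OF seats_pos])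
  let ?Q = "\<lambda>st'. ls_stop I (ls_threshold I \<epsilon> A) (B, u) \<and>
              ints st' ''return'' 0 = 1 \<and> encodes vs cs es I \<epsilon> (B, u) st' \<or>
            (\<exists>S'. ls_step I (ls_threshold I \<epsilon> A) (B, u) S' \<and>
              ints st' ''return'' 0 = 0 \<and> encodes vs cs es I \<epsilon> S' st')"
  obtain m st' where run: "exec iteration_code st m st'" "m \<le> unit_cost iteration_code * (Suc (length es) * Suc r)" "?Q st'"
    using iteration_correct[OF A r(1)] unfolding runs_def by blast
  have "real m \<le> real (unit_cost iteration_code) * real (Suc (length es) * Suc r)"
    using run(2) by (metis of_nat_le_iff of_nat_mult)
  also have "\<dots> \<le> real (unit_cost iteration_code) * (6 * (real (length es) * max 1 (log 2 (real (seats I)))))"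
    by (rule mult_left_mono[OF r(2)]) simp
  finally have "real m \<le> ?T"
    unfolding length_eqs by (simp add: mult.assoc mult.left_commute)
  then show "\<exists>m st'. exec iteration_code st m st' \<and>
      real m \<le> ?T \<and>
      (ls_stop I (ls_threshold I \<epsilon> A) S \<and> ints st' ''return'' 0 = 1 \<and> encodes vs cs es I \<epsilon> S st' \<or>
       (\<exists>S'. ls_step I (ls_threshold I \<epsilon> A) S S' \<and> ints st' ''return'' 0 = 0 \<and> encodes
           vs cs es I \<epsilon> S' st'))"
    unfolding S using run(1,3) by blast
qed

text \<open>Program and constant are chosen before the instance, so one program with one constant
  serves all elections. Termination is asserted under \<open>0 < OPT I\<close>, respectively
  positive total strength: otherwise the threshold is 0 and the stopping test never succeeds. Bounds
  on executions that do return need no such proviso.\<close>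

theorem theorem9:
  shows "\<exists>(p :: com) (K :: real).
    \<forall>(I :: ('v, 'c) election) (\<epsilon> :: real) (A :: 'c set) (w :: ('v, 'c) weight).
      valid_election I \<and> 0 < \<epsilon> \<and> full_solution I A w \<longrightarrow>
        (0 < OPT I \<longrightarrow> (\<exists>b. ls_terminates_within I (ls_threshold I \<epsilon> A) (A, w) b)) \<and>
        (\<forall>i A' w'. ls_returns I (ls_threshold I \<epsilon> A) (A, w) i (A', w') \<longrightarrow>
           full_solution I A' w' \<and> supp_set I w' A' \<ge> supp_set I w A \<and>
           (let t_hat' = (\<Sum>n\<in>voters I. strength I n) / real (seats I);
                t = min ((1 + \<epsilon>) * supp_set I w' A') t_hat'
            in Max ((\<lambda>c'. prescore I A' w' c' t) ` (cands I - A')) < t \<and>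
               t_PJR I t A' \<and> PJR I A')) \<and>
        (\<forall>\<alpha>\<ge>1. approximation I \<alpha> A w \<longrightarrow>
           (let b = real (seats I) * (1 + log (1 + \<epsilon>) \<alpha>) + 1
            in (\<forall>i S'. ls_returns I (ls_threshold I \<epsilon> A) (A, w) i S' \<longrightarrow> real i \<le> b) \<and>
               (0 < OPT I \<longrightarrow> ls_terminates_within I (ls_threshold I \<epsilon> A) (A, w) b)) \<and>
           (\<forall>j S. (ls_step I (ls_threshold I \<epsilon> A) ^^ j) (A, w) S \<longrightarrow>
              performs_iteration p I \<epsilon> A S
                (K * (real (card (edges I)) * max 1 (log 2 (real (seats I))))))) \<and>
        (\<forall>i A' w'. ls_returns I (ls_threshold_inf I A) (A, w) i (A', w') \<longrightarrow>
           full_solution I A' w' \<and> PJR I A' \<and> i \<le> seats I + 1) \<and>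
        (0 < (\<Sum>n\<in>voters I. strength I n) \<longrightarrow>
           ls_terminates_within I (ls_threshold_inf I A) (A, w) (real (seats I + 1)))"
proof (rule exI[of _ iteration_code], rule exI[of _ "6 * real (unit_cost iteration_code)"],
    intro allI impI, goal_cases)
  case asm: (1 I \<epsilon> A w)
  interpret election_instance I using asm by unfold_locales simp
  have \<epsilon>: "0 < \<epsilon>" and sol: "full_solution I A w" and full: "full (A, w)" using asm by simp_all
  have A: "card A = seats I" by (rule full_solutionD(3)[OF sol])
  let ?\<theta> = "ls_threshold I \<epsilon> A" and ?T = "6 * real (unit_cost iteration_code) * (real (card (edges
      I)) * max 1 (log 2 (real (seats I))))"
  have "\<exists>b. ls_terminates_within I ?\<theta> (A, w) b" if OPT: "0 < OPT I"
  proof -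
    obtain b where b: "\<And>j S'. (ls_step I ?\<theta> ^^ j) (A, w) S' \<Longrightarrow> real j \<le> b"
      using ls_terminates[OF A \<epsilon> full OPT] by blast
    have "ls_terminates_within I ?\<theta> (A, w) (b + 1)"
      by (rule ls_terminates_withinI[OF full]) (use b in fastforce)
    then show ?thesis by blast
  qed
  moreover have "full_solution I A' w' \<and> supp_set I w' A' \<ge> supp_set I w A \<and>
      (let t_hat' = average; t = min ((1 + \<epsilon>) * supp_set I w' A') t_hat'
       in Max ((\<lambda>c'. prescore I A' w' c' t) ` (cands I - A')) < t \<and> t_PJR I t A' \<and> PJR I A')"
    if "ls_returns I ?\<theta> (A, w) i (A', w')" for i A' w'
  proof -
    note R = ls_returns_props[OF A \<epsilon> sol that]
    show ?thesis unfolding Let_def using R(1,2) PJR_if_stop[OF R(1,3)] by simp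
  qed
  moreover have "(let b = real (seats I) * (1 + log (1 + \<epsilon>) \<alpha>) + 1
       in (\<forall>i S'. ls_returns I ?\<theta> (A, w) i S' \<longrightarrow> real i \<le> b) \<and>
          (0 < OPT I \<longrightarrow> ls_terminates_within I ?\<theta> (A, w) b)) \<and>
      (\<forall>j S. (ls_step I ?\<theta> ^^ j) (A, w) S \<longrightarrow> performs_iteration iteration_code I \<epsilon> A S
         ?T)"
    if \<alpha>: "1 \<le> \<alpha>" and apx: "approximation I \<alpha> A w" for \<alpha>
  proof -
    let ?b = "real (seats I) * (1 + log (1 + \<epsilon>) \<alpha>) + 1"
    have "ls_terminates_within I ?\<theta> (A, w) ?b" if OPT: "0 < OPT I"
    proof (rule ls_terminates_withinI[OF full])
      fix j S' assume "(ls_step I ?\<theta> ^^ j) (A, w) S'"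
      then have "real j \<le> real (seats I) * (1 + log (1 + \<epsilon>) \<alpha>)"
        by (intro ls_steps_bound[OF A \<epsilon> full \<alpha> _ OPT]) (use apx in \<open>simp add: approximation_def\<close>)
      then show "real (Suc j) \<le> ?b" by simp
    qed
    moreover have "performs_iteration iteration_code I \<epsilon> A S
         ?T"
      if "(ls_step I ?\<theta> ^^ j) (A, w) S" for j S
      by (rule performs_iteration_code[OF ls_steps_full[OF that full] A])
    ultimately show ?thesis unfolding Let_def using ls_returns_bound[OF A \<epsilon> \<alpha> apx] by blast
  qed
  moreover have "full_solution I A' w' \<and> PJR I A' \<and> i \<le> seats I + 1"
    if "ls_returns I (ls_threshold_inf I A) (A, w) i (A', w')" for i A' w'
    using ls_returns_inf_props[OF A sol that] by blast
  moreover have "ls_terminates_within I (ls_threshold_inf I A) (A, w) (real (seats I + 1))" if "0 < tot_str"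
    by (rule ls_terminates_withinI[OF full]) (use ls_steps_inf_bound[OF A full that] in force)
  ultimately show ?case
    by blast
qed

end
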